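(* Let $K$ be a valued field of equi-characteristic $0$ with valuation $|\cdot|$, considered as a structure in a language $\mathcal L\supset\{+,\cdot,\mathcal O_K\}$. Suppose that $\mathrm{Th}_{\mathcal L}(K)$ is $\omega$-h-minimal and that $|\cdot|_c\colon K\to\Gamma_{K,c}$ is a non-trivial coarsening of the valuation $|\cdot|$ on $K$ with valuation ring $\mathcal O_{K,c}$ (non-trivial meaning $\mathcal O_{K,c}\neq K$). Let $K_c$ be the expansion of $K$ by a predicate for $\mathcal O_{K,c}$, considered as a valued field with the valuation $|\cdot|_c$, and denote by $\mathcal L_c\supset\mathcal L$ the corresponding language. Then $\mathrm{Th}_{\mathcal L_c}(K_c)$ is also $\omega$-h-minimal (with respect to the valuation $|\cdot|_c$).
   Context: Valued fields: valuations are arbitrary non-trivial Krull valuations. $K$ has valuation ring $\mathcal O_K\subsetneq K$; equi-characteristic $0$ means that $K$ and its residue field have characteristic $0$. The value group is written multiplicatively, $\Gamma_K^\times=K^\times/\mathcal O_K^\times$, $\Gamma_K=\Gamma_K^\times\cup\{0\}$, with valuation $|\cdot|\colon K\to\Gamma_K$, $|0|=0$, ordered so that $\mathcal O_K=\{x:|x|\le 1\}$. A coarsening of the valuation is the valuation given by a valuation ring $\mathcal O_{K,c}$ with $\mathcal O_K\subset\mathcal O_{K,c}\subset K$; it is not required to be definable in $\mathcal L$. Leading terms: for $\lambda\le 1$ in $\Gamma_K^\times$ let $\mathrm{RV}_\lambda=K^\times/(1+\{x:|x|<\lambda\})\ \cup\{0\}$ and let $\mathrm{rv}_\lambda\colon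 K\to\mathrm{RV}_\lambda$ be the quotient map on $K^\times$ extended by $0\mapsto 0$. Write $\mathrm{RV}=\mathrm{RV}_1$, $\mathrm{rv}=\mathrm{rv}_1$. Elements of $\mathrm{RV}_\lambda$ are imaginary elements and may be used as parameters. "$A$-definable" means definable with parameters from $A$. Preparation: a finite non-empty set $C\subset K$ $\lambda$-prepares $X\subset K$ if whether $x\in K$ lies in $X$ depends only on the tuple $(\mathrm{rv}_\lambda(x-c))_{c\in C}$. Hensel minimality: for $\ell\ge 0$ an integer or $\omega$, a theory $\mathcal T$ of valued fields of equi-characteristic $0$ in a language containing (symbols for) $\{+,\cdot,\mathcal O_K\}$ is $\ell$-h-minimal if for every model $K\models\mathcal T$, every $\lambda\le1$ in $\Gamma_K^\times$, every $A\subset K$ and every $A'\subset\mathrm{RV}_\lambda$ with $\#A'\le\ell$ (for $\ell=\omega$: $A'$ of cardinality at most $\omega$), every $(A\cup\mathrm{RV}\cup A')$-definable set $X\subset K$ can be $\lambda$-prepared by a finite $A$-definable set $C\subset K$. For $K_c$, the notions $\Gamma_K$, $\mathrm{RV}_\lambda$, etc. in this definition are those of the valuation ring $\mathcal O_{K,c}$. *)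

theory Defs
  imports
    "HOL-Algebra.QuotRing"
    "HOL-Algebra.Subrings"
    "HOL-Library.Extended_Nat"
    "HOL-Library.Countable_Set"
begin

section \<open>First-order logic\<close>

text \<open>All elements of the types \<open>'f\<close> and \<open>'r\<close> are function and relation symbols; constants are
  function symbols of arity 0.\<close>

record ('f, 'r) lang =
  farity :: "'f \<Rightarrow> nat"
  rarity :: "'r \<Rightarrow> nat"

datatype 'f trm = Var nat | Fn 'f "'f trm list"

datatype ('f, 'r) fm =
    Eql "'f trm" "'f trm"
  | Rel 'r "'f trm list"
  | Neg "('f, 'r) fm"
  | Conj "('f, 'r) fm" "('f, 'r) fm"
  | Exi nat "('f, 'r) fm"

fun wf_trm :: "('f, 'r, 'm) lang_scheme \<Rightarrow> 'f trm \<Rightarrow> bool" where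
  "wf_trm L (Var i) \<longleftrightarrow> True"
| "wf_trm L (Fn f ts) \<longleftrightarrow> length ts = farity L f \<and> (\<forall>t\<in>set ts. wf_trm L t)"

primrec wf_fm :: "('f, 'r, 'm) lang_scheme \<Rightarrow> ('f, 'r) fm \<Rightarrow> bool" where
  "wf_fm L (Eql s t) \<longleftrightarrow> wf_trm L s \<and> wf_trm L t"
| "wf_fm L (Rel r ts) \<longleftrightarrow> length ts = rarity L r \<and> (\<forall>t\<in>set ts. wf_trm L t)"
| "wf_fm L (Neg p) \<longleftrightarrow> wf_fm L p"
| "wf_fm L (Conj p q) \<longleftrightarrow> wf_fm L p \<and> wf_fm L q"
| "wf_fm L (Exi i p) \<longleftrightarrow> wf_fm L p"

fun fv_trm :: "'f trm \<Rightarrow> nat set" where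
  "fv_trm (Var i) = {i}"
| "fv_trm (Fn f ts) = \<Union> (fv_trm ` set ts)"

primrec fv :: "('f, 'r) fm \<Rightarrow> nat set" where
  "fv (Eql s t) = fv_trm s \<union> fv_trm t"
| "fv (Rel r ts) = \<Union> (fv_trm ` set ts)"
| "fv (Neg p) = fv p"
| "fv (Conj p q) = fv p \<union> fv q"
| "fv (Exi i p) = fv p - {i}"

text \<open>The universe of a structure is a set, so that a type accommodates structures of every
  cardinality up to its own.\<close>

record ('f, 'r, 'u) struct =
  univ :: "'u set"
  fun_of :: "'f \<Rightarrow> 'u list \<Rightarrow> 'u"
  rel_of :: "'r \<Rightarrow> 'u list \<Rightarrow> bool"

definition tuples :: "('f, 'r, 'u) struct \<Rightarrow> nat \<Rightarrow> 'u list set" where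
  "tuples M n = {xs. length xs = n \<and> set xs \<subseteq> univ M}"

definition wf_struct :: "('f, 'r, 'm) lang_scheme \<Rightarrow> ('f, 'r, 'u) struct \<Rightarrow> bool" where
  "wf_struct L M \<longleftrightarrow> univ M \<noteq> {} \<and> (\<forall>f. \<forall>xs\<in>tuples M (farity L f). fun_of M f xs \<in> univ M)"

primrec tval :: "('f, 'r, 'u) struct \<Rightarrow> (nat \<Rightarrow> 'u) \<Rightarrow> 'f trm \<Rightarrow> 'u" where
  "tval M e (Var i) = e i"
| "tval M e (Fn f ts) = fun_of M f (map (tval M e) ts)"

primrec sat :: "('f, 'r, 'u) struct \<Rightarrow> (nat \<Rightarrow> 'u) \<Rightarrow> ('f, 'r) fm \<Rightarrow> bool" where
  "sat M e (Eql s t) \<longleftrightarrow> tval M e s = tval M e t"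
| "sat M e (Rel r ts) \<longleftrightarrow> rel_of M r (map (tval M e) ts)"
| "sat M e (Neg p) \<longleftrightarrow> \<not> sat M e p"
| "sat M e (Conj p q) \<longleftrightarrow> sat M e p \<and> sat M e q"
| "sat M e (Exi i p) \<longleftrightarrow> (\<exists>x\<in>univ M. sat M (e(i := x)) p)"

definition Th :: "('f, 'r, 'm) lang_scheme \<Rightarrow> ('f, 'r, 'u) struct \<Rightarrow> ('f, 'r) fm set" where
  "Th L M = {p. wf_fm L p \<and> fv p = {} \<and> (\<forall>e. sat M e p)}"

definition models ::
  "('f, 'r, 'm) lang_scheme \<Rightarrow> ('f, 'r, 'u) struct \<Rightarrow> ('f, 'r) fm set \<Rightarrow> bool" where
  "models L M T \<longleftrightarrow> wf_struct L M \<and> (\<forall>p\<in>T. \<forall>e. sat M e p)"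

text \<open>\<open>definable L M P n X\<close>: the relation \<open>X\<close> on the \<open>n\<close>-th power of the universe of \<open>M\<close> is
  definable with parameters from \<open>P\<close>; the variables below \<open>n\<close> are the coordinates and the other
  free variables are evaluated in \<open>P\<close>.\<close>

definition definable ::
  "('f, 'r, 'm) lang_scheme \<Rightarrow> ('f, 'r, 'u) struct \<Rightarrow> 'u set \<Rightarrow> nat \<Rightarrow> 'u list set \<Rightarrow> bool" where
  "definable L M P n X \<longleftrightarrow>
     (\<exists>p e. wf_fm L p \<and> (\<forall>i\<in>fv p. i < n \<or> e i \<in> P) \<and>
            X = {xs \<in> tuples M n. sat M (\<lambda>i. if i < n then xs ! i else e i) p})"

definition definable_set ::
  "('f, 'r, 'm) lang_scheme \<Rightarrow> ('f, 'r, 'u) struct \<Rightarrow> 'u set \<Rightarrow> 'u set \<Rightarrow> bool" where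
  "definable_set L M P X \<longleftrightarrow> definable L M P 1 ((\<lambda>x. [x]) ` X)"


section \<open>Imaginary elements\<close>

text \<open>The structure \<open>M\<^sup>e\<^sup>q\<close>, in one-sorted form. Its imaginary sorts are the equivalence relations
  on powers of the universe that are definable without parameters. The elements are \<open>Inl x\<close> with
  \<open>x\<close> in \<open>M\<close> and \<open>Inr (s, c)\<close> with \<open>c\<close> a class of the sort \<open>s\<close>; the symbol \<open>Inr s\<close> denotes the
  graph of the projection onto the sort \<open>s\<close> (and the empty relation if \<open>s\<close> is not a sort). A
  function symbol applied to a tuple not in the home sort returns the first entry, which makes it
  total without changing the definable sets.\<close>

type_synonym 'u sort = "nat \<times> ('u list \<times> 'u list) set"
type_synonym 'u eq_elem = "'u + 'u sort \<times> 'u list set"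

definition is_sort :: "('f, 'r, 'm) lang_scheme \<Rightarrow> ('f, 'r, 'u) struct \<Rightarrow> 'u sort \<Rightarrow> bool" where
  "is_sort L M s \<longleftrightarrow> (case s of (n, E) \<Rightarrow>
     equiv (tuples M n) E \<and> definable L M {} (n + n) {xs @ ys | xs ys. (xs, ys) \<in> E})"

definition eq_lang :: "('f, 'r, 'm) lang_scheme \<Rightarrow> ('f, 'r + 'u sort) lang" where
  "eq_lang L = \<lparr>farity = farity L, rarity = case_sum (rarity L) (\<lambda>(n, E). n + 1)\<rparr>"

definition eq_struct ::
  "('f, 'r, 'm) lang_scheme \<Rightarrow> ('f, 'r, 'u) struct \<Rightarrow> ('f, 'r + 'u sort, 'u eq_elem) struct" where
  "eq_struct L M = \<lparr>
     univ = Inl ` univ M \<union> {Inr ((n, E), c) | n E c. is_sort L M (n, E) \<and> c \<in> tuples M n // E},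
     fun_of = (\<lambda>f zs. if set zs \<subseteq> range Inl then Inl (fun_of M f (map projl zs)) else hd zs),
     rel_of = (\<lambda>q zs. case q of
         Inl r \<Rightarrow> set zs \<subseteq> range Inl \<and> rel_of M r (map projl zs)
       | Inr (n, E) \<Rightarrow> is_sort L M (n, E) \<and>
           (\<exists>xs\<in>tuples M n. zs = map Inl xs @ [Inr ((n, E), E `` {xs})]))\<rparr>"

text \<open>Definability of a subset of \<open>M\<close> with parameters from \<open>M\<^sup>e\<^sup>q\<close>.\<close>

definition definable_eq ::
  "('f, 'r, 'm) lang_scheme \<Rightarrow> ('f, 'r, 'u) struct \<Rightarrow> 'u eq_elem set \<Rightarrow> 'u set \<Rightarrow> bool" where
  "definable_eq L M P X \<longleftrightarrow> definable_set (eq_lang L) (eq_struct L M) P (Inl ` X)"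


section \<open>Valued fields\<close>

definition valuation_ring :: "('a, 'm) ring_scheme \<Rightarrow> 'a set \<Rightarrow> bool" where
  "valuation_ring R V \<longleftrightarrow>
     subring V R \<and> (\<forall>x\<in>carrier R - {\<zero>\<^bsub>R\<^esub>}. x \<in> V \<or> inv\<^bsub>R\<^esub> x \<in> V)"

definition valued_field :: "('a, 'm) ring_scheme \<Rightarrow> 'a set \<Rightarrow> bool" where
  "valued_field R V \<longleftrightarrow> field R \<and> valuation_ring R V \<and> V \<noteq> carrier R"

definition residue_ring :: "('a, 'm) ring_scheme \<Rightarrow> 'a set \<Rightarrow> 'a set ring" where
  "residue_ring R V = (R\<lparr>carrier := V\<rparr>) Quot (V - Units (R\<lparr>carrier := V\<rparr>))"

definition characteristic_0 :: "('a, 'm) ring_scheme \<Rightarrow> bool" where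
  "characteristic_0 R \<longleftrightarrow> (\<forall>n::nat. n > 0 \<longrightarrow> add_pow R n \<one>\<^bsub>R\<^esub> \<noteq> \<zero>\<^bsub>R\<^esub>)"

definition equichar_0 :: "('a, 'm) ring_scheme \<Rightarrow> 'a set \<Rightarrow> bool" where
  "equichar_0 R V \<longleftrightarrow>
     valued_field R V \<and> characteristic_0 R \<and> characteristic_0 (residue_ring R V)"

text \<open>Values are cosets of the unit group of the valuation ring; the value of 0 is \<open>{0}\<close>.\<close>

definition val :: "('a, 'm) ring_scheme \<Rightarrow> 'a set \<Rightarrow> 'a \<Rightarrow> 'a set" where
  "val R V x = x <#\<^bsub>R\<^esub> Units (R\<lparr>carrier := V\<rparr>)"

definition value_group :: "('a, 'm) ring_scheme \<Rightarrow> 'a set \<Rightarrow> 'a set set" where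
  "value_group R V = val R V ` (carrier R - {\<zero>\<^bsub>R\<^esub>})"

definition val_le :: "('a, 'm) ring_scheme \<Rightarrow> 'a set \<Rightarrow> 'a set \<Rightarrow> 'a set \<Rightarrow> bool" where
  "val_le R V \<kappa> \<mu> \<longleftrightarrow> (\<exists>x\<in>\<kappa>. \<exists>y\<in>\<mu>. x \<in> y <#\<^bsub>R\<^esub> V)"

definition val_less :: "('a, 'm) ring_scheme \<Rightarrow> 'a set \<Rightarrow> 'a set \<Rightarrow> 'a set \<Rightarrow> bool" where
  "val_less R V \<kappa> \<mu> \<longleftrightarrow> val_le R V \<kappa> \<mu> \<and> \<kappa> \<noteq> \<mu>"

text \<open>Leading terms are cosets as well; the extra element 0 of \<open>RV\<close> is the set \<open>{0}\<close>.\<close>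

definition rv :: "('a, 'm) ring_scheme \<Rightarrow> 'a set \<Rightarrow> 'a set \<Rightarrow> 'a \<Rightarrow> 'a set" where
  "rv R V \<kappa> x =
     x <#\<^bsub>R\<^esub> {\<one>\<^bsub>R\<^esub> \<oplus>\<^bsub>R\<^esub> y | y. y \<in> carrier R \<and> val_less R V (val R V y) \<kappa>}"

definition RV :: "('a, 'm) ring_scheme \<Rightarrow> 'a set \<Rightarrow> 'a set \<Rightarrow> 'a set set" where
  "RV R V \<kappa> = rv R V \<kappa> ` carrier R"

definition prepares ::
  "('a, 'm) ring_scheme \<Rightarrow> 'a set \<Rightarrow> 'a set \<Rightarrow> 'a set \<Rightarrow> 'a set \<Rightarrow> bool" where
  "prepares R V \<kappa> C X \<longleftrightarrow> finite C \<and> C \<noteq> {} \<and> C \<subseteq> carrier R \<and>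
     (\<forall>x\<in>carrier R. \<forall>x'\<in>carrier R.
        (\<forall>c\<in>C. rv R V \<kappa> (x \<ominus>\<^bsub>R\<^esub> c) = rv R V \<kappa> (x' \<ominus>\<^bsub>R\<^esub> c)) \<longrightarrow>
        (x \<in> X \<longleftrightarrow> x' \<in> X))"


section \<open>Valued fields as structures\<close>

record ('f, 'r) vlang = "('f, 'r) lang" +
  plus_sym :: 'f
  times_sym :: 'f
  vring_sym :: 'r

definition wf_vlang :: "('f, 'r) vlang \<Rightarrow> bool" where
  "wf_vlang L \<longleftrightarrow>
     farity L (plus_sym L) = 2 \<and> farity L (times_sym L) = 2 \<and> rarity L (vring_sym L) = 1"

definition fld :: "('f, 'r) vlang \<Rightarrow> ('f, 'r, 'u) struct \<Rightarrow> 'u ring" where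
  "fld L M = \<lparr>
     carrier = univ M,
     mult = (\<lambda>x y. fun_of M (times_sym L) [x, y]),
     one = (THE u. u \<in> univ M \<and> (\<forall>x\<in>univ M. fun_of M (times_sym L) [u, x] = x)),
     zero = (THE z. z \<in> univ M \<and> (\<forall>x\<in>univ M. fun_of M (plus_sym L) [z, x] = x)),
     add = (\<lambda>x y. fun_of M (plus_sym L) [x, y])\<rparr>"

definition vring :: "('f, 'r) vlang \<Rightarrow> ('f, 'r, 'u) struct \<Rightarrow> 'u set" where
  "vring L M = {x \<in> univ M. rel_of M (vring_sym L) [x]}"

text \<open>All \<open>RV\<^sub>\<lambda>\<close> with \<open>\<lambda> \<le> 1\<close> together form one imaginary sort: the leading term \<open>rv\<^sub>\<lambda> x\<close> is the class
  of the pair \<open>(x, l)\<close> for any \<open>l\<close> of value \<open>\<lambda>\<close>. The pairs whose second entry does not have a value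
  in \<open>(0, 1]\<close> form one additional, irrelevant class.\<close>

definition rv_radius :: "('f, 'r) vlang \<Rightarrow> ('f, 'r, 'u) struct \<Rightarrow> 'u \<Rightarrow> bool" where
  "rv_radius L M l \<longleftrightarrow> (let R = fld L M; V = vring L M in
     l \<noteq> \<zero>\<^bsub>R\<^esub> \<and> val_le R V (val R V l) (val R V \<one>\<^bsub>R\<^esub>))"

definition rv_sort :: "('f, 'r) vlang \<Rightarrow> ('f, 'r, 'u) struct \<Rightarrow> 'u sort" where
  "rv_sort L M = (let R = fld L M; V = vring L M in
     (2, {([x, l], [x', l']) | x l x' l'.
            x \<in> univ M \<and> l \<in> univ M \<and> x' \<in> univ M \<and> l' \<in> univ M \<and>
            (rv_radius L M l \<and> rv_radius L M l' \<and> val R V l = val R V l' \<and>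
               rv R V (val R V l) x = rv R V (val R V l') x' \<or>
             \<not> rv_radius L M l \<and> \<not> rv_radius L M l')}))"

text \<open>The elements of \<open>M\<^sup>e\<^sup>q\<close> given by a set \<open>S\<close> of elements of \<open>RV\<^sub>\<kappa>\<close>.\<close>

definition rv_imag ::
  "('f, 'r) vlang \<Rightarrow> ('f, 'r, 'u) struct \<Rightarrow> 'u set \<Rightarrow> 'u set set \<Rightarrow> 'u eq_elem set" where
  "rv_imag L M \<kappa> S = (let R = fld L M; V = vring L M in
     {Inr (rv_sort L M, snd (rv_sort L M) `` {[x, l]}) | x l.
        x \<in> univ M \<and> l \<in> univ M \<and> val R V l = \<kappa> \<and> rv R V \<kappa> x \<in> S})"

text \<open>The cardinality bound for an integer or \<open>\<omega>\<close>, the latter written \<open>\<infinity>\<close>.\<close>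

definition card_at_most :: "'a set \<Rightarrow> enat \<Rightarrow> bool" where
  "card_at_most A ell \<longleftrightarrow> (case ell of enat n \<Rightarrow> finite A \<and> card A \<le> n | \<infinity> \<Rightarrow> countable A)"

text \<open>Hensel minimality of a theory \<open>T\<close>. HOL cannot quantify over types inside a formula, so the
  type \<open>'u\<close> from which the models are taken is a parameter. By the downward Loewenheim-Skolem theorem
  the notion does not depend on it once \<open>'u\<close> is infinite and has at least as many elements as the
  language has symbols: if preparation fails in some model, the finitely many parameters involved
  lie in an elementary submodel no larger than that, in which preparation fails too.\<close>

definition h_minimal ::
  "'u itself \<Rightarrow> enat \<Rightarrow> ('f, 'r) vlang \<Rightarrow> ('f, 'r) fm set \<Rightarrow> bool" where
  "h_minimal _ ell L T \<longleftrightarrow>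
     (\<forall>M::('f, 'r, 'u) struct. models L M T \<longrightarrow> (let R = fld L M; V = vring L M; \<iota> = val R V \<one>\<^bsub>R\<^esub> in
        equichar_0 R V \<and>
        (\<forall>\<kappa>\<in>value_group R V. val_le R V \<kappa> \<iota> \<longrightarrow>
          (\<forall>A A' X. A \<subseteq> univ M \<and> A' \<subseteq> RV R V \<kappa> \<and> card_at_most A' ell \<and> X \<subseteq> univ M \<and>
             definable_eq L M (Inl ` A \<union> rv_imag L M \<iota> (RV R V \<iota>) \<union> rv_imag L M \<kappa> A') X \<longrightarrow>
             (\<exists>C. definable_set L M A C \<and> prepares R V \<kappa> C X)))))"


section \<open>Expansion by a new valuation ring\<close>

text \<open>The new predicate is \<open>None\<close>, and it becomes the symbol for the valuation ring; the predicate
  for the old valuation ring is still part of the language.\<close>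

definition coarse_lang :: "('f, 'r) vlang \<Rightarrow> ('f, 'r option) vlang" where
  "coarse_lang L = \<lparr>farity = farity L, rarity = case_option 1 (rarity L),
     plus_sym = plus_sym L, times_sym = times_sym L, vring_sym = None\<rparr>"

definition expand :: "('f, 'r, 'u) struct \<Rightarrow> 'u set \<Rightarrow> ('f, 'r option, 'u) struct" where
  "expand M V = \<lparr>univ = univ M, fun_of = fun_of M,
     rel_of = (\<lambda>q xs. case q of None \<Rightarrow> \<exists>x\<in>V. xs = [x] | Some r \<Rightarrow> rel_of M r xs)\<rparr>"

end

theory Submission
  imports Defs "HOL-Library.Nat_Bijection"
begin

text \<open>By compactness, the finite preparing sets of a definable family are given uniformly by one formula.
  Hence, for a definable set of tuples of leading terms that depends on field elements \<open>f\<close>, the sets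
  belonging to all \<open>f(i := y)\<close> can be read off from another such set that depends on \<open>f\<close> only: \<open>y\<close>
  matters only through its nearest preparing points and the leading term of the difference. So the relations
  ``\<open>f\<close> and \<open>f'\<close> define the same set of tuples of leading terms of radius \<open>l\<close>'' admit a back and forth.
  Membership in the coarse valuation ring and equality of coarse leading terms are respected by them as
  well, and by induction so are all formulas of the expanded language, imaginary elements included. It
  follows that a set definable in the expansion has a finite set of points such that membership of \<open>x\<close> depends
  only on its leading terms of radius \<open>l\<close> relative to these points, for every small enough radius \<open>l\<close> of the fine
  valuation. Elements with the same coarse leading terms have the same leading terms for a suitable \<open>l\<close>
  of this kind, so the same points prepare the set coarsely.\<close>

section \<open>Renaming, de Bruijn quantifiers\<close>

text \<open>The coarse ring is an arbitrary predicate on the L-structure, so h-minimality says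
  nothing directly about sets defined with it. What survives the expansion is a back and forth
  between environments, and for this the preparing points must be uniform in two ways. They depend
  on field elements only, not on leading terms; this keeps the final set definable over A. And one
  formula serves every radius at once: the fine radius at which x and x' are compared is found only
  after both are known, whereas the preparing set has to precede them. Each quantifier increases the
  number of leading terms that a family speaks about, so the induction needs preparation with
  unboundedly many leading-term parameters. The coarse leading terms among the parameters of the set
  are treated as further quantified variables: when x moves to x', their representatives move along
  to elements with the same coarse leading terms, and the imaginary parameters stay fixed. Other
  elements of M^eq are likewise followed through representing tuples in the field.\<close>

lemma tval_cong: "(\<And>i. i \<in> fv_trm t \<Longrightarrow> e i = e' i) \<Longrightarrow> tval M e t = tval M e' t"
proof (induction t)
  case (Fn f ts)
  have "map (tval M e) ts = map (tval M e') ts"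
    using Fn by (intro map_cong refl Fn.IH) auto
  then show ?case by (simp only: tval.simps)
qed auto

lemma sat_cong: "(\<And>i. i \<in> fv p \<Longrightarrow> e i = e' i) \<Longrightarrow> sat M e p = sat M e' p"
proof (induction p arbitrary: e e')
  case (Eql s t)
  then have "tval M e s = tval M e' s" "tval M e t = tval M e' t"
    by (auto intro!: tval_cong)
  then show ?case by simp
next
  case (Rel r ts)
  have "map (tval M e) ts = map (tval M e') ts"
    using Rel by (intro map_cong refl tval_cong) auto
  then show ?case by (simp only: sat.simps)
next
  case (Neg p)
  have "sat M e p = sat M e' p"
    by (rule Neg.IH) (use Neg.prems in simp)
  then show ?case by simp
next
  case (Conj p q)
  have "sat M e p = sat M e' p" "sat M e q = sat M e' q"
    by (rule Conj.IH; use Conj.prems in simp)+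
  then show ?case by simp
next
  case (Exi k p)
  have "sat M (e(k := x)) p = sat M (e'(k := x)) p" for x
    by (rule Exi.IH) (use Exi.prems in auto)
  then show ?case by simp
qed

lemma finite_fv_trm: "finite (fv_trm t)"
  by (induction t) auto

lemma finite_fv: "finite (fv p)"
  by (induction p) (auto simp: finite_fv_trm)

text \<open>Above the whole set and not merely outside it: the same constant later bounds the free
  variables of a formula, which fixes the arguments of Skolem functions and the number of leading
  terms to be named.\<close>

definition fresh :: "nat set \<Rightarrow> nat" where
  "fresh S = Suc (Max (insert 0 S))"

lemma fresh_greater: "finite S \<Longrightarrow> i \<in> S \<Longrightarrow> i < fresh S"
  unfolding fresh_def by (simp add: le_imp_less_Suc)

lemma fresh_notin: "finite S \<Longrightarrow> fresh S \<notin> S"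
  using fresh_greater by blast

primrec ren_trm :: "(nat \<Rightarrow> nat) \<Rightarrow> 'f trm \<Rightarrow> 'f trm" where
  "ren_trm \<sigma> (Var i) = Var (\<sigma> i)"
| "ren_trm \<sigma> (Fn f ts) = Fn f (map (ren_trm \<sigma>) ts)"

text \<open>The map on variables need not be injective: a bound variable is moved above the images
  of the free ones, so nothing is captured.\<close>

primrec ren :: "(nat \<Rightarrow> nat) \<Rightarrow> ('f, 'r) fm \<Rightarrow> ('f, 'r) fm" where
  "ren \<sigma> (Eql s t) = Eql (ren_trm \<sigma> s) (ren_trm \<sigma> t)"
| "ren \<sigma> (Rel r ts) = Rel r (map (ren_trm \<sigma>) ts)"
| "ren \<sigma> (Neg p) = Neg (ren \<sigma> p)"
| "ren \<sigma> (Conj p q) = Conj (ren \<sigma> p) (ren \<sigma> q)"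
| "ren \<sigma> (Exi i p) = (let k = fresh (\<sigma> ` (fv p - {i})) in Exi k (ren (\<sigma>(i := k)) p))"

lemma tval_ren_trm [simp]: "tval M e (ren_trm \<sigma> t) = tval M (\<lambda>i. e (\<sigma> i)) t"
  by (induction t) (auto simp: comp_def cong: map_cong)

lemma sat_ren [simp]: "sat M e (ren \<sigma> p) = sat M (\<lambda>i. e (\<sigma> i)) p"
proof (induction p arbitrary: \<sigma> e)
  case (Exi i p)
  define k where "k = fresh (\<sigma> ` (fv p - {i}))"
  have k: "k \<notin> \<sigma> ` (fv p - {i})"
    unfolding k_def by (rule fresh_notin) (simp add: finite_fv)
  have "sat M (\<lambda>j. (e(k := x)) ((\<sigma>(i := k)) j)) p = sat M ((\<lambda>j. e (\<sigma> j))(i := x)) p" for x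
    by (rule sat_cong) (use k in auto)
  then show ?case using Exi by (simp add: Let_def flip: k_def)
qed (auto simp: comp_def cong: map_cong)

lemma fv_ren_trm: "fv_trm (ren_trm \<sigma> t) = \<sigma> ` fv_trm t"
  by (induction t) auto

lemma fv_ren: "fv (ren \<sigma> p) \<subseteq> \<sigma> ` fv p"
proof (induction p arbitrary: \<sigma>)
  case (Exi i p)
  define k where "k = fresh (\<sigma> ` (fv p - {i}))"
  have "fv (ren (\<sigma>(i := k)) p) \<subseteq> (\<sigma>(i := k)) ` fv p" by (rule Exi)
  then show ?case by (auto simp: Let_def split: if_splits simp flip: k_def)
qed (auto simp: fv_ren_trm; blast)+

lemma wf_ren_trm [simp]: "wf_trm L (ren_trm \<sigma> t) = wf_trm L t"
  by (induction t) auto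

lemma wf_ren [simp]: "wf_fm L (ren \<sigma> p) = wf_fm L p"
  by (induction p arbitrary: \<sigma>) (auto simp: Let_def)

text \<open>A de Bruijn quantifier on top of the named syntax: the body is read in the environment
  \<open>case_nat y e\<close>, and explicit formulas need no choice of names.\<close>

definition ExB :: "('f, 'r) fm \<Rightarrow> ('f, 'r) fm" where
  "ExB p = (let k = fresh (fv p) in Exi k (ren (case_nat k (\<lambda>i. i)) p))"

definition Disj :: "('f, 'r) fm \<Rightarrow> ('f, 'r) fm \<Rightarrow> ('f, 'r) fm" where
  "Disj p q = Neg (Conj (Neg p) (Neg q))"

definition Imp :: "('f, 'r) fm \<Rightarrow> ('f, 'r) fm \<Rightarrow> ('f, 'r) fm" where
  "Imp p q = Neg (Conj p (Neg q))"

definition Iff :: "('f, 'r) fm \<Rightarrow> ('f, 'r) fm \<Rightarrow> ('f, 'r) fm" where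
  "Iff p q = Conj (Imp p q) (Imp q p)"

definition AllB :: "('f, 'r) fm \<Rightarrow> ('f, 'r) fm" where
  "AllB p = Neg (ExB (Neg p))"

definition Tru :: "('f, 'r) fm" where
  "Tru = Eql (Var 0) (Var 0)"

text \<open>The empty conjunction is a closed true sentence and contributes no free
  variable.\<close>

primrec Conjs :: "('f, 'r) fm list \<Rightarrow> ('f, 'r) fm" where
  "Conjs [] = Neg (Exi 0 (Neg (Eql (Var 0) (Var 0))))"
| "Conjs (p # ps) = Conj p (Conjs ps)"

primrec exis :: "nat list \<Rightarrow> ('f, 'r) fm \<Rightarrow> ('f, 'r) fm" where
  "exis [] p = p"
| "exis (v # vs) p = Exi v (exis vs p)"

lemma sat_ExB [simp]: "sat M e (ExB p) \<longleftrightarrow> (\<exists>y\<in>univ M. sat M (case_nat y e) p)"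
proof -
  define k where "k = fresh (fv p)"
  have "sat M (\<lambda>i. (e(k := y)) (case_nat k (\<lambda>i. i) i)) p = sat M (case_nat y e) p" for y
  proof (rule sat_cong)
    fix i assume i: "i \<in> fv p"
    then have "i < k" unfolding k_def by (intro fresh_greater finite_fv)
    then show "(e(k := y)) (case_nat k (\<lambda>i. i) i) = case_nat y e i"
      by (auto split: nat.split)
  qed
  then show ?thesis by (simp add: ExB_def Let_def flip: k_def)
qed

lemma fv_ExB: "fv (ExB p) \<subseteq> {i. Suc i \<in> fv p}"
  unfolding ExB_def Let_def using fv_ren[of "case_nat (fresh (fv p)) (\<lambda>i. i)" p]
  by (auto split: nat.splits)

lemma sat_connectives [simp]:
  "sat M e (Disj p q) \<longleftrightarrow> sat M e p \<or> sat M e q"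
  "sat M e (Imp p q) \<longleftrightarrow> (sat M e p \<longrightarrow> sat M e q)"
  "sat M e (Iff p q) \<longleftrightarrow> (sat M e p \<longleftrightarrow> sat M e q)"
  "sat M e (AllB p) \<longleftrightarrow> (\<forall>y\<in>univ M. sat M (case_nat y e) p)"
  by (auto simp: Disj_def Imp_def Iff_def AllB_def)

lemma sat_Conjs [simp]: "sat M e (Conjs ps) \<longleftrightarrow> (\<forall>p\<in>set ps. sat M e p)"
  by (induction ps) auto

lemma sat_exis: "sat M e (exis vs p) \<longleftrightarrow>
  (\<exists>e'. (\<forall>i\<in>set vs. e' i \<in> univ M) \<and> (\<forall>i. i \<notin> set vs \<longrightarrow> e' i = e i) \<and> sat M e' p)"
proof (induction vs arbitrary: e)
  case Nil
  have "(\<forall>i. e' i = e i) \<longleftrightarrow> e' = e" for e' by auto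
  then show ?case by simp
next
  case (Cons v vs)
  show ?case
  proof
    assume "sat M e (exis (v # vs) p)"
    then obtain x e' where "x \<in> univ M" "\<forall>i\<in>set vs. e' i \<in> univ M"
      "\<forall>i. i \<notin> set vs \<longrightarrow> e' i = (e(v := x)) i" "sat M e' p"
      by (auto simp: Cons.IH)
    then show "\<exists>e'. (\<forall>i\<in>set (v # vs). e' i \<in> univ M) \<and> (\<forall>i. i \<notin> set (v # vs) \<longrightarrow> e' i = e i) \<and> sat M e' p"
      by (intro exI[of _ e']) (cases "v \<in> set vs"; auto)
  next
    assume "\<exists>e'. (\<forall>i\<in>set (v # vs). e' i \<in> univ M) \<and> (\<forall>i. i \<notin> set (v # vs) \<longrightarrow> e' i = e i) \<and> sat M e' p"
    then obtain e' where "\<forall>i\<in>set (v # vs). e' i \<in> univ M" "\<forall>i. i \<notin> set (v # vs) \<longrightarrow> e' i = e i" "sat M e' p"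
      by blast
    then show "sat M e (exis (v # vs) p)"
      by (simp add: Cons.IH) (rule bexI[of _ "e' v"], rule exI[of _ e'], auto)
  qed
qed

lemma fv_exis [simp]: "fv (exis vs p) = fv p - set vs"
  by (induction vs) auto

lemma wf_connectives [simp]:
  "wf_fm L (ExB p) = wf_fm L p" "wf_fm L (AllB p) = wf_fm L p"
  "wf_fm L (Disj p q) = (wf_fm L p \<and> wf_fm L q)"
  "wf_fm L (Imp p q) = (wf_fm L p \<and> wf_fm L q)"
  "wf_fm L (Iff p q) = (wf_fm L p \<and> wf_fm L q)"
  "wf_fm L (Conjs ps) = (\<forall>p\<in>set ps. wf_fm L p)"
  "wf_fm L (exis vs p) = wf_fm L p"
proof -
  show "wf_fm L (Conjs ps) = (\<forall>p\<in>set ps. wf_fm L p)" by (induction ps) auto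
  show "wf_fm L (exis vs p) = wf_fm L p" by (induction vs) auto
qed (auto simp: ExB_def AllB_def Disj_def Imp_def Iff_def Let_def)

lemma fv_connectives [simp]:
  "fv (Disj p q) = fv p \<union> fv q" "fv (Imp p q) = fv p \<union> fv q" "fv (Iff p q) = fv p \<union> fv q"
  by (auto simp: Disj_def Imp_def Iff_def)

text \<open>At most m + 1 solutions means that some element can be removed so that at most m remain.
  The renaming makes room for the removed element, which becomes variable 1.\<close>

primrec AtMost :: "nat \<Rightarrow> ('f, 'r) fm \<Rightarrow> ('f, 'r) fm" where
  "AtMost 0 p = Neg (ExB p)"
| "AtMost (Suc m) p = ExB (AtMost m (Conj (ren (case_nat 0 (\<lambda>i. Suc (Suc i))) p) (Neg (Eql (Var 0) (Var 1)))))"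

lemma wf_AtMost [simp]: "wf_fm L (AtMost m p) = wf_fm L p"
  by (induction m arbitrary: p) auto

lemma case_nat_ren: "(\<lambda>i. case_nat y (case_nat x e) (case_nat 0 (\<lambda>i. Suc (Suc i)) i)) = case_nat y e"
  by (auto split: nat.split)

lemma sat_AtMost:
  assumes "univ M \<noteq> {}"
  shows "sat M e (AtMost m p) \<longleftrightarrow>
    finite {y \<in> univ M. sat M (case_nat y e) p} \<and> card {y \<in> univ M. sat M (case_nat y e) p} \<le> m"
proof (induction m arbitrary: p e)
  case 0
  show ?case
  proof (cases "{y \<in> univ M. sat M (case_nat y e) p} = {}")
    case True
    then have "\<forall>y\<in>univ M. \<not> sat M (case_nat y e) p" by blast
    then show ?thesis by (simp only: True) simp
  next
    case False
    then have "\<exists>y\<in>univ M. sat M (case_nat y e) p" by blast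
    with False show ?thesis by (simp only: AtMost.simps sat.simps sat_ExB le_0_eq card_eq_0_iff) blast
  qed
next
  case (Suc m)
  let ?S = "{y \<in> univ M. sat M (case_nat y e) p}"
  have *: "sat M e (AtMost (Suc m) p) \<longleftrightarrow> (\<exists>x\<in>univ M. finite (?S - {x}) \<and> card (?S - {x}) \<le> m)"
  proof -
    have "{y \<in> univ M. sat M (case_nat y (case_nat x e))
        (Conj (ren (case_nat 0 (\<lambda>i. Suc (Suc i))) p) (Neg (Eql (Var 0) (Var 1))))} = ?S - {x}" for x
      by (auto simp: case_nat_ren)
    then show ?thesis by (simp only: AtMost.simps sat_ExB Suc.IH)
  qed
  also have "\<dots> \<longleftrightarrow> finite ?S \<and> card ?S \<le> Suc m"
  proof
    assume "\<exists>x\<in>univ M. finite (?S - {x}) \<and> card (?S - {x}) \<le> m"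
    then obtain x where "finite (?S - {x})" "card (?S - {x}) \<le> m" by blast
    moreover have "card ?S \<le> card (insert x (?S - {x}))"
      by (rule card_mono) (use calculation in auto)
    moreover have "card (insert x (?S - {x})) \<le> Suc (card (?S - {x}))"
      by (rule card_insert_le_m1) auto
    ultimately show "finite ?S \<and> card ?S \<le> Suc m" by simp
  next
    assume S: "finite ?S \<and> card ?S \<le> Suc m"
    show "\<exists>x\<in>univ M. finite (?S - {x}) \<and> card (?S - {x}) \<le> m"
    \<comment> \<open>Without any solution an arbitrary element may be removed; this is where the
      universe has to be nonempty.\<close>
    proof (cases "?S = {}")
      case True
      with assms show ?thesis by (metis (no_types, lifting) ex_in_conv card.empty empty_Diff le0 finite.emptyI)
    next
      case False
      then obtain x where "x \<in> ?S" by blast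
      with S show ?thesis by (intro bexI[of _ x]) (auto simp: card_Diff_singleton)
    qed
  qed
  finally show ?case .
qed

section \<open>Compactness\<close>

definition fip :: "'e set set \<Rightarrow> bool" where
  "fip G \<longleftrightarrow> (\<forall>F. finite F \<longrightarrow> F \<subseteq> G \<longrightarrow> \<Inter>F \<noteq> {})"

definition ultra :: "'e set set \<Rightarrow> bool" where
  "ultra U \<longleftrightarrow> (\<forall>A. A \<in> U \<longleftrightarrow> - A \<notin> U) \<and> (\<forall>A\<in>U. \<forall>B\<in>U. A \<inter> B \<in> U) \<and> (\<forall>A\<in>U. \<forall>B. A \<subseteq> B \<longrightarrow> B \<in> U)"

lemma fip_maximal_ultra:
  assumes G: "fip G" and max: "\<And>A. fip (insert A G) \<Longrightarrow> A \<in> G"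
  shows "ultra G"
proof -
  \<comment> \<open>A set above a finite intersection of members can be added without losing the
    finite intersection property, so by maximality it is a member. The ultrafilter laws follow from
    this.\<close>
  have ext: "A \<in> G" if "finite F" "F \<subseteq> G" "\<Inter>F \<subseteq> A" for A F
  proof (rule max, unfold fip_def, intro allI impI)
    fix F' assume F': "finite F'" "F' \<subseteq> insert A G"
    have "\<Inter>((F' - {A}) \<union> F) \<noteq> {}"
      by (rule G[unfolded fip_def, rule_format]) (use F' that in auto)
    moreover have "\<Inter>((F' - {A}) \<union> F) \<subseteq> \<Inter>F'" using that(3) by blast
    ultimately show "\<Inter>F' \<noteq> {}" by blast
  qed
  have "A \<in> G \<longleftrightarrow> - A \<notin> G" for A
  proof
    assume "A \<in> G"
    show "- A \<notin> G"
    proof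
      assume "- A \<in> G"
      with \<open>A \<in> G\<close> G[unfolded fip_def, rule_format, of "{A, - A}"] show False by auto
    qed
  next
    assume "- A \<notin> G"
    show "A \<in> G"
    proof (rule max, unfold fip_def, intro allI impI notI)
      fix F assume F: "finite F" "F \<subseteq> insert A G" "\<Inter>F = {}"
      have "\<Inter>(F - {A}) \<subseteq> - A" using F(3) by blast
      then have "- A \<in> G" using F(1,2) by (intro ext[of "F - {A}"]) auto
      with \<open>- A \<notin> G\<close> show False by simp
    qed
  qed
  moreover have "A \<inter> B \<in> G" if "A \<in> G" "B \<in> G" for A B
    using that by (intro ext[of "{A, B}"]) auto
  moreover have "B \<in> G" if "A \<in> G" "A \<subseteq> B" for A B
    using that by (intro ext[of "{A}"]) auto
  ultimately show ?thesis unfolding ultra_def by blast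
qed

lemma ultrafilter_exists:
  assumes "fip S"
  obtains U where "S \<subseteq> U" "ultra U"
proof -
  have "\<exists>G\<in>{G. S \<subseteq> G \<and> fip G}. \<forall>X\<in>{G. S \<subseteq> G \<and> fip G}. G \<subseteq> X \<longrightarrow> X = G"
  proof (rule subset_Zorn_nonempty)
    show "{G. S \<subseteq> G \<and> fip G} \<noteq> {}" using assms by blast
    fix \<C> assume \<C>: "\<C> \<noteq> {}" "subset.chain {G. S \<subseteq> G \<and> fip G} \<C>"
    then have in_\<C>: "\<And>G. G \<in> \<C> \<Longrightarrow> S \<subseteq> G \<and> fip G"
      by (auto simp: subset_chain_def)
    have "fip (\<Union>\<C>)" unfolding fip_def
    proof (intro allI impI)
      fix F assume F: "finite F" "F \<subseteq> \<Union>\<C>"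
      obtain G where "G \<in> \<C>" "F \<subseteq> G"
        by (rule finite_subset_Union_chain[OF F \<C>]) blast
      then show "\<Inter>F \<noteq> {}" using in_\<C> F unfolding fip_def by blast
    qed
    moreover have "S \<subseteq> \<Union>\<C>" using \<C>(1) in_\<C> by blast
    ultimately show "\<Union>\<C> \<in> {G. S \<subseteq> G \<and> fip G}" by blast
  qed
  then obtain G where G: "S \<subseteq> G" "fip G" and max: "\<And>X. S \<subseteq> X \<Longrightarrow> fip X \<Longrightarrow> G \<subseteq> X \<Longrightarrow> X = G"
    by (smt (verit) mem_Collect_eq)
  have "ultra G"
  proof (rule fip_maximal_ultra[OF G(2)])
    fix A assume "fip (insert A G)"
    then have "insert A G = G" by (rule max[rotated]) (use G(1) in auto)
    then show "A \<in> G" by blast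
  qed
  with G that show thesis by blast
qed

section \<open>Coding Skolem terms in the target type\<close>

lemma infinite_ex_pairing:
  assumes "infinite (UNIV :: 'u set)"
  shows "\<exists>P :: 'u \<times> 'u \<Rightarrow> 'u. inj P"
proof -
  have "(card_of ((UNIV :: 'u set) \<times> (UNIV :: 'u set)), card_of (UNIV :: 'u set)) \<in> ordLeq"
    using card_of_Times_same_infinite[OF assms] ordIso_imp_ordLeq by blast
  then show ?thesis
    unfolding card_of_ordLeq[symmetric] by auto
qed

text \<open>The tags \<open>I 0\<close> and \<open>I 1\<close> tell the empty list from a cons, so
  injectivity of P and I is enough. Terms and formulas are coded with tags in the same way.\<close>

definition enc_list :: "('u \<times> 'u \<Rightarrow> 'u) \<Rightarrow> (nat \<Rightarrow> 'u) \<Rightarrow> 'u list \<Rightarrow> 'u" where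
  "enc_list P I xs = foldr (\<lambda>x y. P (I 1, P (x, y))) xs (P (I 0, I 0))"

lemma enc_list_eq:
  assumes "inj P" "inj I"
  shows "enc_list P I xs = enc_list P I ys \<longleftrightarrow> xs = ys"
proof (induction xs arbitrary: ys)
  case Nil
  show ?case using assms by (cases ys) (auto simp: enc_list_def inj_eq)
next
  case (Cons x xs)
  then show ?case using assms by (cases ys) (auto simp: enc_list_def inj_eq)
qed

primrec enc_trm :: "('u \<times> 'u \<Rightarrow> 'u) \<Rightarrow> (nat \<Rightarrow> 'u) \<Rightarrow> ('s \<Rightarrow> 'u) \<Rightarrow> 's trm \<Rightarrow> 'u" where
  "enc_trm P I J (Var n) = P (I 0, I n)"
| "enc_trm P I J (Fn s ts) = P (I 1, P (J s, enc_list P I (map (enc_trm P I J) ts)))"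

lemma enc_trm_eq:
  assumes "inj P" "inj I" "inj J"
  shows "enc_trm P I J s = enc_trm P I J t \<longleftrightarrow> s = t"
proof (induction s arbitrary: t)
  case (Var n)
  show ?case using assms by (cases t) (auto simp: inj_eq)
next
  case (Fn f ss)
  have *: "map (enc_trm P I J) ss = map (enc_trm P I J) ts \<longleftrightarrow> ss = ts" for ts
  proof
    assume m: "map (enc_trm P I J) ss = map (enc_trm P I J) ts"
    then have len: "length ss = length ts" by (rule map_eq_imp_length_eq)
    show "ss = ts"
    proof (rule nth_equalityI[OF len])
      fix i assume i: "i < length ss"
      then have "enc_trm P I J (ss ! i) = enc_trm P I J (ts ! i)"
        using m len by (metis nth_map)
      then show "ss ! i = ts ! i" using Fn[of "ss ! i" "ts ! i"] i by simp
    qed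
  qed simp
  show ?case using assms
    by (cases t) (auto simp: inj_eq enc_list_eq[OF assms(1,2)] *)
qed

primrec enc_fm :: "('u \<times> 'u \<Rightarrow> 'u) \<Rightarrow> (nat \<Rightarrow> 'u) \<Rightarrow> ('f \<Rightarrow> 'u) \<Rightarrow> ('r \<Rightarrow> 'u) \<Rightarrow> ('f, 'r) fm \<Rightarrow> 'u" where
  "enc_fm P I J R (Eql s t) = P (I 0, P (enc_trm P I J s, enc_trm P I J t))"
| "enc_fm P I J R (Rel r ts) = P (I 1, P (R r, enc_list P I (map (enc_trm P I J) ts)))"
| "enc_fm P I J R (Neg p) = P (I 2, enc_fm P I J R p)"
| "enc_fm P I J R (Conj p q) = P (I 3, P (enc_fm P I J R p, enc_fm P I J R q))"
| "enc_fm P I J R (Exi i p) = P (I 4, P (I i, enc_fm P I J R p))"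

lemma enc_fm_eq:
  assumes "inj P" "inj I" "inj J" "inj R"
  shows "enc_fm P I J R p = enc_fm P I J R q \<longleftrightarrow> p = q"
proof -
  have tr: "inj (enc_trm P I J)" by (rule injI) (simp add: enc_trm_eq[OF assms(1-3)])
  show ?thesis
  proof (induction p arbitrary: q)
    case (Eql s t)
    show ?case using assms tr by (cases q) (auto simp: inj_eq)
  next
    case (Rel r ts)
    show ?case using assms tr by (cases q) (auto simp: inj_eq enc_list_eq[OF assms(1,2)] inj_map_eq_map)
  next
    case (Neg p)
    then show ?case using assms by (cases q) (auto simp: inj_eq)
  next
    case (Conj p p')
    then show ?case using assms by (cases q) (auto simp: inj_eq)
  next
    case (Exi i p)
    then show ?case using assms by (cases q) (auto simp: inj_eq)
  qed
qed

text \<open>The Skolem language adds one function symbol for each pair of a variable and a formula.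
  Its terms are still no more numerous than the elements of \<open>'u\<close>, and this is what
  allows the Skolem hull to be built in that type.\<close>

lemma ex_inj_skolem_terms:
  fixes g :: "('f + 'r) + nat \<Rightarrow> 'u"
  assumes g: "inj g"
  shows "\<exists>h :: ('f + nat \<times> ('f, 'r) fm) trm \<Rightarrow> 'u. inj h"
proof -
  define I where "I = g \<circ> Inr"
  define J where "J = g \<circ> Inl \<circ> Inl"
  define R where "R = g \<circ> Inl \<circ> Inr"
  have I: "inj I" and J: "inj J" and R: "inj R"
    unfolding I_def J_def R_def using g by (auto intro!: inj_compose)
  have "infinite (UNIV :: 'u set)"
    using I by (meson finite_imageD finite_subset infinite_UNIV_nat subset_UNIV)
  then obtain P :: "'u \<times> 'u \<Rightarrow> 'u" where P: "inj P"
    using infinite_ex_pairing by blast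
  define S where "S = case_sum (\<lambda>f. P (I 0, J f)) (\<lambda>(k, p). P (I 1, P (I k, enc_fm P I J R p)))"
  have "inj S"
    by (rule injI)
      (use I J P in \<open>auto simp: S_def inj_eq enc_fm_eq[OF P I J R] split: sum.splits prod.splits\<close>)
  then have "inj (enc_trm P I S)"
    by (intro injI) (simp add: enc_trm_eq[OF P I])
  then show ?thesis by blast
qed

section \<open>The Skolem hull of an ultrapower and the theorem of Los\<close>

definition skolem :: "('f, 'r, 'u) struct \<Rightarrow> ('f + nat \<times> ('f, 'r) fm, unit, 'u) struct" where
  "skolem M = (let d = SOME d. d \<in> univ M in
     \<lparr>univ = univ M,
      fun_of = (\<lambda>s xs. case s of
          Inl f \<Rightarrow> if fun_of M f xs \<in> univ M then fun_of M f xs else d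
        | Inr (k, p) \<Rightarrow> (let e = (\<lambda>i. if i < length xs then xs ! i else d) in
            SOME y. y \<in> univ M \<and> ((\<exists>x\<in>univ M. sat M (e(k := x)) p) \<longrightarrow> sat M (e(k := y)) p))),
      rel_of = (\<lambda>_ _. False)\<rparr>)"

primrec lift_trm :: "(nat \<Rightarrow> ('f + 's) trm) \<Rightarrow> 'f trm \<Rightarrow> ('f + 's) trm" where
  "lift_trm \<tau> (Var i) = \<tau> i"
| "lift_trm \<tau> (Fn f ts) = Fn (Inl f) (map (lift_trm \<tau>) ts)"

text \<open>A term stands for the function that sends an environment e to the value of the term at
  e, that is for a point of the ultrapower indexed by environments. \<open>q\<close> names its class
  modulo \<open>U\<close> by an element of the small type.\<close>

locale skolem_ultraproduct =
  fixes L :: "('f, 'r, 'm) lang_scheme" and M :: "('f, 'r, 'v) struct"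
    and U :: "(nat \<Rightarrow> 'v) set set" and q :: "('f + nat \<times> ('f, 'r) fm) trm \<Rightarrow> 'u"
  assumes M: "wf_struct L M" and U: "ultra U" and envs: "{e. \<forall>i. e i \<in> univ M} \<in> U"
    and q: "q t = q t' \<longleftrightarrow> {e. tval (skolem M) e t = tval (skolem M) e t'} \<in> U"
begin

abbreviation "ev \<equiv> tval (skolem M)"

lemma univ_nonempty: "univ M \<noteq> {}"
  using M by (simp add: wf_struct_def)

lemma default_in: "(SOME d. d \<in> univ M) \<in> univ M"
  using univ_nonempty by (simp add: some_in_eq)

lemma witness:
  fixes e k p
  defines "y \<equiv> SOME y. y \<in> univ M \<and> ((\<exists>x\<in>univ M. sat M (e(k := x)) p) \<longrightarrow> sat M (e(k := y)) p)"
  shows "y \<in> univ M \<and> ((\<exists>x\<in>univ M. sat M (e(k := x)) p) \<longrightarrow> sat M (e(k := y)) p)"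
  unfolding y_def by (rule someI_ex) (use univ_nonempty in blast)

lemma skolem_fun_in: "fun_of (skolem M) s xs \<in> univ M"
proof (cases s)
  case (Inl f)
  then show ?thesis using default_in by (simp add: skolem_def Let_def)
next
  case (Inr kp)
  obtain k p where "kp = (k, p)" by force
  with Inr show ?thesis by (simp add: skolem_def Let_def conjunct1[OF witness])
qed

lemma fun_of_skolem_Inr:
  "fun_of (skolem M) (Inr (k, p)) xs =
     (let e = (\<lambda>i. if i < length xs then xs ! i else (SOME d. d \<in> univ M)) in
       SOME y. y \<in> univ M \<and> ((\<exists>x\<in>univ M. sat M (e(k := x)) p) \<longrightarrow> sat M (e(k := y)) p))"
  by (simp add: skolem_def Let_def)

lemma ev_in: "(\<And>i. e i \<in> univ M) \<Longrightarrow> ev e t \<in> univ M"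
  by (cases t) (simp_all add: skolem_fun_in)

lemma U_mono: "A \<in> U \<Longrightarrow> A \<subseteq> B \<Longrightarrow> B \<in> U"
  using U unfolding ultra_def by blast

lemma U_Int: "A \<in> U \<Longrightarrow> B \<in> U \<Longrightarrow> A \<inter> B \<in> U"
  using U unfolding ultra_def by blast

lemma U_Neg: "- A \<in> U \<longleftrightarrow> A \<notin> U"
  using U unfolding ultra_def by blast

lemma U_mp:
  assumes "{e. P e} \<in> U" "\<And>e. P e \<Longrightarrow> (\<And>i. e i \<in> univ M) \<Longrightarrow> Q e"
  shows "{e. Q e} \<in> U"
  by (rule U_mono[OF U_Int[OF assms(1) envs]]) (use assms(2) in auto)

lemma U_cong:
  assumes "\<And>e. (\<And>i. e i \<in> univ M) \<Longrightarrow> P e = Q e"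
  shows "{e. P e} \<in> U \<longleftrightarrow> {e. Q e} \<in> U"
  using U_mp[of P Q] U_mp[of Q P] assms by (intro iffI) simp_all

lemma U_subst:
  assumes "{e. f e = g e} \<in> U"
  shows "{e. P (f e)} \<in> U \<longleftrightarrow> {e. P (g e)} \<in> U"
proof
  assume "{e. P (f e)} \<in> U"
  from U_Int[OF assms this] show "{e. P (g e)} \<in> U" by (rule U_mono) auto
next
  assume "{e. P (g e)} \<in> U"
  from U_Int[OF assms this] show "{e. P (f e)} \<in> U" by (rule U_mono) auto
qed

lemma U_list:
  assumes "\<And>t. t \<in> set ts \<Longrightarrow> {e. P e t} \<in> U"
  shows "{e. \<forall>t\<in>set ts. P e t} \<in> U"
  using assms
proof (induction ts)
  case Nil
  show ?case by (rule U_mono[OF envs]) auto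
next
  case (Cons t ts)
  then have "{e. P e t} \<inter> {e. \<forall>t\<in>set ts. P e t} \<in> U"
    by (intro U_Int) auto
  then show ?case by (rule U_mono) auto
qed

definition ultraprod :: "('f, 'r, 'u) struct" where
  "ultraprod = \<lparr>univ = range q,
     fun_of = (\<lambda>f us. q (Fn (Inl f) (map (inv_into UNIV q) us))),
     rel_of = (\<lambda>r us. {e. rel_of M r (map (\<lambda>u. ev e (inv_into UNIV q u)) us)} \<in> U)\<rparr>"

lemma ultraprod_simps [simp]:
  "univ ultraprod = range q"
  "fun_of ultraprod f us = q (Fn (Inl f) (map (inv_into UNIV q) us))"
  "rel_of ultraprod r us \<longleftrightarrow> {e. rel_of M r (map (\<lambda>u. ev e (inv_into UNIV q u)) us)} \<in> U"
  by (simp_all add: ultraprod_def)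

text \<open>The operations of the ultraproduct are defined through chosen representatives; this is
  their independence of the choice.\<close>

lemma rep: "{e. ev e (inv_into UNIV q (q t)) = ev e t} \<in> U"
  by (subst q[symmetric]) (simp add: f_inv_into_f)

lemma reps: "{e. \<forall>t\<in>set ts. ev e (inv_into UNIV q (q t)) = ev e t} \<in> U"
  by (rule U_list) (rule rep)

lemma wf_ultraprod: "wf_struct L ultraprod"
  by (auto simp: wf_struct_def)

lemma tval_ultraprod: "tval ultraprod (\<lambda>i. q (\<tau> i)) t = q (lift_trm \<tau> t)"
proof (induction t)
  case (Fn f ts)
  have "map (tval ultraprod (\<lambda>i. q (\<tau> i))) ts = map q (map (lift_trm \<tau>) ts)"
    using Fn by auto
  moreover have "q (Fn (Inl f) (map (inv_into UNIV q) (map q us))) = q (Fn (Inl f) us)" for us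
    unfolding q
  proof (rule U_mp[OF reps[of us]])
    fix e assume "\<forall>t\<in>set us. ev e (inv_into UNIV q (q t)) = ev e t"
    then have "map (ev e) (map (inv_into UNIV q) (map q us)) = map (ev e) us" by auto
    then show "ev e (Fn (Inl f) (map (inv_into UNIV q) (map q us))) = ev e (Fn (Inl f) us)"
      by (simp only: tval.simps)
  qed
  ultimately show ?case by (simp only: tval.simps lift_trm.simps ultraprod_simps)
qed simp

lemma ev_lift:
  assumes "wf_trm L t" "\<And>i. e i \<in> univ M"
  shows "ev e (lift_trm \<tau> t) = tval M (\<lambda>i. ev e (\<tau> i)) t"
  using assms(1)
proof (induction t)
  case (Fn f ts)
  have eq: "map (ev e) (map (lift_trm \<tau>) ts) = map (tval M (\<lambda>i. ev e (\<tau> i))) ts"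
    using Fn by auto
  have "set (map (ev e) (map (lift_trm \<tau>) ts)) \<subseteq> univ M"
    using ev_in[OF assms(2)] by auto
  then have "fun_of M f (map (ev e) (map (lift_trm \<tau>) ts)) \<in> univ M"
    using M Fn.prems unfolding wf_struct_def tuples_def by simp
  then show ?case
    by (simp only: lift_trm.simps tval.simps eq) (simp add: skolem_def Let_def)
qed simp

lemma Los:
  "wf_fm L p \<Longrightarrow> sat ultraprod (\<lambda>i. q (\<tau> i)) p \<longleftrightarrow> {e. sat M (\<lambda>i. ev e (\<tau> i)) p} \<in> U"
proof (induction p arbitrary: \<tau>)
  case (Eql s t)
  then show ?case
    by (simp add: tval_ultraprod q) (rule U_cong, simp add: ev_lift)
next
  case (Rel r ts)
  have "sat ultraprod (\<lambda>i. q (\<tau> i)) (Rel r ts) \<longleftrightarrow>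
      {e. rel_of M r (map (\<lambda>t. ev e (inv_into UNIV q (q (lift_trm \<tau> t)))) ts)} \<in> U"
    by (simp add: tval_ultraprod comp_def)
  also have "\<dots> \<longleftrightarrow> {e. rel_of M r (map (\<lambda>t. ev e (lift_trm \<tau> t)) ts)} \<in> U"
  proof -
    have eq: "{e. map (\<lambda>t. ev e (inv_into UNIV q (q (lift_trm \<tau> t)))) ts = map (\<lambda>t. ev e (lift_trm \<tau> t)) ts} \<in> U"
      by (rule U_mp[OF reps[of "map (lift_trm \<tau>) ts"]]) auto
    show ?thesis by (rule U_subst[OF eq])
  qed
  also have "\<dots> \<longleftrightarrow> {e. sat M (\<lambda>i. ev e (\<tau> i)) (Rel r ts)} \<in> U"
  proof (rule U_cong)
    fix e :: "nat \<Rightarrow> 'v" assume e: "\<And>i. e i \<in> univ M"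
    have "map (\<lambda>t. ev e (lift_trm \<tau> t)) ts = map (tval M (\<lambda>i. ev e (\<tau> i))) ts"
      using Rel.prems ev_lift[OF _ e] by auto
    then show "rel_of M r (map (\<lambda>t. ev e (lift_trm \<tau> t)) ts) = sat M (\<lambda>i. ev e (\<tau> i)) (Rel r ts)"
      by (simp only: sat.simps)
  qed
  finally show ?case .
next
  case (Neg p)
  have "{e. \<not> sat M (\<lambda>i. ev e (\<tau> i)) p} = - {e. sat M (\<lambda>i. ev e (\<tau> i)) p}" by auto
  with Neg show ?case by (simp add: U_Neg)
next
  case (Conj p p')
  have "{e. sat M (\<lambda>i. ev e (\<tau> i)) p \<and> sat M (\<lambda>i. ev e (\<tau> i)) p'} \<in> U \<longleftrightarrow>
      {e. sat M (\<lambda>i. ev e (\<tau> i)) p} \<in> U \<and> {e. sat M (\<lambda>i. ev e (\<tau> i)) p'} \<in> U"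
    using U_Int[of "{e. sat M (\<lambda>i. ev e (\<tau> i)) p}" "{e. sat M (\<lambda>i. ev e (\<tau> i)) p'}"]
    by (auto simp: Collect_conj_eq intro: U_mono)
  with Conj show ?case by simp
next
  case (Exi k p)
  have upd: "(\<lambda>i. q (\<tau> i))(k := q t) = (\<lambda>i. q ((\<tau>(k := t)) i))" for t by auto
  have upd': "(\<lambda>i. ev e (\<tau> i))(k := ev e t) = (\<lambda>i. ev e ((\<tau>(k := t)) i))" for t e by auto
  have IH: "sat ultraprod ((\<lambda>i. q (\<tau> i))(k := q t)) p \<longleftrightarrow>
      {e. sat M ((\<lambda>i. ev e (\<tau> i))(k := ev e t)) p} \<in> U" for t
    unfolding upd upd' using Exi by simp
  show ?case
  proof
    assume "sat ultraprod (\<lambda>i. q (\<tau> i)) (Exi k p)"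
    then obtain t where "{e. sat M ((\<lambda>i. ev e (\<tau> i))(k := ev e t)) p} \<in> U"
      using IH by auto
    then show "{e. sat M (\<lambda>i. ev e (\<tau> i)) (Exi k p)} \<in> U"
      by (rule U_mp) (auto intro: ev_in)
  next
    assume ex: "{e. sat M (\<lambda>i. ev e (\<tau> i)) (Exi k p)} \<in> U"
    define B where "B = fresh (fv p)"
    \<comment> \<open>The Skolem function of (k, p), applied to the terms at all variables below B.
      As B exceeds every free variable of p, the value of this term is a witness at every index that
      has one.\<close>
    define w where "w = Fn (Inr (k, p)) (map \<tau> [0..<B])"
    have "{e. sat M ((\<lambda>i. ev e (\<tau> i))(k := ev e w)) p} \<in> U"
    proof (rule U_mp[OF ex])
      fix e :: "nat \<Rightarrow> 'v" assume "sat M (\<lambda>i. ev e (\<tau> i)) (Exi k p)"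
      then obtain x where x: "x \<in> univ M" "sat M ((\<lambda>i. ev e (\<tau> i))(k := x)) p" by auto
      define e' where "e' = (\<lambda>i. if i < B then map (ev e) (map \<tau> [0..<B]) ! i else (SOME d. d \<in> univ M))"
      have cong: "sat M ((\<lambda>i. ev e (\<tau> i))(k := y)) p = sat M (e'(k := y)) p" for y
        by (rule sat_cong) (auto simp: e'_def B_def dest: fresh_greater[OF finite_fv])
      have "ev e w = (SOME y. y \<in> univ M \<and> ((\<exists>x\<in>univ M. sat M (e'(k := x)) p) \<longrightarrow> sat M (e'(k := y)) p))"
        by (simp add: w_def fun_of_skolem_Inr Let_def e'_def cong: if_cong)
      with witness[of e' k p] have "(\<exists>x\<in>univ M. sat M (e'(k := x)) p) \<longrightarrow> sat M (e'(k := ev e w)) p"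
        by (simp only:) blast
      moreover have "sat M (e'(k := x)) p" using x(2) by (simp only: cong)
      ultimately show "sat M ((\<lambda>i. ev e (\<tau> i))(k := ev e w)) p"
        using x(1) by (simp only: cong) blast
    qed
    then show "sat ultraprod (\<lambda>i. q (\<tau> i)) (Exi k p)"
      using IH[of w] by auto
  qed
qed

end

text \<open>The model is a Skolem hull inside an ultrapower whose index set is the set of all
  environments, so that compactness and the downward Loewenheim-Skolem theorem come together.\<close>

theorem compactness:
  fixes L :: "('f, 'r, 'm) lang_scheme" and M :: "('f, 'r, 'v) struct" and g :: "('f + 'r) + nat \<Rightarrow> 'u"
  assumes M: "wf_struct L M" and g: "inj g" and wf: "\<And>p. p \<in> \<Sigma> \<Longrightarrow> wf_fm L p"
    and fin: "\<And>F. finite F \<Longrightarrow> F \<subseteq> \<Sigma> \<Longrightarrow> \<exists>e. (\<forall>i. e i \<in> univ M) \<and> (\<forall>p\<in>F. sat M e p)"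
  obtains N :: "('f, 'r, 'u) struct" and e where "models L N (Th L M)" "\<And>i. e i \<in> univ N" "\<And>p. p \<in> \<Sigma> \<Longrightarrow> sat N e p"
proof -
  define E where "E = {e. \<forall>i::nat. e i \<in> univ M}"
  \<comment> \<open>The index type also contains environments that leave the universe; adding
    \<open>E\<close> makes them negligible.\<close>
  have "fip (insert E ((\<lambda>p. {e. sat M e p}) ` \<Sigma>))"
    unfolding fip_def
  proof (intro allI impI)
    fix F assume F: "finite F" "F \<subseteq> insert E ((\<lambda>p. {e. sat M e p}) ` \<Sigma>)"
    then have "finite (F - {E})" "F - {E} \<subseteq> (\<lambda>p. {e. sat M e p}) ` \<Sigma>" by auto
    then obtain G where G: "finite G" "G \<subseteq> \<Sigma>" "F - {E} = (\<lambda>p. {e. sat M e p}) ` G"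
      by (meson finite_subset_image)
    from fin[OF G(1,2)] obtain e where "e \<in> E" "\<forall>p\<in>G. sat M e p" by (auto simp: E_def)
    with G have "e \<in> \<Inter>F" by blast
    then show "\<Inter>F \<noteq> {}" by blast
  qed
  then obtain U where U: "insert E ((\<lambda>p. {e. sat M e p}) ` \<Sigma>) \<subseteq> U" "ultra U"
    by (rule ultrafilter_exists)
  have Int: "A \<inter> B \<in> U" if "A \<in> U" "B \<in> U" for A B using U that unfolding ultra_def by blast
  have mono: "B \<in> U" if "A \<in> U" "A \<subseteq> B" for A B using U that unfolding ultra_def by blast
  obtain h :: "('f + nat \<times> ('f, 'r) fm) trm \<Rightarrow> 'u" where h: "inj h"
    using ex_inj_skolem_terms[OF g] by blast
  define eqv where "eqv t t' \<longleftrightarrow> {e. tval (skolem M) e t = tval (skolem M) e t'} \<in> U" for t t'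
  have sym: "eqv t' t" if "eqv t t'" for t t'
    using that unfolding eqv_def by (simp add: eq_commute)
  have trans: "eqv t t''" if "eqv t t'" "eqv t' t''" for t t' t''
    using Int[OF that[unfolded eqv_def]] unfolding eqv_def by (rule mono) auto
  have refl: "eqv t t" for t
    unfolding eqv_def by (rule mono[of E]) (use U in auto)
  \<comment> \<open>A class of terms is sent to the code of a chosen member, so that classes and not
    terms become elements of \<open>'u\<close>.\<close>
  define q where "q t = h (SOME t'. eqv t t')" for t
  have rep: "eqv t (SOME t'. eqv t t')" for t
    by (rule someI[of _ t]) (rule refl)
  have q: "q t = q t' \<longleftrightarrow> eqv t t'" for t t'
  proof
    assume "q t = q t'"
    then have "(SOME s. eqv t s) = (SOME s. eqv t' s)"
      using h by (simp add: q_def inj_eq)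
    then show "eqv t t'" using rep[of t] rep[of t'] sym trans by metis
  next
    assume "eqv t t'"
    then have "eqv t s \<longleftrightarrow> eqv t' s" for s using sym trans by blast
    then show "q t = q t'" by (simp add: q_def)
  qed
  interpret su: skolem_ultraproduct L M U q
    by unfold_locales (use M U q in \<open>simp_all add: E_def eqv_def\<close>)
  \<comment> \<open>The variables, read as terms, form the generic environment: it satisfies exactly
    the formulas that hold at almost every index, hence all of \<Sigma>.\<close>
  have los: "sat su.ultraprod (\<lambda>i. q (Var i)) p \<longleftrightarrow> {e. sat M e p} \<in> U" if "wf_fm L p" for p
    using su.Los[OF that, of Var] by simp
  show thesis
  proof
    show "models L su.ultraprod (Th L M)" unfolding models_def
    proof (intro conjI su.wf_ultraprod ballI allI)
      fix p and e :: "nat \<Rightarrow> 'u" assume p: "p \<in> Th L M"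
      then have p': "wf_fm L p" "fv p = {}" "\<And>e. sat M e p" by (simp_all add: Th_def)
      have "E \<in> U" using U(1) by simp
      then have "{e. sat M e p} \<in> U" by (rule mono) (simp add: p'(3))
      then have "sat su.ultraprod (\<lambda>i. q (Var i)) p" by (simp add: los[OF p'(1)])
      moreover have "sat su.ultraprod e p = sat su.ultraprod (\<lambda>i. q (Var i)) p"
        by (rule sat_cong) (simp add: p'(2))
      ultimately show "sat su.ultraprod e p" by simp
    qed
    show "q (Var i) \<in> univ su.ultraprod" for i by simp
    show "sat su.ultraprod (\<lambda>i. q (Var i)) p" if "p \<in> \<Sigma>" for p
      using that U(1) los[OF wf[OF that]] by auto
  qed
qed

section \<open>Valued fields\<close>

text \<open>Values are compared through elements, |a| <= |b|, and a radius is given by an element l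
  of this value. In this form everything becomes first-order in the field.\<close>

definition vle :: "('a, 'm) ring_scheme \<Rightarrow> 'a set \<Rightarrow> 'a \<Rightarrow> 'a \<Rightarrow> bool" where
  "vle R V a b \<longleftrightarrow> (\<exists>v\<in>V. a = b \<otimes>\<^bsub>R\<^esub> v)"

text \<open>Equality of leading terms of radius |l|, written as |x - x'| < |l x| to avoid inverses.
  The first disjunct covers x = x' = 0, where the strict inequality fails.\<close>

definition rveq :: "('a, 'm) ring_scheme \<Rightarrow> 'a set \<Rightarrow> 'a \<Rightarrow> 'a \<Rightarrow> 'a \<Rightarrow> bool" where
  "rveq R V l x x' \<longleftrightarrow> x = x' \<or> \<not> vle R V (l \<otimes>\<^bsub>R\<^esub> x) (x \<ominus>\<^bsub>R\<^esub> x')"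

definition radius :: "('a, 'm) ring_scheme \<Rightarrow> 'a set \<Rightarrow> 'a \<Rightarrow> bool" where
  "radius R V l \<longleftrightarrow> l \<in> V \<and> l \<noteq> \<zero>\<^bsub>R\<^esub>"

lemma vle_mono: "V \<subseteq> V' \<Longrightarrow> vle R V a b \<Longrightarrow> vle R V' a b"
  by (auto simp: vle_def)

locale valued = field R for R (structure) +
  fixes V
  assumes valuation_ring: "valuation_ring R V"
begin

lemma V_subring: "subring V R"
  using valuation_ring by (simp add: valuation_ring_def)

lemmas V_carrier = subringE(1)[OF V_subring]
  and V_zero = subringE(2)[OF V_subring]
  and V_one = subringE(3)[OF V_subring]
  and V_minus = subringE(5)[OF V_subring]
  and V_mult = subringE(6)[OF V_subring]
  and V_add = subringE(7)[OF V_subring]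

lemma V_in [simp]: "v \<in> V \<Longrightarrow> v \<in> carrier R"
  using V_carrier by blast

lemma V_or_inv: "x \<in> carrier R \<Longrightarrow> x \<noteq> \<zero> \<Longrightarrow> x \<in> V \<or> inv x \<in> V"
  using valuation_ring by (simp add: valuation_ring_def)

lemma inv_in [simp]: "x \<in> carrier R \<Longrightarrow> x \<noteq> \<zero> \<Longrightarrow> inv x \<in> carrier R"
  by (simp add: field_Units)

lemma mult_inv [simp]: "x \<in> carrier R \<Longrightarrow> x \<noteq> \<zero> \<Longrightarrow> x \<otimes> inv x = \<one>"
  by (simp add: field_Units)

lemma inv_mult [simp]: "x \<in> carrier R \<Longrightarrow> x \<noteq> \<zero> \<Longrightarrow> inv x \<otimes> x = \<one>"
  by (simp add: field_Units)

lemma mult_divide [simp]: "x \<in> carrier R \<Longrightarrow> y \<in> carrier R \<Longrightarrow> x \<noteq> \<zero> \<Longrightarrow> x \<otimes> (inv x \<otimes> y) = y"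
  by (simp flip: m_assoc)

lemma divide_mult [simp]: "x \<in> carrier R \<Longrightarrow> y \<in> carrier R \<Longrightarrow> x \<noteq> \<zero> \<Longrightarrow> inv x \<otimes> (x \<otimes> y) = y"
  by (simp flip: m_assoc)

abbreviation le (infix \<open>\<preceq>\<close> 50) where "a \<preceq> b \<equiv> vle R V a b"

lemma le_refl [simp]: "a \<in> carrier R \<Longrightarrow> a \<preceq> a"
  unfolding vle_def by (rule bexI[of _ \<one>]) (auto simp: V_one)

lemma le_trans: "a \<in> carrier R \<Longrightarrow> b \<in> carrier R \<Longrightarrow> c \<in> carrier R \<Longrightarrow> a \<preceq> b \<Longrightarrow> b \<preceq> c \<Longrightarrow> a \<preceq> c"
  unfolding vle_def
proof (elim bexE)
  fix v w assume *: "c \<in> carrier R" "v \<in> V" "a = b \<otimes> v" "w \<in> V" "b = c \<otimes> w"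
  then show "\<exists>v\<in>V. a = c \<otimes> v"
    by (intro bexI[of _ "w \<otimes> v"]) (auto simp: V_mult m_assoc)
qed

lemma zero_le [simp]: "b \<in> carrier R \<Longrightarrow> \<zero> \<preceq> b"
  unfolding vle_def by (rule bexI[of _ \<zero>]) (auto simp: V_zero)

lemma le_zero [simp]: "a \<in> carrier R \<Longrightarrow> a \<preceq> \<zero> \<longleftrightarrow> a = \<zero>"
  using V_zero by (auto simp: vle_def)

lemma le_one [simp]: "a \<preceq> \<one> \<longleftrightarrow> a \<in> V"
  by (auto simp: vle_def)

lemma le_total: "a \<in> carrier R \<Longrightarrow> b \<in> carrier R \<Longrightarrow> a \<preceq> b \<or> b \<preceq> a"
proof (cases "a = \<zero> \<or> b = \<zero>")
  case False
  assume ab: "a \<in> carrier R" "b \<in> carrier R"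
  with False have q: "inv b \<otimes> a \<in> carrier R" "inv b \<otimes> a \<noteq> \<zero>"
    by (auto simp: integral_iff) (metis inv_mult l_null one_not_zero mult_inv r_null)
  have "b \<otimes> (inv b \<otimes> a) = a" using False ab by simp
  moreover have "a \<otimes> inv (inv b \<otimes> a) = b"
  proof -
    have "b \<otimes> (inv b \<otimes> a) \<otimes> inv (inv b \<otimes> a) = b \<otimes> ((inv b \<otimes> a) \<otimes> inv (inv b \<otimes> a))"
      using q ab by (intro m_assoc) auto
    also have "\<dots> = b" using mult_inv[OF q] ab by simp
    finally show ?thesis using False ab by simp
  qed
  ultimately show ?thesis
    using V_or_inv[OF q] unfolding vle_def by metis
qed auto

lemma le_mult: "a \<in> carrier R \<Longrightarrow> b \<in> carrier R \<Longrightarrow> c \<in> carrier R \<Longrightarrow> a \<preceq> b \<Longrightarrow> c \<otimes> a \<preceq> c \<otimes> b"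
  unfolding vle_def by (auto simp: m_assoc)

lemma le_mult_iff: "a \<in> carrier R \<Longrightarrow> b \<in> carrier R \<Longrightarrow> c \<in> carrier R \<Longrightarrow> c \<noteq> \<zero> \<Longrightarrow> c \<otimes> a \<preceq> c \<otimes> b \<longleftrightarrow> a \<preceq> b"
proof
  assume *: "a \<in> carrier R" "b \<in> carrier R" "c \<in> carrier R" "c \<noteq> \<zero>" "c \<otimes> a \<preceq> c \<otimes> b"
  then have "inv c \<otimes> (c \<otimes> a) \<preceq> inv c \<otimes> (c \<otimes> b)" by (intro le_mult[of "c \<otimes> a" "c \<otimes> b"]) auto
  with *(1-4) show "a \<preceq> b" by (metis divide_mult)
qed (rule le_mult)

lemma le_V_mult: "v \<in> V \<Longrightarrow> a \<in> carrier R \<Longrightarrow> v \<otimes> a \<preceq> a"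
  unfolding vle_def by (rule bexI[of _ v]) (auto simp: m_comm)

lemma le_minus [simp]: "a \<in> carrier R \<Longrightarrow> b \<in> carrier R \<Longrightarrow> \<ominus> a \<preceq> b \<longleftrightarrow> a \<preceq> b"
proof -
  have *: "\<ominus> a \<preceq> b" if "a \<in> carrier R" "b \<in> carrier R" "a \<preceq> b" for a b
  proof -
    from that obtain v where "v \<in> V" "a = b \<otimes> v" by (auto simp: vle_def)
    with that show ?thesis unfolding vle_def
      by (intro bexI[of _ "\<ominus> v"]) (auto simp: V_minus r_minus)
  qed
  show "a \<in> carrier R \<Longrightarrow> b \<in> carrier R \<Longrightarrow> ?thesis"
    using *[of a b] *[of "\<ominus> a" b] by auto
qed

lemma le_add: "a \<in> carrier R \<Longrightarrow> b \<in> carrier R \<Longrightarrow> c \<in> carrier R \<Longrightarrow> a \<preceq> c \<Longrightarrow> b \<preceq> c \<Longrightarrow> a \<oplus> b \<preceq> c"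
  unfolding vle_def
proof (elim bexE)
  fix v w assume "c \<in> carrier R" "v \<in> V" "a = c \<otimes> v" "w \<in> V" "b = c \<otimes> w"
  then show "\<exists>v\<in>V. a \<oplus> b = c \<otimes> v"
    by (intro bexI[of _ "v \<oplus> w"]) (auto simp: V_add r_distr)
qed

lemma add_less:
  assumes "a \<in> carrier R" "b \<in> carrier R" "c \<in> carrier R" "\<not> c \<preceq> a" "\<not> c \<preceq> b"
  shows "\<not> c \<preceq> a \<oplus> b"
proof
  assume c: "c \<preceq> a \<oplus> b"
  from le_total[OF assms(1,2)] show False
  proof
    assume "a \<preceq> b"
    then have "a \<oplus> b \<preceq> b" using assms by (intro le_add) auto
    with c have "c \<preceq> b" using assms by (intro le_trans[of c "a \<oplus> b" b]) auto
    with assms show False by simp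
  next
    assume "b \<preceq> a"
    then have "a \<oplus> b \<preceq> a" using assms by (intro le_add) auto
    with c have "c \<preceq> a" using assms by (intro le_trans[of c "a \<oplus> b" a]) auto
    with assms show False by simp
  qed
qed

lemma le_minus2: "a \<in> carrier R \<Longrightarrow> b \<in> carrier R \<Longrightarrow> a \<preceq> \<ominus> b \<longleftrightarrow> a \<preceq> b"
proof -
  assume *: "a \<in> carrier R" "b \<in> carrier R"
  then have "\<ominus> b \<preceq> b" "b \<preceq> \<ominus> b" using le_minus[of "\<ominus> b" "\<ominus> b"] by simp_all
  then show ?thesis using * le_trans[of a b "\<ominus> b"] le_trans[of a "\<ominus> b" b] by auto
qed

lemma minus_swap: "a \<in> carrier R \<Longrightarrow> b \<in> carrier R \<Longrightarrow> a \<ominus> b = \<ominus> (b \<ominus> a)"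
  by (simp add: a_minus_def minus_add a_comm)

lemma minus_add_cancel: "a \<in> carrier R \<Longrightarrow> b \<in> carrier R \<Longrightarrow> (a \<ominus> b) \<oplus> b = a"
  by (simp add: a_minus_def a_assoc l_neg)

lemma minus_trans: "a \<in> carrier R \<Longrightarrow> b \<in> carrier R \<Longrightarrow> c \<in> carrier R \<Longrightarrow> (a \<ominus> b) \<oplus> (b \<ominus> c) = a \<ominus> c"
  by (simp add: a_minus_def a_assoc r_neg1)

lemma eq_add_iff: "a \<in> carrier R \<Longrightarrow> b \<in> carrier R \<Longrightarrow> t \<in> carrier R \<Longrightarrow> a = t \<oplus> b \<longleftrightarrow> t = a \<ominus> b"
  by (auto simp: minus_add_cancel a_minus_def a_assoc r_neg l_neg)

lemma minus_cancel: "a \<in> carrier R \<Longrightarrow> b \<in> carrier R \<Longrightarrow> c \<in> carrier R \<Longrightarrow> (a \<ominus> c) \<ominus> (b \<ominus> c) = a \<ominus> b"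
  using minus_trans[of a c b] minus_swap[of b c] by (simp add: a_minus_def)

lemma minus_eq_iff: "a \<in> carrier R \<Longrightarrow> b \<in> carrier R \<Longrightarrow> c \<in> carrier R \<Longrightarrow> a \<ominus> c = b \<ominus> c \<longleftrightarrow> a = b"
  using minus_add_cancel by metis

lemma minus_eq_zero: "a \<in> carrier R \<Longrightarrow> b \<in> carrier R \<Longrightarrow> a \<ominus> b = \<zero> \<longleftrightarrow> a = b"
  using minus_add_cancel[of a b] by (auto simp: a_minus_def r_neg)

lemma Units_V: "Units (R\<lparr>carrier := V\<rparr>) = {v \<in> V. \<one> \<preceq> v}"
proof -
  have "(\<exists>y\<in>V. y \<otimes> x = \<one> \<and> x \<otimes> y = \<one>) \<longleftrightarrow> (\<exists>y\<in>V. \<one> = x \<otimes> y)" if "x \<in> V" for x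
    using that m_comm[of x] by (metis V_in)
  then show ?thesis by (auto simp: Units_def vle_def)
qed

lemma mem_val: "x \<in> carrier R \<Longrightarrow> y \<in> val R V x \<longleftrightarrow> y \<in> carrier R \<and> x \<preceq> y \<and> y \<preceq> x"
proof
  assume x: "x \<in> carrier R" and "y \<in> val R V x"
  then obtain v w where vw: "v \<in> V" "w \<in> V" "\<one> = v \<otimes> w" "y = x \<otimes> v"
    by (auto simp: val_def l_coset_def Units_V vle_def)
  then have y: "y \<in> carrier R" using x by simp
  have "y \<otimes> w = x" using x vw by (simp add: m_assoc flip: vw(3))
  then have "x = y \<otimes> w" by simp
  with vw x y show "y \<in> carrier R \<and> x \<preceq> y \<and> y \<preceq> x" unfolding vle_def by blast
next
  assume x: "x \<in> carrier R" and y: "y \<in> carrier R \<and> x \<preceq> y \<and> y \<preceq> x"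
  then obtain v w where vw: "v \<in> V" "w \<in> V" "y = x \<otimes> v" "x = y \<otimes> w"
    by (auto simp: vle_def)
  show "y \<in> val R V x"
  proof (cases "x = \<zero>")
    case True
    then have "y = x \<otimes> \<one>" "\<one> \<preceq> \<one>" using vw(1,3) V_one by auto
    then show ?thesis using V_one unfolding val_def l_coset_def Units_V by blast
  next
    case False
    have "x \<otimes> (v \<otimes> w) = x \<otimes> v \<otimes> w" using x vw(1,2) by (simp add: m_assoc)
    also have "\<dots> = x \<otimes> \<one>" unfolding vw(3)[symmetric] vw(4)[symmetric] using x by simp
    finally have "x \<otimes> (v \<otimes> w) = x \<otimes> \<one>" .
    then have "\<one> = v \<otimes> w" using False x vw(1,2) m_lcancel[of x "v \<otimes> w" \<one>] by simp
    then have "\<one> \<preceq> v" using vw unfolding vle_def by blast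
    then show ?thesis using vw unfolding val_def l_coset_def Units_V by blast
  qed
qed

lemma val_self: "x \<in> carrier R \<Longrightarrow> x \<in> val R V x"
  by (simp add: mem_val)

lemma val_eq: "x \<in> carrier R \<Longrightarrow> y \<in> carrier R \<Longrightarrow> val R V x = val R V y \<longleftrightarrow> x \<preceq> y \<and> y \<preceq> x"
proof
  assume *: "x \<in> carrier R" "y \<in> carrier R" "x \<preceq> y \<and> y \<preceq> x"
  show "val R V x = val R V y"
    by (rule Set.set_eqI) (use * in \<open>auto simp: mem_val intro: le_trans\<close>)
qed (use val_self mem_val in blast)

lemma val_le: "x \<in> carrier R \<Longrightarrow> y \<in> carrier R \<Longrightarrow> val_le R V (val R V x) (val R V y) \<longleftrightarrow> x \<preceq> y"
proof -
  assume *: "x \<in> carrier R" "y \<in> carrier R"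
  have "x \<in> y <#\<^bsub>R\<^esub> V \<longleftrightarrow> x \<preceq> y" for x y by (auto simp: l_coset_def vle_def)
  then have "val_le R V (val R V x) (val R V y) \<longleftrightarrow> (\<exists>x'\<in>val R V x. \<exists>y'\<in>val R V y. x' \<preceq> y')"
    by (simp add: val_le_def)
  also have "\<dots> \<longleftrightarrow> x \<preceq> y"
  proof
    assume "\<exists>x'\<in>val R V x. \<exists>y'\<in>val R V y. x' \<preceq> y'"
    then obtain x' y' where "x' \<in> val R V x" "y' \<in> val R V y" "x' \<preceq> y'" by blast
    with * show "x \<preceq> y"
      using le_trans[of x x' y'] le_trans[of x y' y] by (simp add: mem_val)
  qed (use * val_self in blast)
  finally show ?thesis .
qed

lemma val_less: "x \<in> carrier R \<Longrightarrow> y \<in> carrier R \<Longrightarrow> val_less R V (val R V x) (val R V y) \<longleftrightarrow> \<not> y \<preceq> x"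
  using le_total by (auto simp: val_less_def val_le val_eq)

lemma radius_in: "radius R V l \<Longrightarrow> l \<in> carrier R"
  by (auto simp: radius_def)

lemma less_radius:
  assumes "radius R V l" "x \<in> carrier R" "d \<in> carrier R" "\<not> l \<otimes> x \<preceq> d"
  shows "\<not> x \<preceq> d"
  using assms le_V_mult[of l x] le_trans[of "l \<otimes> x" x d] by (auto simp: radius_def)

lemma rveq_refl [simp]: "rveq R V l x x"
  by (simp add: rveq_def)

text \<open>|x - x'| < |l x| <= |x| forces |x| = |x'| by the ultrametric inequality: a leading term
  determines the value.\<close>

lemma rveq_le:
  assumes "radius R V l" "x \<in> carrier R" "x' \<in> carrier R" "rveq R V l x x'"
  shows "x \<preceq> x' \<and> x' \<preceq> x"
proof (cases "x = x'")
  case False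
  then have less: "\<not> x \<preceq> x \<ominus> x'"
    using assms less_radius by (auto simp: rveq_def)
  have "x' = x \<oplus> \<ominus> (x \<ominus> x')"
    using assms minus_swap[of x x'] minus_add_cancel[of x' x] by (simp add: a_comm)
  moreover have "x \<ominus> x' \<preceq> x" using less le_total assms by blast
  ultimately have 1: "x' \<preceq> x" using assms le_add[of x "\<ominus> (x \<ominus> x')" x] by simp
  have "x \<preceq> x'"
  proof (rule ccontr)
    assume "\<not> x \<preceq> x'"
    with less add_less[of "x \<ominus> x'" x' x] show False using assms by (simp add: minus_add_cancel)
  qed
  with 1 show ?thesis by simp
qed (use assms in simp)

lemma less_cong: 
  assumes "x \<in> carrier R" "x' \<in> carrier R" "l \<in> carrier R" "d \<in> carrier R" "x \<preceq> x'" 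
    "\<not> l \<otimes> x \<preceq> d"
  shows "\<not> l \<otimes> x' \<preceq> d"
  using assms le_mult[of x x' l] le_trans[of "l \<otimes> x" "l \<otimes> x'" d] by auto

lemma rveq_sym:
  assumes "radius R V l" "x \<in> carrier R" "x' \<in> carrier R" "rveq R V l x x'"
  shows "rveq R V l x' x"
proof (cases "x = x'")
  case False
  then have "\<not> l \<otimes> x \<preceq> x \<ominus> x'" using assms by (simp add: rveq_def)
  then have "\<not> l \<otimes> x' \<preceq> x \<ominus> x'"
    using less_cong[of x x' l] rveq_le[OF assms] assms radius_in by simp
  then have "\<not> l \<otimes> x' \<preceq> x' \<ominus> x"
    using assms radius_in minus_swap[of x' x] le_minus2[of "l \<otimes> x'" "x \<ominus> x'"] by simp
  then show ?thesis by (simp add: rveq_def)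
qed simp

lemma rveq_trans:
  assumes "radius R V l" "x \<in> carrier R" "y \<in> carrier R" "z \<in> carrier R" "rveq R V l x y" "rveq R V l y z"
  shows "rveq R V l x z"
proof (cases "x = y \<or> y = z")
  case False
  then have 1: "\<not> l \<otimes> x \<preceq> x \<ominus> y" and 2: "\<not> l \<otimes> y \<preceq> y \<ominus> z"
    using assms by (auto simp: rveq_def)
  have "\<not> l \<otimes> x \<preceq> y \<ominus> z"
    using less_cong[OF _ _ _ _ _ 2, of x] rveq_le[OF assms(1,2,3,5)] assms radius_in by simp
  with 1 add_less[of "x \<ominus> y" "y \<ominus> z" "l \<otimes> x"] assms radius_in[OF assms(1)]
  show ?thesis by (simp add: rveq_def minus_trans)
qed (use assms in auto)

text \<open>From |x - x'| < |l x| <= |l' x|: equality of leading terms passes to every larger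
  radius, in particular to another element of the same value.\<close>

lemma rveq_radius_cong:
  assumes "radius R V l" "radius R V l'" "l \<preceq> l'" "x \<in> carrier R" "x' \<in> carrier R" "rveq R V l x x'"
  shows "rveq R V l' x x'"
proof (cases "x = x'")
  case False
  then have "\<not> x \<otimes> l \<preceq> x \<ominus> x'" using assms radius_in by (simp add: rveq_def m_comm)
  then have "\<not> x \<otimes> l' \<preceq> x \<ominus> x'"
    using less_cong[of l l' x] assms radius_in by simp
  then show ?thesis using assms radius_in by (simp add: rveq_def m_comm)
qed simp

text \<open>Membership in the coset x (1 + y), |y| < |l|, is tested with y = (x' - x) / x; for x = 0
  both sides say x' = 0.\<close>

lemma mem_rv:
  assumes "radius R V l" "x \<in> carrier R"
  shows "x' \<in> rv R V (val R V l) x \<longleftrightarrow> x' \<in> carrier R \<and> rveq R V l x x'"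
proof -
  have l: "l \<in> carrier R" "l \<noteq> \<zero>" using assms by (auto simp: radius_def)
  have mem: "x' \<in> rv R V (val R V l) x \<longleftrightarrow> (\<exists>y\<in>carrier R. \<not> l \<preceq> y \<and> x' = x \<otimes> (\<one> \<oplus> y))"
  proof -
    have "(y \<in> carrier R \<and> val_less R V (val R V y) (val R V l)) = (y \<in> carrier R \<and> \<not> l \<preceq> y)" for y
      using l val_less[of y l] by auto
    then show ?thesis by (simp only: rv_def l_coset_def) blast
  qed
  show ?thesis
  proof
    assume "x' \<in> rv R V (val R V l) x"
    then obtain y where y: "y \<in> carrier R" "\<not> l \<preceq> y" "x' = x \<otimes> (\<one> \<oplus> y)" unfolding mem by blast
    then have x': "x' = x \<otimes> y \<oplus> x" using assms(2) by (simp add: r_distr a_comm)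
    have "x' \<in> carrier R" using y assms(2) by simp
    with x' have "x' \<ominus> x = x \<otimes> y" using assms(2) y(1) eq_add_iff[of x' x "x \<otimes> y"] by (metis m_closed)
    moreover have "\<not> x \<otimes> l \<preceq> x \<otimes> y" if "x \<noteq> \<zero>"
      using that y l assms by (simp add: le_mult_iff)
    ultimately have "x = \<zero> \<or> \<not> l \<otimes> x \<preceq> x' \<ominus> x" using l assms(2) m_comm[of l x] by metis
    moreover have "x = \<zero> \<Longrightarrow> x' = x" using x' y(1) by simp
    moreover have "l \<otimes> x \<preceq> x \<ominus> x' \<longleftrightarrow> l \<otimes> x \<preceq> x' \<ominus> x"
      using \<open>x' \<in> carrier R\<close> assms(2) l minus_swap[of x x'] le_minus2[of "l \<otimes> x" "x' \<ominus> x"] by simp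
    ultimately show "x' \<in> carrier R \<and> rveq R V l x x'"
      using \<open>x' \<in> carrier R\<close> unfolding rveq_def by blast
  next
    assume x': "x' \<in> carrier R \<and> rveq R V l x x'"
    show "x' \<in> rv R V (val R V l) x"
    proof (cases "x' = x")
      case True
      then show ?thesis unfolding mem using assms l by (intro bexI[of _ \<zero>]) auto
    next
      case False
      then have less: "\<not> l \<otimes> x \<preceq> x' \<ominus> x"
        using x' assms l minus_swap[of x x'] le_minus2[of "l \<otimes> x" "x' \<ominus> x"] by (auto simp: rveq_def)
      then have x: "x \<noteq> \<zero>" using x' assms l by auto
      define y where "y = inv x \<otimes> (x' \<ominus> x)"
      have y: "y \<in> carrier R" "x \<otimes> y = x' \<ominus> x" using x x' assms by (auto simp: y_def)
      have "\<not> l \<preceq> y"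
        using less y assms l x le_mult_iff[of l y x] by (simp add: m_comm)
      moreover have "x' = x \<otimes> (\<one> \<oplus> y)"
        using assms x' y minus_add_cancel[of x' x] a_comm[of x "x' \<ominus> x"] by (simp add: r_distr)
      ultimately show ?thesis unfolding mem using y by blast
    qed
  qed
qed

lemma rv_eq:
  assumes "radius R V l" "x \<in> carrier R" "x' \<in> carrier R"
  shows "rv R V (val R V l) x = rv R V (val R V l) x' \<longleftrightarrow> rveq R V l x x'"
proof
  assume "rv R V (val R V l) x = rv R V (val R V l) x'"
  moreover have "x' \<in> rv R V (val R V l) x'" using assms by (simp add: mem_rv)
  ultimately show "rveq R V l x x'" using mem_rv[OF assms(1,2)] by blast
next
  assume *: "rveq R V l x x'"
  have "rveq R V l x y \<longleftrightarrow> rveq R V l x' y" if "y \<in> carrier R" for y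
    using rveq_trans[OF assms(1,2,3) that *] rveq_trans[OF assms(1,3,2) that rveq_sym[OF assms *]] by blast
  then show "rv R V (val R V l) x = rv R V (val R V l) x'"
    using assms by (intro Set.set_eqI) (auto simp: mem_rv)
qed

lemma prepares_iff:
  assumes "radius R V l"
  shows "prepares R V (val R V l) C X \<longleftrightarrow> finite C \<and> C \<noteq> {} \<and> C \<subseteq> carrier R \<and>
    (\<forall>x\<in>carrier R. \<forall>x'\<in>carrier R. (\<forall>c\<in>C. rveq R V l (x \<ominus> c) (x' \<ominus> c)) \<longrightarrow> (x \<in> X \<longleftrightarrow> x' \<in> X))"
proof -
  have "rv R V (val R V l) (x \<ominus> c) = rv R V (val R V l) (x' \<ominus> c) \<longleftrightarrow> rveq R V l (x \<ominus> c) (x' \<ominus> c)"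
    if "C \<subseteq> carrier R" "x \<in> carrier R" "x' \<in> carrier R" "c \<in> C" for x x' c
    using that rv_eq[OF assms, of "x \<ominus> c" "x' \<ominus> c"] by blast
  then have *: "(\<forall>c\<in>C. rv R V (val R V l) (x \<ominus> c) = rv R V (val R V l) (x' \<ominus> c)) \<longleftrightarrow>
      (\<forall>c\<in>C. rveq R V l (x \<ominus> c) (x' \<ominus> c))"
    if "C \<subseteq> carrier R" "x \<in> carrier R" "x' \<in> carrier R" for x x'
    using that by simp
  show ?thesis unfolding prepares_def
    by (intro conj_cong refl ball_cong) (simp only: *)
qed

lemma radius_iff: "l \<in> carrier R \<Longrightarrow> radius R V l \<longleftrightarrow> l \<noteq> \<zero> \<and> val_le R V (val R V l) (val R V \<one>)"
  by (auto simp: radius_def val_le)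

text \<open>A class of the ball decomposition given by \<open>C\<close> is determined by a nearest point of \<open>C\<close> together
  with the leading term of the difference.\<close>

lemma rveq_nearest:
  assumes "radius R V l" "x \<in> carrier R" "x' \<in> carrier R" "c \<in> carrier R" "c' \<in> carrier R"
    "x \<ominus> c \<preceq> x \<ominus> c'" "rveq R V l (x \<ominus> c) (x' \<ominus> c)"
  shows "rveq R V l (x \<ominus> c') (x' \<ominus> c')"
proof (cases "x = x'")
  case False
  then have "\<not> l \<otimes> (x \<ominus> c) \<preceq> x \<ominus> x'"
    using assms by (simp add: rveq_def minus_cancel minus_eq_iff)
  then have "\<not> l \<otimes> (x \<ominus> c') \<preceq> x \<ominus> x'"
    using less_cong[of "x \<ominus> c" "x \<ominus> c'" l] assms radius_in by simp
  then show ?thesis using assms by (simp add: rveq_def minus_cancel)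
qed simp

lemma nearest_exists:
  assumes "finite C" "C \<noteq> {}" "C \<subseteq> carrier R" "x \<in> carrier R"
  shows "\<exists>c\<in>C. \<forall>c'\<in>C. x \<ominus> c \<preceq> x \<ominus> c'"
  using assms
proof (induction C rule: finite_ne_induct)
  case (insert d C)
  then obtain c where c: "c \<in> C" "\<forall>c'\<in>C. x \<ominus> c \<preceq> x \<ominus> c'" by auto
  show ?case
  proof (cases "x \<ominus> c \<preceq> x \<ominus> d")
    case True
    with c show ?thesis by auto
  next
    case False
    moreover have cd: "x \<ominus> c \<in> carrier R" "x \<ominus> d \<in> carrier R" using insert.prems c by auto
    ultimately have "x \<ominus> d \<preceq> x \<ominus> c" using le_total by blast
    then have "x \<ominus> d \<preceq> x \<ominus> c'" if "c' \<in> C" for c'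
      using c cd insert.prems that by (intro le_trans[of "x \<ominus> d" "x \<ominus> c" "x \<ominus> c'"]) auto
    with cd show ?thesis by (intro bexI[of _ d]) auto
  qed
qed auto

end

section \<open>Residue characteristic\<close>

context valued
begin

lemma add_pow_V: "add_pow R (n :: nat) \<one> \<in> V"
  by (induction n) (auto simp: add_pow_def nat_pow_def V_zero V_one V_add)

lemma add_pow_Suc: "add_pow R (Suc n) x = add_pow R n x \<oplus> x"
  by (simp add: add_pow_def nat_pow_def)

text \<open>A multiple of 1 lies in the valuation ring and vanishes in the residue field exactly if
  it is a nonunit. The quotient ring disappears from the condition, which becomes a scheme of
  first-order axioms.\<close>

lemma residue_characteristic_0:
  "characteristic_0 (residue_ring R V) \<longleftrightarrow> (\<forall>n::nat. n > 0 \<longrightarrow> \<one> \<preceq> add_pow R n \<one>)"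
proof -
  define S where "S = R\<lparr>carrier := V\<rparr>"
  define I where "I = V - Units S"
  interpret S: ring S unfolding S_def by (rule subring_is_ring[OF V_subring])
  have I: "I = {v \<in> V. \<not> \<one> \<preceq> v}" unfolding I_def S_def Units_V by auto
  have S: "carrier S = V" "mult S = mult R" "add S = add R" "one S = \<one>" "zero S = \<zero>"
    by (simp_all add: S_def)
  have minus: "\<ominus>\<^bsub>S\<^esub> v = \<ominus> v" if "v \<in> V" for v
    using that by (intro S.minus_equality) (simp_all add: S V_minus l_neg)
  have mult_I: "x \<otimes> a \<in> I" if "a \<in> I" "x \<in> V" for a x
    using that le_trans[of \<one> "x \<otimes> a" a] le_V_mult[of x a] by (auto simp: I V_mult)
  have "ideal I S"
  proof (rule idealI[OF S.ring_axioms])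
    show "subgroup I (add_monoid S)"
    proof (rule S.add.subgroupI)
      show "I \<subseteq> carrier S" by (auto simp: I S)
      show "I \<noteq> {}" using V_zero by (auto simp: I)
      show "\<ominus>\<^bsub>S\<^esub> a \<in> I" if "a \<in> I" for a
        using that by (simp add: I minus V_minus le_minus2)
      show "a \<oplus>\<^bsub>S\<^esub> b \<in> I" if "a \<in> I" "b \<in> I" for a b
        using that add_less[of a b \<one>] by (simp add: I S V_add)
    qed
    show "x \<otimes>\<^bsub>S\<^esub> a \<in> I" "a \<otimes>\<^bsub>S\<^esub> x \<in> I" if "a \<in> I" "x \<in> carrier S" for a x
      using that mult_I[of a x] m_comm[of a x] by (auto simp: S I)
  qed
  then interpret I: ideal I S .
  define Q where "Q = S Quot I"
  have hom: "(+>\<^bsub>S\<^esub>) I \<in> ring_hom S Q" unfolding Q_def by (rule I.rcos_ring_hom)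
  have Q: "residue_ring R V = Q" by (simp add: residue_ring_def Q_def I_def S_def)
  have one: "\<one>\<^bsub>Q\<^esub> = I +>\<^bsub>S\<^esub> \<one>\<^bsub>S\<^esub>" and zero: "\<zero>\<^bsub>Q\<^esub> = I" by (simp_all add: Q_def FactRing_def)
  have pow: "add_pow Q n \<one>\<^bsub>Q\<^esub> = I +>\<^bsub>S\<^esub> (add_pow R n \<one>)" for n :: nat
  proof (induction n)
    case 0
    have "I +>\<^bsub>S\<^esub> \<zero> = I" using I.a_rcos_const[of \<zero>] V_zero by (simp add: I)
    then show ?case by (simp add: add_pow_def nat_pow_def zero)
  next
    case (Suc n)
    have "add_pow Q (Suc n) \<one>\<^bsub>Q\<^esub> = (I +>\<^bsub>S\<^esub> (add_pow R n \<one>)) \<oplus>\<^bsub>Q\<^esub> (I +>\<^bsub>S\<^esub> \<one>\<^bsub>S\<^esub>)"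
      using Suc by (simp add: add_pow_def nat_pow_def one)
    also have "\<dots> = I +>\<^bsub>S\<^esub> (add_pow R n \<one> \<oplus>\<^bsub>S\<^esub> \<one>\<^bsub>S\<^esub>)"
      by (rule ring_hom_add[OF hom, symmetric]) (simp_all add: S add_pow_V V_one)
    finally show ?case by (simp add: S add_pow_Suc)
  qed
  have "add_pow Q n \<one>\<^bsub>Q\<^esub> = \<zero>\<^bsub>Q\<^esub> \<longleftrightarrow> add_pow R n \<one> \<in> I" for n :: nat
    unfolding pow zero using I.a_rcos_const[of "add_pow R n \<one>"] I.a_rcos_self[of "add_pow R n \<one>"]
      add_pow_V[of n] by (auto simp: S)
  then show ?thesis unfolding Q characteristic_0_def using add_pow_V by (auto simp: I)
qed

text \<open>A multiple of 1 with nonzero residue is itself nonzero, so residue characteristic 0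
  covers both characteristics.\<close>

lemma equichar_0_iff:
  "equichar_0 R V \<longleftrightarrow> V \<noteq> carrier R \<and> (\<forall>n::nat. n > 0 \<longrightarrow> \<one> \<preceq> add_pow R n \<one>)"
proof -
  have "characteristic_0 R" if "\<forall>n::nat. n > 0 \<longrightarrow> \<one> \<preceq> add_pow R n \<one>"
    unfolding characteristic_0_def
  proof (intro allI impI notI)
    fix n :: nat assume "n > 0" "add_pow R n \<one> = \<zero>"
    with that have "\<one> \<preceq> \<zero>" by metis
    then show False by simp
  qed
  then show ?thesis
    using field_axioms valuation_ring
    unfolding equichar_0_def valued_field_def residue_characteristic_0 by blast
qed

end

section \<open>Formulas in the language of valued fields\<close>

abbreviation tadd :: "('f, 'r) vlang \<Rightarrow> 'f trm \<Rightarrow> 'f trm \<Rightarrow> 'f trm" where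
  "tadd L s t \<equiv> Fn (plus_sym L) [s, t]"

abbreviation tmul :: "('f, 'r) vlang \<Rightarrow> 'f trm \<Rightarrow> 'f trm \<Rightarrow> 'f trm" where
  "tmul L s t \<equiv> Fn (times_sym L) [s, t]"

text \<open>No symbols for zero and subtraction are assumed: zero is the solution of z + z = z, and
  below d = a - b is written as a = d + b.\<close>

definition fZero :: "('f, 'r) vlang \<Rightarrow> nat \<Rightarrow> ('f, 'r) fm" where
  "fZero L z = Eql (tadd L (Var z) (Var z)) (Var z)"

definition fV :: "('f, 'r) vlang \<Rightarrow> nat \<Rightarrow> ('f, 'r) fm" where
  "fV L a = Rel (vring_sym L) [Var a]"

definition fLe :: "('f, 'r) vlang \<Rightarrow> nat \<Rightarrow> nat \<Rightarrow> ('f, 'r) fm" where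
  "fLe L a b = ExB (Conj (fV L 0) (Eql (Var (Suc a)) (tmul L (Var (Suc b)) (Var 0))))"

definition fRad :: "('f, 'r) vlang \<Rightarrow> nat \<Rightarrow> ('f, 'r) fm" where
  "fRad L l = Conj (fV L l) (Neg (fZero L l))"

definition fSub :: "('f, 'r) vlang \<Rightarrow> nat \<Rightarrow> nat \<Rightarrow> nat \<Rightarrow> ('f, 'r) fm" where
  "fSub L d a b = Eql (Var a) (tadd L (Var d) (Var b))"

text \<open>Variable 1 is the difference x - x', variable 0 the product l x; the offset 2 skips
  these two.\<close>

definition fRv :: "('f, 'r) vlang \<Rightarrow> nat \<Rightarrow> nat \<Rightarrow> nat \<Rightarrow> ('f, 'r) fm" where
  "fRv L l x x' = Disj (Eql (Var x) (Var x')) (ExB (ExB (Conj (fSub L 1 (x + 2) (x' + 2))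
     (Conj (Eql (Var 0) (tmul L (Var (l + 2)) (Var (x + 2)))) (Neg (fLe L 0 1))))))"

definition fRvSub :: "('f, 'r) vlang \<Rightarrow> nat \<Rightarrow> nat \<Rightarrow> nat \<Rightarrow> nat \<Rightarrow> ('f, 'r) fm" where
  "fRvSub L l x x' c = ExB (ExB (Conj (fSub L 1 (x + 2) (c + 2)) (Conj (fSub L 0 (x' + 2) (c + 2)) (fRv L (l + 2) 1 0))))"

definition fNear :: "('f, 'r) vlang \<Rightarrow> nat \<Rightarrow> nat \<Rightarrow> nat \<Rightarrow> ('f, 'r) fm" where
  "fNear L y c c' = ExB (ExB (Conj (fSub L 1 (y + 2) (c + 2)) (Conj (fSub L 0 (y + 2) (c' + 2)) (fLe L 1 0))))"

lemma wf_formulas [simp]: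
  assumes "wf_vlang L"
  shows "wf_fm L (fZero L z)" "wf_fm L (fV L a)" "wf_fm L (fLe L a b)" "wf_fm L (fRad L l)"
    "wf_fm L (fSub L d a b)" "wf_fm L (fRv L l x x')" "wf_fm L (fRvSub L l x x' c)" "wf_fm L (fNear L y c c')"
  using assms
  by (simp_all add: wf_vlang_def fZero_def fV_def fLe_def fRad_def fSub_def fRv_def fRvSub_def fNear_def)

text \<open>The relation behind the sort of leading terms must be definable without parameters, so
  the free variables of its constituents have to be known.\<close>

lemma fv_formulas:
  "fv (fLe L a b) \<subseteq> {a, b}" "fv (fRad L l) \<subseteq> {l}" "fv (fRv L l x x') \<subseteq> {l, x, x'}"
proof -
  show le: "fv (fLe L a b) \<subseteq> {a, b}" for a b
    unfolding fLe_def using fv_ExB by (rule subset_trans) (auto simp: fV_def)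
  show "fv (fRad L l) \<subseteq> {l}" by (auto simp: fRad_def fV_def fZero_def)
  have "Suc (Suc i) \<notin> fv (fLe L 0 1)" for i using le[of 0 1] by auto
  then have "fv (ExB (ExB (Conj (fSub L 1 (x + 2) (x' + 2))
     (Conj (Eql (Var 0) (tmul L (Var (l + 2)) (Var (x + 2)))) (Neg (fLe L 0 1)))))) \<subseteq> {l, x, x'}"
    by (intro subset_trans[OF fv_ExB] subsetI)
      (drule CollectD, drule subsetD[OF fv_ExB], auto simp: fSub_def)
  then show "fv (fRv L l x x') \<subseteq> {l, x, x'}" by (auto simp: fRv_def)
qed

lemma fld_simps [simp]:
  "carrier (fld L M) = univ M"
  "mult (fld L M) a b = fun_of M (times_sym L) [a, b]"
  "add (fld L M) a b = fun_of M (plus_sym L) [a, b]"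
  by (simp_all add: fld_def)

locale valued_struct =
  fixes L :: "('f, 'r) vlang" and M :: "('f, 'r, 'u) struct"
  assumes wf_lang: "wf_vlang L" and wf: "wf_struct L M"
    and F: "field (fld L M)" and VR: "valuation_ring (fld L M) (vring L M)"
begin

abbreviation "R \<equiv> fld L M"
abbreviation "V \<equiv> vring L M"

sublocale valued R V
  by (rule valued.intro[OF F]) (rule valued_axioms.intro[OF VR])

lemma sat_fZero [simp]: "e z \<in> univ M \<Longrightarrow> sat M e (fZero L z) \<longleftrightarrow> e z = \<zero>\<^bsub>R\<^esub>"
proof -
  assume z: "e z \<in> univ M"
  have "e z \<oplus>\<^bsub>R\<^esub> e z = e z \<longleftrightarrow> e z = \<zero>\<^bsub>R\<^esub>"
    using add.r_cancel_one[of "e z" "e z"] z by simp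
  then show ?thesis by (simp add: fZero_def)
qed

lemma sat_fV [simp]: "e a \<in> univ M \<Longrightarrow> sat M e (fV L a) \<longleftrightarrow> e a \<in> V"
  by (simp add: fV_def vring_def)

lemma sat_fLe [simp]: "sat M e (fLe L a b) \<longleftrightarrow> vle R V (e a) (e b)"
  by (auto simp: fLe_def vle_def vring_def fV_def)

lemma sat_fRad [simp]: "e l \<in> univ M \<Longrightarrow> sat M e (fRad L l) \<longleftrightarrow> radius R V (e l)"
  by (simp add: fRad_def radius_def)

lemma sat_fSub [simp]:
  "e a \<in> univ M \<Longrightarrow> e b \<in> univ M \<Longrightarrow> e d \<in> univ M \<Longrightarrow> sat M e (fSub L d a b) \<longleftrightarrow> e d = e a \<ominus>\<^bsub>R\<^esub> e b"
  using eq_add_iff[of "e a" "e b" "e d"] by (simp add: fSub_def)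

lemma minus_in [simp]: "a \<in> univ M \<Longrightarrow> b \<in> univ M \<Longrightarrow> a \<ominus>\<^bsub>R\<^esub> b \<in> univ M"
  using minus_closed[of a b] by simp

lemma mult_in [simp]: "a \<in> univ M \<Longrightarrow> b \<in> univ M \<Longrightarrow> fun_of M (times_sym L) [a, b] \<in> univ M"
  using m_closed[of a b] by simp

lemma sat_fRv [simp]:
  assumes "e l \<in> univ M" "e x \<in> univ M" "e x' \<in> univ M"
  shows "sat M e (fRv L l x x') \<longleftrightarrow> rveq R V (e l) (e x) (e x')"
  using assms by (auto simp: fRv_def rveq_def)

lemma sat_fRvSub [simp]:
  assumes "e l \<in> univ M" "e x \<in> univ M" "e x' \<in> univ M" "e c \<in> univ M"
  shows "sat M e (fRvSub L l x x' c) \<longleftrightarrow> rveq R V (e l) (e x \<ominus>\<^bsub>R\<^esub> e c) (e x' \<ominus>\<^bsub>R\<^esub> e c)"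
  using assms by (auto simp: fRvSub_def)

lemma sat_fNear [simp]:
  assumes "e y \<in> univ M" "e c \<in> univ M" "e c' \<in> univ M"
  shows "sat M e (fNear L y c c') \<longleftrightarrow> vle R V (e y \<ominus>\<^bsub>R\<^esub> e c) (e y \<ominus>\<^bsub>R\<^esub> e c')"
  using assms by (auto simp: fNear_def)

end

section \<open>Transfer of first-order properties\<close>

definition closure_fm :: "('f, 'r) fm \<Rightarrow> ('f, 'r) fm" where
  "closure_fm p = Neg (exis (sorted_list_of_set (fv p)) (Neg p))"

lemma Th_closure_fm:
  assumes "wf_fm L p" "univ K \<noteq> {}" "\<And>e. (\<And>i. e i \<in> univ K) \<Longrightarrow> sat K e p"
  shows "closure_fm p \<in> Th L K"
proof -
  obtain d where d: "d \<in> univ K" using assms(2) by blast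
  have "sat K e' p" if "\<forall>i\<in>fv p. e' i \<in> univ K" for e'
  proof -
    have "sat K (\<lambda>i. if i \<in> fv p then e' i else d) p"
      by (rule assms(3)) (use that d in auto)
    moreover have "sat K (\<lambda>i. if i \<in> fv p then e' i else d) p = sat K e' p"
      by (rule sat_cong) auto
    ultimately show ?thesis by simp
  qed
  then show ?thesis using assms(1) finite_fv[of p]
    by (auto simp: Th_def closure_fm_def sat_exis)
qed

text \<open>The theory consists of sentences; an open formula valid everywhere in K enters it
  through its universal closure.\<close>

lemma models_transfer:
  assumes "wf_fm L p" "wf_struct L K" "\<And>e. (\<And>i. e i \<in> univ K) \<Longrightarrow> sat K e p"
    and M: "models L M (Th L K)" "\<And>i. e i \<in> univ M"
  shows "sat M e p"
proof -
  have "closure_fm p \<in> Th L K"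
    by (rule Th_closure_fm) (use assms in \<open>auto simp: wf_struct_def\<close>)
  then have "sat M e (closure_fm p)" using M by (auto simp: models_def)
  then show ?thesis using M(2) by (auto simp: closure_fm_def sat_exis elim!: allE[of _ e])
qed

text \<open>The multiple is n + 1, which gives all positive multiples without a term for
  zero.\<close>

primrec mult_trm :: "('f, 'r) vlang \<Rightarrow> nat \<Rightarrow> 'f trm \<Rightarrow> 'f trm" where
  "mult_trm L 0 t = t"
| "mult_trm L (Suc n) t = tadd L (mult_trm L n t) t"

text \<open>The outer quantifiers provide 0 (variable 1) and 1 (variable 0).\<close>

definition valued_axiom :: "('f, 'r) vlang \<Rightarrow> nat \<Rightarrow> ('f, 'r) fm" where
  "valued_axiom L n = (let A = \<lambda>i j. tadd L (Var i) (Var j); P = \<lambda>i j. tmul L (Var i) (Var j) in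
    ExB (ExB (Conjs
     [AllB (AllB (AllB (Eql (tadd L (A 2 1) (Var 0)) (tadd L (Var 2) (A 1 0))))),
      AllB (AllB (Eql (A 1 0) (A 0 1))),
      AllB (Eql (A 2 0) (Var 0)),
      AllB (ExB (Eql (A 0 1) (Var 3))),
      AllB (AllB (AllB (Eql (tmul L (P 2 1) (Var 0)) (tmul L (Var 2) (P 1 0))))),
      AllB (AllB (Eql (P 1 0) (P 0 1))),
      AllB (Eql (P 1 0) (Var 0)),
      Neg (Eql (Var 0) (Var 1)),
      AllB (Imp (Neg (Eql (Var 0) (Var 2))) (ExB (Eql (P 1 0) (Var 2)))),
      AllB (AllB (AllB (Eql (tmul L (A 2 1) (Var 0)) (tadd L (P 2 0) (P 1 0))))),
      AllB (AllB (Imp (Conj (fV L 0) (fV L 1)) (Conj (Rel (vring_sym L) [A 1 0]) (Rel (vring_sym L) [P 1 0])))),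
      fV L 0,
      AllB (Imp (fV L 0) (ExB (Conj (fV L 0) (Eql (A 0 1) (Var 3))))),
      AllB (Disj (Eql (Var 0) (Var 2)) (Disj (fV L 0) (ExB (Conj (fV L 0) (Eql (P 1 0) (Var 2)))))),
      ExB (Neg (fV L 0)),
      ExB (Conj (fV L 0) (Eql (Var 1) (tmul L (mult_trm L n (Var 1)) (Var 0))))])))"

lemma wf_valued_axiom: "wf_vlang L \<Longrightarrow> wf_fm L (valued_axiom L n)"
proof -
  assume L: "wf_vlang L"
  have "wf_trm L (mult_trm L n t) = wf_trm L t" for t
    using L by (induction n) (auto simp: wf_vlang_def)
  then show ?thesis using L by (simp add: valued_axiom_def wf_vlang_def fV_def Let_def)
qed

lemma sat_valued_axiom:
  fixes M :: "('f, 'r, 'u) struct" and L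
  defines "pl \<equiv> \<lambda>x y. fun_of M (plus_sym L) [x, y]"
    and "ml \<equiv> \<lambda>x y. fun_of M (times_sym L) [x, y]"
    and "V \<equiv> \<lambda>x. rel_of M (vring_sym L) [x]"
    and "U \<equiv> univ M"
  shows "sat M e (valued_axiom L n) \<longleftrightarrow> (\<exists>z\<in>U. \<exists>u\<in>U.
     (\<forall>x\<in>U. \<forall>y\<in>U. \<forall>w\<in>U. pl (pl x y) w = pl x (pl y w)) \<and>
     (\<forall>x\<in>U. \<forall>y\<in>U. pl x y = pl y x) \<and>
     (\<forall>x\<in>U. pl z x = x) \<and> (\<forall>x\<in>U. \<exists>y\<in>U. pl y x = z) \<and>
     (\<forall>x\<in>U. \<forall>y\<in>U. \<forall>w\<in>U. ml (ml x y) w = ml x (ml y w)) \<and>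
     (\<forall>x\<in>U. \<forall>y\<in>U. ml x y = ml y x) \<and>
     (\<forall>x\<in>U. ml u x = x) \<and> u \<noteq> z \<and> (\<forall>x\<in>U. x \<noteq> z \<longrightarrow> (\<exists>y\<in>U. ml x y = u)) \<and>
     (\<forall>x\<in>U. \<forall>y\<in>U. \<forall>w\<in>U. ml (pl x y) w = pl (ml x w) (ml y w)) \<and>
     (\<forall>x\<in>U. \<forall>y\<in>U. V y \<and> V x \<longrightarrow> V (pl x y) \<and> V (ml x y)) \<and>
     V u \<and> (\<forall>x\<in>U. V x \<longrightarrow> (\<exists>y\<in>U. V y \<and> pl y x = z)) \<and>
     (\<forall>x\<in>U. x = z \<or> V x \<or> (\<exists>y\<in>U. V y \<and> ml x y = u)) \<and>
     (\<exists>x\<in>U. \<not> V x) \<and>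
     (\<exists>y\<in>U. V y \<and> u = ml (((\<lambda>x. pl x u) ^^ n) u) y))"
proof -
  have "tval M e (mult_trm L n t) = ((\<lambda>x. pl x (tval M e t)) ^^ n) (tval M e t)" for e t
    by (induction n) (auto simp: pl_def)
  then show ?thesis
    by (simp add: valued_axiom_def Let_def fV_def numeral_2_eq_2 numeral_3_eq_3 pl_def ml_def V_def U_def)
qed

lemma (in valued_struct) sat_valued_axiomI:
  assumes "equichar_0 R V"
  shows "sat M e (valued_axiom L n)"
proof -
  have ops: "fun_of M (plus_sym L) [x, y] = x \<oplus>\<^bsub>R\<^esub> y" "fun_of M (times_sym L) [x, y] = x \<otimes>\<^bsub>R\<^esub> y"
    "univ M = carrier R" for x y
    by simp_all
  have V: "rel_of M (vring_sym L) [x] \<longleftrightarrow> x \<in> V" if "x \<in> carrier R" for x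
    using that by (simp add: vring_def)
  have pow: "((\<lambda>x. x \<oplus>\<^bsub>R\<^esub> \<one>\<^bsub>R\<^esub>) ^^ n) \<one>\<^bsub>R\<^esub> = add_pow R (Suc n) \<one>\<^bsub>R\<^esub>"
  proof (induction n)
    case 0
    then show ?case using l_zero[of "\<one>\<^bsub>R\<^esub>"] one_closed by (simp add: add_pow_def nat_pow_def del: fld_simps)
  qed (simp add: add_pow_Suc del: fld_simps)
  have proper: "\<exists>x\<in>carrier R. x \<notin> V" and char: "vle R V \<one>\<^bsub>R\<^esub> (add_pow R (Suc n) \<one>\<^bsub>R\<^esub>)"
    using assms V_carrier unfolding equichar_0_iff by auto
  show ?thesis
    unfolding sat_valued_axiom unfolding ops
  proof (rule bexI[of _ "\<zero>\<^bsub>R\<^esub>"], rule bexI[of _ "\<one>\<^bsub>R\<^esub>"], intro conjI ballI impI)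
    fix x assume x: "x \<in> carrier R"
    show "\<exists>y\<in>carrier R. y \<oplus>\<^bsub>R\<^esub> x = \<zero>\<^bsub>R\<^esub>"
      using x l_neg a_inv_closed by blast
    show "\<exists>y\<in>carrier R. x \<otimes>\<^bsub>R\<^esub> y = \<one>\<^bsub>R\<^esub>" if "x \<noteq> \<zero>\<^bsub>R\<^esub>"
      using x that mult_inv inv_in by blast
    show "\<exists>y\<in>carrier R. rel_of M (vring_sym L) [y] \<and> y \<oplus>\<^bsub>R\<^esub> x = \<zero>\<^bsub>R\<^esub>" if "rel_of M (vring_sym L) [x]"
      using x that V V_minus l_neg a_inv_closed by blast
    show "x = \<zero>\<^bsub>R\<^esub> \<or> rel_of M (vring_sym L) [x] \<or> (\<exists>y\<in>carrier R. rel_of M (vring_sym L) [y] \<and> x \<otimes>\<^bsub>R\<^esub> y = \<one>\<^bsub>R\<^esub>)"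
      using x V V_or_inv mult_inv inv_in by blast
  next
    show "\<exists>x\<in>carrier R. \<not> rel_of M (vring_sym L) [x]" using proper V by blast
    show "\<exists>y\<in>carrier R. rel_of M (vring_sym L) [y] \<and> \<one>\<^bsub>R\<^esub> = ((\<lambda>x. x \<oplus>\<^bsub>R\<^esub> \<one>\<^bsub>R\<^esub>) ^^ n) \<one>\<^bsub>R\<^esub> \<otimes>\<^bsub>R\<^esub> y"
      unfolding pow using char V V_in unfolding vle_def by blast
    show "rel_of M (vring_sym L) [\<one>\<^bsub>R\<^esub>]" using V[OF one_closed] V_one by (simp del: fld_simps)
  next
    fix x y assume "x \<in> carrier R" "y \<in> carrier R" "rel_of M (vring_sym L) [y] \<and> rel_of M (vring_sym L) [x]"
    then show "rel_of M (vring_sym L) [x \<oplus>\<^bsub>R\<^esub> y]" "rel_of M (vring_sym L) [x \<otimes>\<^bsub>R\<^esub> y]"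
      using V[of x] V[of y] V[of "x \<oplus>\<^bsub>R\<^esub> y"] V[of "x \<otimes>\<^bsub>R\<^esub> y"] by (simp_all add: V_add V_mult del: fld_simps)
  qed (auto simp del: fld_simps intro: a_assoc a_comm m_assoc m_comm l_distr)
qed

text \<open>Zero and one of \<open>fld\<close> are definite descriptions. They have to be identified
  with the elements provided by the axiom before any ring law can be stated about them.\<close>

lemma valued_structI:
  fixes M :: "('f, 'r, 'u) struct" and L
  assumes L: "wf_vlang L" and M: "wf_struct L M" and ax: "\<And>n. \<exists>e. sat M e (valued_axiom L n)"
  shows "valued_struct L M" "equichar_0 (fld L M) (vring L M)"
proof -
  define R where "R = fld L M"
  have closed: "x \<oplus>\<^bsub>R\<^esub> y \<in> carrier R" "x \<otimes>\<^bsub>R\<^esub> y \<in> carrier R" if "x \<in> carrier R" "y \<in> carrier R" for x y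
    using that L M by (auto simp: R_def wf_struct_def wf_vlang_def tuples_def)
  have ops: "fun_of M (plus_sym L) [x, y] = x \<oplus>\<^bsub>R\<^esub> y" "fun_of M (times_sym L) [x, y] = x \<otimes>\<^bsub>R\<^esub> y"
    "univ M = carrier R" for x y
    by (simp_all add: R_def)
  have V: "rel_of M (vring_sym L) [x] \<longleftrightarrow> x \<in> vring L M" if "x \<in> carrier R" for x
    using that by (simp add: vring_def R_def)
  have ax': "\<And>n. \<exists>z\<in>carrier R. \<exists>u\<in>carrier R.
     (\<forall>x\<in>carrier R. \<forall>y\<in>carrier R. \<forall>w\<in>carrier R. (x \<oplus>\<^bsub>R\<^esub> y) \<oplus>\<^bsub>R\<^esub> w = x \<oplus>\<^bsub>R\<^esub> (y \<oplus>\<^bsub>R\<^esub> w)) \<and>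
     (\<forall>x\<in>carrier R. \<forall>y\<in>carrier R. x \<oplus>\<^bsub>R\<^esub> y = y \<oplus>\<^bsub>R\<^esub> x) \<and>
     (\<forall>x\<in>carrier R. z \<oplus>\<^bsub>R\<^esub> x = x) \<and> (\<forall>x\<in>carrier R. \<exists>y\<in>carrier R. y \<oplus>\<^bsub>R\<^esub> x = z) \<and>
     (\<forall>x\<in>carrier R. \<forall>y\<in>carrier R. \<forall>w\<in>carrier R. (x \<otimes>\<^bsub>R\<^esub> y) \<otimes>\<^bsub>R\<^esub> w = x \<otimes>\<^bsub>R\<^esub> (y \<otimes>\<^bsub>R\<^esub> w)) \<and>
     (\<forall>x\<in>carrier R. \<forall>y\<in>carrier R. x \<otimes>\<^bsub>R\<^esub> y = y \<otimes>\<^bsub>R\<^esub> x) \<and>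
     (\<forall>x\<in>carrier R. u \<otimes>\<^bsub>R\<^esub> x = x) \<and> u \<noteq> z \<and> (\<forall>x\<in>carrier R. x \<noteq> z \<longrightarrow> (\<exists>y\<in>carrier R. x \<otimes>\<^bsub>R\<^esub> y = u)) \<and>
     (\<forall>x\<in>carrier R. \<forall>y\<in>carrier R. \<forall>w\<in>carrier R. (x \<oplus>\<^bsub>R\<^esub> y) \<otimes>\<^bsub>R\<^esub> w = x \<otimes>\<^bsub>R\<^esub> w \<oplus>\<^bsub>R\<^esub> y \<otimes>\<^bsub>R\<^esub> w) \<and>
     (\<forall>x\<in>carrier R. \<forall>y\<in>carrier R. rel_of M (vring_sym L) [y] \<and> rel_of M (vring_sym L) [x] \<longrightarrow>
        rel_of M (vring_sym L) [x \<oplus>\<^bsub>R\<^esub> y] \<and> rel_of M (vring_sym L) [x \<otimes>\<^bsub>R\<^esub> y]) \<and>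
     rel_of M (vring_sym L) [u] \<and> (\<forall>x\<in>carrier R. rel_of M (vring_sym L) [x] \<longrightarrow> (\<exists>y\<in>carrier R. rel_of M (vring_sym L) [y] \<and> y \<oplus>\<^bsub>R\<^esub> x = z)) \<and>
     (\<forall>x\<in>carrier R. x = z \<or> rel_of M (vring_sym L) [x] \<or> (\<exists>y\<in>carrier R. rel_of M (vring_sym L) [y] \<and> x \<otimes>\<^bsub>R\<^esub> y = u)) \<and>
     (\<exists>x\<in>carrier R. \<not> rel_of M (vring_sym L) [x]) \<and>
     (\<exists>y\<in>carrier R. rel_of M (vring_sym L) [y] \<and> u = ((\<lambda>x. x \<oplus>\<^bsub>R\<^esub> u) ^^ n) u \<otimes>\<^bsub>R\<^esub> y)"
    using ax unfolding sat_valued_axiom ops by blast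
  have zero: "\<zero>\<^bsub>R\<^esub> = z" if "z \<in> carrier R" "\<forall>x\<in>carrier R. \<forall>y\<in>carrier R. x \<oplus>\<^bsub>R\<^esub> y = y \<oplus>\<^bsub>R\<^esub> x"
    "\<forall>x\<in>carrier R. z \<oplus>\<^bsub>R\<^esub> x = x" for z
  proof -
    have "(THE z. z \<in> carrier R \<and> (\<forall>x\<in>carrier R. z \<oplus>\<^bsub>R\<^esub> x = x)) = z"
    proof (rule the_equality)
      fix z' assume z': "z' \<in> carrier R \<and> (\<forall>x\<in>carrier R. z' \<oplus>\<^bsub>R\<^esub> x = x)"
      then have "z' \<oplus>\<^bsub>R\<^esub> z = z" "z \<oplus>\<^bsub>R\<^esub> z' = z'" "z' \<oplus>\<^bsub>R\<^esub> z = z \<oplus>\<^bsub>R\<^esub> z'"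
        using that by blast+
      then show "z' = z" by simp
    qed (use that in blast)
    then show ?thesis unfolding R_def by (simp add: fld_def)
  qed
  have one: "\<one>\<^bsub>R\<^esub> = z" if "z \<in> carrier R" "\<forall>x\<in>carrier R. \<forall>y\<in>carrier R. x \<otimes>\<^bsub>R\<^esub> y = y \<otimes>\<^bsub>R\<^esub> x"
    "\<forall>x\<in>carrier R. z \<otimes>\<^bsub>R\<^esub> x = x" for z
  proof -
    have "(THE z. z \<in> carrier R \<and> (\<forall>x\<in>carrier R. z \<otimes>\<^bsub>R\<^esub> x = x)) = z"
    proof (rule the_equality)
      fix z' assume z': "z' \<in> carrier R \<and> (\<forall>x\<in>carrier R. z' \<otimes>\<^bsub>R\<^esub> x = x)"
      then have "z' \<otimes>\<^bsub>R\<^esub> z = z" "z \<otimes>\<^bsub>R\<^esub> z' = z'" "z' \<otimes>\<^bsub>R\<^esub> z = z \<otimes>\<^bsub>R\<^esub> z'"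
        using that by blast+
      then show "z' = z" by simp
    qed (use that in blast)
    then show ?thesis unfolding R_def by (simp add: fld_def)
  qed
  from ax'[of 0] obtain z u where zu: "z \<in> carrier R" "u \<in> carrier R" and
     a1: "\<forall>x\<in>carrier R. \<forall>y\<in>carrier R. \<forall>w\<in>carrier R. (x \<oplus>\<^bsub>R\<^esub> y) \<oplus>\<^bsub>R\<^esub> w = x \<oplus>\<^bsub>R\<^esub> (y \<oplus>\<^bsub>R\<^esub> w)" and
     a2: "\<forall>x\<in>carrier R. \<forall>y\<in>carrier R. x \<oplus>\<^bsub>R\<^esub> y = y \<oplus>\<^bsub>R\<^esub> x" and
     a3: "\<forall>x\<in>carrier R. z \<oplus>\<^bsub>R\<^esub> x = x" and a4: "\<forall>x\<in>carrier R. \<exists>y\<in>carrier R. y \<oplus>\<^bsub>R\<^esub> x = z" and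
     m1: "\<forall>x\<in>carrier R. \<forall>y\<in>carrier R. \<forall>w\<in>carrier R. (x \<otimes>\<^bsub>R\<^esub> y) \<otimes>\<^bsub>R\<^esub> w = x \<otimes>\<^bsub>R\<^esub> (y \<otimes>\<^bsub>R\<^esub> w)" and
     m2: "\<forall>x\<in>carrier R. \<forall>y\<in>carrier R. x \<otimes>\<^bsub>R\<^esub> y = y \<otimes>\<^bsub>R\<^esub> x" and
     m3: "\<forall>x\<in>carrier R. u \<otimes>\<^bsub>R\<^esub> x = x" and m4: "u \<noteq> z" and
     m5: "\<forall>x\<in>carrier R. x \<noteq> z \<longrightarrow> (\<exists>y\<in>carrier R. x \<otimes>\<^bsub>R\<^esub> y = u)" and
     d: "\<forall>x\<in>carrier R. \<forall>y\<in>carrier R. \<forall>w\<in>carrier R. (x \<oplus>\<^bsub>R\<^esub> y) \<otimes>\<^bsub>R\<^esub> w = x \<otimes>\<^bsub>R\<^esub> w \<oplus>\<^bsub>R\<^esub> y \<otimes>\<^bsub>R\<^esub> w" and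
     v1: "\<forall>x\<in>carrier R. \<forall>y\<in>carrier R. rel_of M (vring_sym L) [y] \<and> rel_of M (vring_sym L) [x] \<longrightarrow>
        rel_of M (vring_sym L) [x \<oplus>\<^bsub>R\<^esub> y] \<and> rel_of M (vring_sym L) [x \<otimes>\<^bsub>R\<^esub> y]" and
     v2: "rel_of M (vring_sym L) [u]" and
     v3: "\<forall>x\<in>carrier R. rel_of M (vring_sym L) [x] \<longrightarrow> (\<exists>y\<in>carrier R. rel_of M (vring_sym L) [y] \<and> y \<oplus>\<^bsub>R\<^esub> x = z)" and
     v4: "\<forall>x\<in>carrier R. x = z \<or> rel_of M (vring_sym L) [x] \<or> (\<exists>y\<in>carrier R. rel_of M (vring_sym L) [y] \<and> x \<otimes>\<^bsub>R\<^esub> y = u)" and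
     v5: "\<exists>x\<in>carrier R. \<not> rel_of M (vring_sym L) [x]"
    by - (erule bexE, erule bexE, (erule conjE)+, rule that; assumption)
  have z: "\<zero>\<^bsub>R\<^esub> = z" by (rule zero) (fact zu a2 a3)+
  have u: "\<one>\<^bsub>R\<^esub> = u" by (rule one) (fact zu m2 m3)+
  have "abelian_group R"
    by (rule abelian_groupI) (use closed zu a1 a2 a3 a4 z in \<open>simp_all\<close>)
  moreover have "comm_monoid R"
    by (rule comm_monoidI) (use closed zu m1 m2 m3 u in \<open>simp_all\<close>)
  ultimately have "cring R"
    by (rule cringI) (use d in simp)
  then interpret cring R .
  have "field R"
    by (rule cring_fieldI2) (use z u m4 m5 in auto)
  then interpret field R .
  have "subring (vring L M) R"
  proof (rule subringI)
    show "vring L M \<subseteq> carrier R" by (auto simp: R_def vring_def)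
    show "\<one>\<^bsub>R\<^esub> \<in> vring L M" using V u v2 zu by simp
    fix h assume h: "h \<in> vring L M"
    then have hc: "h \<in> carrier R" by (auto simp: R_def vring_def)
    then obtain y where y: "y \<in> carrier R" "rel_of M (vring_sym L) [y]" "y \<oplus>\<^bsub>R\<^esub> h = \<zero>\<^bsub>R\<^esub>"
      using v3 h V z by blast
    then have "\<ominus>\<^bsub>R\<^esub> h = y" using hc by (intro minus_equality) auto
    then show "\<ominus>\<^bsub>R\<^esub> h \<in> vring L M" using y V by simp
    fix h' assume h': "h' \<in> vring L M"
    then have hc': "h' \<in> carrier R" by (auto simp: R_def vring_def)
    show "h \<otimes>\<^bsub>R\<^esub> h' \<in> vring L M" "h \<oplus>\<^bsub>R\<^esub> h' \<in> vring L M"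
      using h h' hc hc' v1 V closed by blast+
  qed
  moreover have "x \<in> vring L M \<or> inv\<^bsub>R\<^esub> x \<in> vring L M" if x: "x \<in> carrier R - {\<zero>\<^bsub>R\<^esub>}" for x
  proof (cases "x \<in> vring L M")
    case False
    with x v4 V z u obtain y where y: "y \<in> carrier R" "rel_of M (vring_sym L) [y]" "x \<otimes>\<^bsub>R\<^esub> y = \<one>\<^bsub>R\<^esub>"
      by blast
    then have "inv\<^bsub>R\<^esub> x = y" using x by (intro comm_inv_char) auto
    then show ?thesis using y V by simp
  qed simp
  ultimately have "valuation_ring R (vring L M)" by (simp add: valuation_ring_def)
  with \<open>field R\<close> show vs: "valued_struct L M"
    using L M by (simp add: valued_struct_def R_def)
  interpret vs: valued_struct L M by (rule vs)
  have pow: "((\<lambda>x. x \<oplus>\<^bsub>R\<^esub> \<one>\<^bsub>R\<^esub>) ^^ n) \<one>\<^bsub>R\<^esub> = add_pow R (Suc n) \<one>\<^bsub>R\<^esub>" for n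
  proof (induction n)
    case 0
    then show ?case by (simp add: add_pow_def nat_pow_def)
  next
    case (Suc n)
    then show ?case by (simp add: add_pow_def nat_pow_def)
  qed
  have "vle R (vring L M) \<one>\<^bsub>R\<^esub> (add_pow R (Suc n) \<one>\<^bsub>R\<^esub>)" for n
  proof -
    \<comment> \<open>Each instance of the scheme brings its own u; uniqueness of the unit
      identifies it with one.\<close>
    from ax'[of n] obtain z u where *: "z \<in> carrier R" "u \<in> carrier R"
      "\<forall>x\<in>carrier R. \<forall>y\<in>carrier R. x \<otimes>\<^bsub>R\<^esub> y = y \<otimes>\<^bsub>R\<^esub> x" "\<forall>x\<in>carrier R. u \<otimes>\<^bsub>R\<^esub> x = x"
      "\<exists>y\<in>carrier R. rel_of M (vring_sym L) [y] \<and> u = ((\<lambda>x. x \<oplus>\<^bsub>R\<^esub> u) ^^ n) u \<otimes>\<^bsub>R\<^esub> y"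
      by - (erule bexE, erule bexE, (erule conjE)+, rule that; assumption)
    have "\<one>\<^bsub>R\<^esub> = u" by (rule one) (fact *)+
    with *(5) show ?thesis using V unfolding vle_def pow[symmetric] by blast
  qed
  moreover have "vring L M \<noteq> carrier R" using v5 V by blast
  ultimately show "equichar_0 (fld L M) (vring L M)"
    unfolding vs.equichar_0_iff unfolding R_def[symmetric] by (metis gr0_conv_Suc)
qed

section \<open>Sets defined over leading terms\<close>

text \<open>Environments are split into a radius \<open>l\<close> (variable 0), field variables \<open>f\<close> (odd variables)
  and variables \<open>z\<close> standing for leading terms (positive even variables).\<close>

definition mix :: "(nat \<Rightarrow> 'a) \<Rightarrow> 'a \<Rightarrow> (nat \<Rightarrow> 'a) \<Rightarrow> nat \<Rightarrow> 'a" where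
  "mix f l z = case_nat l (\<lambda>k. if even k then f (k div 2) else z (k div 2))"

lemma mix_simps [simp]:
  "mix f l z 0 = l" "mix f l z (Suc (2 * j)) = f j" "mix f l z (Suc (Suc (2 * j))) = z j"
  by (simp_all add: mix_def)

lemma mix_cases:
  obtains "v = 0" | j where "v = Suc (2 * j)" | j where "v = Suc (Suc (2 * j))"
proof (cases v)
  case (Suc k)
  show thesis
  proof (cases "even k")
    case True
    then show thesis using that(2)[of "k div 2"] Suc by simp
  next
    case False
    then show thesis using that(3)[of "k div 2"] Suc by (simp add: odd_two_times_div_two_succ)
  qed
qed (rule that)

lemma mix_eta: "mix (\<lambda>j. e (Suc (2 * j))) (e 0) (\<lambda>j. e (Suc (Suc (2 * j)))) = e"
  by (rule ext) (rule_tac v = x in mix_cases; simp)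

lemma mix_in:
  assumes "\<And>j. f j \<in> A" "l \<in> A" "\<And>j. z j \<in> A"
  shows "mix f l z v \<in> A"
  by (cases v rule: mix_cases) (simp_all add: assms)

definition rv_equiv :: "('a, 'm) ring_scheme \<Rightarrow> 'a set \<Rightarrow> 'a \<Rightarrow> (nat \<Rightarrow> 'a) \<Rightarrow> 'a \<Rightarrow> (nat \<Rightarrow> 'a) \<Rightarrow> bool" where
  "rv_equiv R V l z l' z' \<longleftrightarrow> radius R V l \<and> radius R V l' \<and> vle R V l l' \<and> vle R V l' l \<and> (\<forall>j. rveq R V l (z j) (z' j))"

text \<open>Truth of p depends on l only through its value and on z only through the leading terms
  of that radius. An implication is enough, since \<open>rv_equiv\<close> is symmetric.\<close>

definition rv_invariant :: "('f, 'r) vlang \<Rightarrow> ('f, 'r, 'u) struct \<Rightarrow> ('f, 'r) fm \<Rightarrow> bool" where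
  "rv_invariant L M p \<longleftrightarrow> (\<forall>f l z l' z'. (\<forall>j. f j \<in> univ M) \<longrightarrow> l \<in> univ M \<longrightarrow> l' \<in> univ M \<longrightarrow>
     (\<forall>j. z j \<in> univ M) \<longrightarrow> (\<forall>j. z' j \<in> univ M) \<longrightarrow> rv_equiv (fld L M) (vring L M) l z l' z' \<longrightarrow>
     sat M (mix f l z) p \<longrightarrow> sat M (mix f l' z') p)"

text \<open>The language of M^eq has no predicate for the home sort. But x lies in it exactly if the
  pair (x, x) has an image in some sort of arity 2.\<close>

definition fHome :: "'u sort \<Rightarrow> nat \<Rightarrow> ('f, 'r + 'u sort) fm" where
  "fHome s k = Exi (Suc k) (Rel (Inr s) [Var k, Var k, Var (Suc k)])"

primrec relat :: "'u sort \<Rightarrow> ('f, 'r) fm \<Rightarrow> ('f, 'r + 'u sort) fm" where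
  "relat s (Eql t u) = Eql t u"
| "relat s (Rel r ts) = Rel (Inl r) ts"
| "relat s (Neg p) = Neg (relat s p)"
| "relat s (Conj p q) = Conj (relat s p) (relat s q)"
| "relat s (Exi k p) = Exi k (Conj (fHome s k) (relat s p))"

lemma fv_relat: "fv (relat s p) = fv p"
  by (induction p) (auto simp: fHome_def)

lemma wf_trm_eq_lang [simp]: "wf_trm (eq_lang L) t = wf_trm L t"
  by (induction t) (auto simp: eq_lang_def)

lemma arity_eq_lang [simp]:
  "farity (eq_lang L) f = farity L f" "rarity (eq_lang L) (Inl r) = rarity L r"
  "rarity (eq_lang L) (Inr (n, E)) = Suc n"
  by (simp_all add: eq_lang_def)

lemma wf_fHome: "wf_fm (eq_lang L) (fHome (2, E) k)"
  by (simp add: fHome_def)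

lemma wf_relat: "wf_fm L p \<Longrightarrow> wf_fm (eq_lang L) (relat (2, E) p)"
  by (induction p) (auto simp: wf_fHome)

lemma eq_struct_simps:
  "univ (eq_struct L M) = Inl ` univ M \<union> {Inr ((n, E), c) | n E c. is_sort L M (n, E) \<and> c \<in> tuples M n // E}"
  "fun_of (eq_struct L M) f zs = (if set zs \<subseteq> range Inl then Inl (fun_of M f (map projl zs)) else hd zs)"
  "rel_of (eq_struct L M) (Inl r) zs \<longleftrightarrow> set zs \<subseteq> range Inl \<and> rel_of M r (map projl zs)"
  "rel_of (eq_struct L M) (Inr (n, E)) zs \<longleftrightarrow> is_sort L M (n, E) \<and>
     (\<exists>xs\<in>tuples M n. zs = map Inl xs @ [Inr ((n, E), E `` {xs})])"
  by (simp_all add: eq_struct_def)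

lemma set_map_Inl: "set (map Inl xs) \<subseteq> range Inl"
  by auto

lemma map_projl_Inl: "map projl (map Inl xs) = xs"
  by (simp add: comp_def)

lemma tval_eq_struct: "tval (eq_struct L M) (\<lambda>i. Inl (e i)) t = Inl (tval M e t)"
proof (induction t)
  case (Fn f ts)
  have "map (tval (eq_struct L M) (\<lambda>i. Inl (e i))) ts = map Inl (map (tval M e) ts)"
    using Fn by auto
  then show ?case by (simp only: tval.simps eq_struct_simps if_True set_map_Inl map_projl_Inl)
qed simp

lemma tuples_2: "xs \<in> tuples M 2 \<longleftrightarrow> (\<exists>x l. xs = [x, l] \<and> x \<in> univ M \<and> l \<in> univ M)"
proof
  assume "xs \<in> tuples M 2"
  then show "\<exists>x l. xs = [x, l] \<and> x \<in> univ M \<and> l \<in> univ M"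
    by (auto simp: tuples_def length_Suc_conv numeral_2_eq_2)
qed (auto simp: tuples_def)

lemma sat_fHome:
  assumes s: "is_sort L M (2, E)"
  shows "sat (eq_struct L M) e (fHome (2, E) k) \<longleftrightarrow> e k \<in> Inl ` univ M"
proof
  assume "sat (eq_struct L M) e (fHome (2, E) k)"
  then show "e k \<in> Inl ` univ M" by (auto simp: fHome_def eq_struct_simps tuples_2)
next
  assume "e k \<in> Inl ` univ M"
  then obtain x where x: "x \<in> univ M" "e k = Inl x" by blast
  then have t: "[x, x] \<in> tuples M 2" by (simp add: tuples_2)
  then have "Inr ((2, E), E `` {[x, x]}) \<in> univ (eq_struct L M)"
    unfolding eq_struct_simps using s by (auto intro: quotientI)
  moreover have "rel_of (eq_struct L M) (Inr (2, E)) [Inl x, Inl x, Inr ((2, E), E `` {[x, x]})]"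
    unfolding eq_struct_simps using s t by force
  ultimately show "sat (eq_struct L M) e (fHome (2, E) k)"
    using x by (auto simp: fHome_def)
qed

lemma sat_relat:
  assumes s: "is_sort L M (2, E)"
  shows "(\<And>i. e i \<in> univ M) \<Longrightarrow> sat (eq_struct L M) (\<lambda>i. Inl (e i)) (relat (2, E) p) \<longleftrightarrow> sat M e p"
proof (induction p arbitrary: e)
  case (Rel r ts)
  have "map (tval (eq_struct L M) (\<lambda>i. Inl (e i))) ts = map Inl (map (tval M e) ts)"
    by (simp add: tval_eq_struct)
  then show ?case by (simp only: relat.simps sat.simps eq_struct_simps simp_thms set_map_Inl map_projl_Inl)
next
  case (Exi k p)
  have upd: "(\<lambda>i. Inl (e i))(k := Inl x) = (\<lambda>i. Inl ((e(k := x)) i))" for x by auto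
  have "sat (eq_struct L M) ((\<lambda>i. Inl (e i))(k := Inl x)) (relat (2, E) p) \<longleftrightarrow> sat M (e(k := x)) p"
    if "x \<in> univ M" for x
    unfolding upd by (rule Exi.IH) (use that Exi.prems in auto)
  moreover have "Inl x \<in> univ (eq_struct L M)" if "x \<in> univ M" for x
    using that by (simp add: eq_struct_simps)
  ultimately show ?case by (auto simp: sat_fHome[OF s])
qed (auto simp: tval_eq_struct)

text \<open>Variables 0, 1 and 2, 3 are the two pairs of a field element and a radius.\<close>

definition fSort :: "('f, 'r) vlang \<Rightarrow> ('f, 'r) fm" where
  "fSort L = Disj (Conj (fRad L 1) (Conj (fRad L 3) (Conj (fLe L 1 3) (Conj (fLe L 3 1) (fRv L 1 0 2)))))
     (Conj (Neg (fRad L 1)) (Neg (fRad L 3)))"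

lemma fv_fSort: "i \<in> fv (fSort L) \<Longrightarrow> i < 4"
  using fv_formulas(1)[of L 1 3] fv_formulas(1)[of L 3 1] fv_formulas(2)[of L 1] fv_formulas(2)[of L 3]
    fv_formulas(3)[of L 1 0 2]
  unfolding fSort_def by auto

lemma definable_mono: "definable L M P n X \<Longrightarrow> P \<subseteq> P' \<Longrightarrow> definable L M P' n X"
  unfolding definable_def by blast

lemma definable_eq_mono: "definable_eq L M P X \<Longrightarrow> P \<subseteq> P' \<Longrightarrow> definable_eq L M P' X"
  unfolding definable_eq_def definable_set_def by (rule definable_mono)

section \<open>The sort of leading terms\<close>

context valued_struct
begin

abbreviation "rvE \<equiv> snd (rv_sort L M)"

lemma rv_sort_eq: "rv_sort L M = (2, rvE)"
  by (simp add: rv_sort_def Let_def)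

lemma rv_radius_iff: "l \<in> univ M \<Longrightarrow> rv_radius L M l \<longleftrightarrow> radius R V l"
  using radius_iff[of l] by (simp add: rv_radius_def Let_def)

lemma mem_rvE:
  "([x, l], [x', l']) \<in> rvE \<longleftrightarrow> x \<in> univ M \<and> l \<in> univ M \<and> x' \<in> univ M \<and> l' \<in> univ M \<and>
     (radius R V l \<and> radius R V l' \<and> vle R V l l' \<and> vle R V l' l \<and> rveq R V l x x' \<or>
      \<not> radius R V l \<and> \<not> radius R V l')"
proof -
  have A: "([x, l], [x', l']) \<in> rvE \<longleftrightarrow> x \<in> univ M \<and> l \<in> univ M \<and> x' \<in> univ M \<and> l' \<in> univ M \<and>
     (rv_radius L M l \<and> rv_radius L M l' \<and> val R V l = val R V l' \<and> rv R V (val R V l) x = rv R V (val R V l') x' \<or>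
      \<not> rv_radius L M l \<and> \<not> rv_radius L M l')"
    by (auto simp: rv_sort_def Let_def)
  have B: "(rv_radius L M l \<and> rv_radius L M l' \<and> val R V l = val R V l' \<and> rv R V (val R V l) x = rv R V (val R V l') x')
      \<longleftrightarrow> (radius R V l \<and> radius R V l' \<and> vle R V l l' \<and> vle R V l' l \<and> rveq R V l x x')"
    if "x \<in> univ M" "l \<in> univ M" "x' \<in> univ M" "l' \<in> univ M"
    using that val_eq[of l l'] rv_eq[of l x x'] by (auto simp: rv_radius_iff)
  show ?thesis
  proof (cases "x \<in> univ M \<and> l \<in> univ M \<and> x' \<in> univ M \<and> l' \<in> univ M")
    case True
    then have "x \<in> univ M" "l \<in> univ M" "x' \<in> univ M" "l' \<in> univ M" by simp_all
    note B' = B[OF this] and l = rv_radius_iff[OF \<open>l \<in> univ M\<close>] rv_radius_iff[OF \<open>l' \<in> univ M\<close>]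
    show ?thesis unfolding A unfolding B' unfolding l by (rule refl)
  next
    case False
    then show ?thesis unfolding A by blast
  qed
qed

lemma rvE_subset: "rvE \<subseteq> tuples M 2 \<times> tuples M 2"
  unfolding rv_sort_def Let_def by (auto simp: tuples_2)

lemma equiv_rvE: "equiv (tuples M 2) rvE"
proof (rule equivI)
  show "rvE \<subseteq> tuples M 2 \<times> tuples M 2" by (rule rvE_subset)
  show "refl_on (tuples M 2) rvE"
    by (rule refl_onI) (auto simp: tuples_2 mem_rvE)
  show "sym rvE"
  proof (rule symI)
    fix a b assume ab: "(a, b) \<in> rvE"
    then have "a \<in> tuples M 2" "b \<in> tuples M 2" using rvE_subset by auto
    then obtain x l x' l' where *: "a = [x, l]" "b = [x', l']"
      by (auto simp: tuples_2)
    with ab show "(b, a) \<in> rvE"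
      unfolding * mem_rvE using rveq_sym[of l x x'] rveq_radius_cong[of l l' x' x] by auto
  qed
  show "trans rvE"
  proof (rule transI)
    fix a b c assume abc: "(a, b) \<in> rvE" "(b, c) \<in> rvE"
    then have "a \<in> tuples M 2" "b \<in> tuples M 2" "c \<in> tuples M 2" using rvE_subset by auto
    then obtain x l x' l' x'' l'' where *: "a = [x, l]" "b = [x', l']" "c = [x'', l'']"
      by (auto simp: tuples_2)
    with abc show "(a, c) \<in> rvE"
      unfolding * mem_rvE
      using le_trans[of l l' l''] le_trans[of l'' l' l] rveq_trans[of l x x' x''] rveq_radius_cong[of l' l x' x'']
      by auto
  qed
qed

lemma rvE_class_eq:
  "x \<in> univ M \<Longrightarrow> l \<in> univ M \<Longrightarrow> x' \<in> univ M \<Longrightarrow> l' \<in> univ M \<Longrightarrow>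
    rvE `` {[x, l]} = rvE `` {[x', l']} \<longleftrightarrow> ([x, l], [x', l']) \<in> rvE"
  using eq_equiv_class_iff[OF equiv_rvE, of "[x, l]" "[x', l']"] by (simp add: tuples_2)

lemma sat_fSort:
  "(\<And>i. i < 4 \<Longrightarrow> e i \<in> univ M) \<Longrightarrow> sat M e (fSort L) \<longleftrightarrow> ([e 0, e 1], [e 2, e 3]) \<in> rvE"
  by (simp add: fSort_def mem_rvE)

lemma rv_sort_is_sort: "is_sort L M (2, rvE)"
proof -
  have S: "sat M (\<lambda>i. if i < 4 then ws ! i else undefined i) (fSort L) \<longleftrightarrow> ([ws ! 0, ws ! 1], [ws ! 2, ws ! 3]) \<in> rvE"
    if "ws \<in> tuples M 4" for ws
    using sat_fSort[of "\<lambda>i. if i < 4 then ws ! i else undefined i"] that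
    by (simp add: tuples_def subset_iff)
  have "definable L M {} 4 {xs @ ys |xs ys. (xs, ys) \<in> rvE}"
    unfolding definable_def
  proof (intro exI conjI)
    show "wf_fm L (fSort L)" by (simp add: fSort_def wf_lang)
    show "\<forall>i\<in>fv (fSort L). i < 4 \<or> undefined i \<in> {}" using fv_fSort by blast
    show "{xs @ ys |xs ys. (xs, ys) \<in> rvE} =
        {xs \<in> tuples M 4. sat M (\<lambda>i. if i < 4 then xs ! i else undefined i) (fSort L)}" (is "?A = ?B")
    proof (intro equalityI subsetI)
      fix ws assume "ws \<in> ?A"
      then obtain xs ys where ws: "ws = xs @ ys" "(xs, ys) \<in> rvE" by blast
      then have "xs \<in> tuples M 2" "ys \<in> tuples M 2" using rvE_subset by auto
      then obtain x l x' l' where *: "xs = [x, l]" "ys = [x', l']" "{x, l, x', l'} \<subseteq> univ M"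
        by (auto simp: tuples_2)
      then have t: "ws \<in> tuples M 4" using ws by (simp add: tuples_def)
      have "sat M (\<lambda>i. if i < 4 then ws ! i else undefined i) (fSort L)"
        unfolding S[OF t] using ws * by (simp add: numeral_2_eq_2 numeral_3_eq_3)
      with t show "ws \<in> ?B" by simp
    next
      fix ws assume ws: "ws \<in> ?B"
      then have "length ws = 4" "set ws \<subseteq> univ M" by (auto simp: tuples_def)
      then obtain x l x' l' where *: "ws = [x, l, x', l']" "{x, l, x', l'} \<subseteq> univ M"
        by (auto simp: length_Suc_conv numeral_eq_Suc)
      have "([ws ! 0, ws ! 1], [ws ! 2, ws ! 3]) \<in> rvE" using ws S by blast
      then have "([x, l], [x', l']) \<in> rvE"
        using * by (simp add: numeral_2_eq_2 numeral_3_eq_3)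
      moreover have "ws = [x, l] @ [x', l']" using * by simp
      ultimately show "ws \<in> ?A" by blast
    qed
  qed
  then show ?thesis using equiv_rvE by (simp add: is_sort_def)
qed

end

section \<open>Definability over leading-term parameters\<close>

context valued_struct
begin

text \<open>A formula of M^eq sees the leading terms only as classes of the pairs (z j, l). It
  quantifies over representatives of these classes and evaluates p at them; by invariance of p the
  choice does not matter.\<close>

lemma definable_eq_over_rv:
  assumes p: "wf_fm L p" and inv: "rv_invariant L M p"
    and f: "\<And>j. f j \<in> univ M" and l: "l \<in> univ M" "radius R V l" and z: "\<And>j. z j \<in> univ M"
  shows "definable_eq L M (Inl ` range f \<union> rv_imag L M (val R V l) (range (\<lambda>j. rv R V (val R V l) (z j))))
    {y \<in> univ M. sat M (mix (f(i := y)) l z) p}"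
proof -
  define cls where "cls j = (Inr ((2, rvE), rvE `` {[z j, l]}) :: 'u eq_elem)" for j
  define P where "P = Inl ` range f \<union> rv_imag L M (val R V l) (range (\<lambda>j. rv R V (val R V l) (z j)))"
  \<comment> \<open>Layout of the variables: 0 for y, 1 for the common radius, 3 j + 2 for f j, 3 j
    + 3 for a representative of the j-th class, 3 j + 4 for the class itself. At 0, 1 and 3 j + 3,
    which are filled otherwise, \<open>E\<close> has default values in P.\<close>
  define E where "E v = (if v mod 3 = 2 then Inl (f (v div 3)) else if v mod 3 = 1 then cls (v div 3 - 1) else Inl (f 0))" for v
  have ar: "(3 * j + 2) mod 3 = 2" "(3 * j + 2) div 3 = j" "(3 * j + 4) mod 3 = 1" "(3 * j + 4) div 3 = Suc j"
    "(3 * j + 3) mod 3 = 0" "(3 * j + 3) div 3 = Suc j" for j :: nat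
    by presburger+
  have cls_P: "cls j \<in> P" for j
  proof -
    have "Inr (rv_sort L M, rvE `` {[z j, l]}) \<in> rv_imag L M (val R V l) (range (\<lambda>j. rv R V (val R V l) (z j)))"
      unfolding rv_imag_def Let_def using z l by blast
    then show ?thesis by (simp add: P_def cls_def rv_sort_eq[symmetric])
  qed
  have E_P: "E v \<in> P" for v
    using cls_P by (auto simp: E_def) (auto simp: P_def)
  have E: "E (3 * j + 2) = Inl (f j)" "E (3 * j + 4) = cls j" for j
    unfolding E_def ar by simp_all
  \<comment> \<open>k bounds the indices of the leading-term variables in p and is positive: at
    least one class is named, and it ties the quantified radius to the value of l.\<close>
  define k where "k = Suc (fresh (fv p))"
  have k: "j < k" if "Suc (Suc (2 * j)) \<in> fv p" for j
    using fresh_greater[OF finite_fv that] by (simp add: k_def)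
  define \<sigma> where "\<sigma> = mix (\<lambda>j. if j = i then 0 else 3 * j + 2) 1 (\<lambda>j. 3 * j + 3)"
  define vs where "vs = 1 # map (\<lambda>j. 3 * j + 3) [0..<k]"
  define \<Psi> where "\<Psi> = Conj (relat (2, rvE) (ren \<sigma> p))
     (Conjs (map (\<lambda>j. Rel (Inr (2, rvE)) [Var (3 * j + 3), Var 1, Var (3 * j + 4)]) [0..<k]))"
  define \<Phi> where "\<Phi> = Conj (fHome (2, rvE) 0) (exis vs \<Psi>)"
  have wf_\<Phi>: "wf_fm (eq_lang L) \<Phi>"
    using p by (simp add: \<Phi>_def \<Psi>_def wf_fHome wf_relat)
  have mod_vs: "v \<notin> set vs" if "v = 0 \<or> v = 3 * j + 2 \<or> v = 3 * j + 4" for v j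
    using that unfolding vs_def by (auto; presburger)
  have in_vs: "3 * j + 3 \<in> set vs" "1 \<in> set vs" if "j < k" for j
    using that by (auto simp: vs_def)
  note sort = rv_sort_is_sort
  have rel: "rel_of (eq_struct L M) (Inr (2, rvE)) [a, b, cls j] \<longleftrightarrow>
      (\<exists>x l'. a = Inl x \<and> b = Inl l' \<and> ([z j, l], [x, l']) \<in> rvE)" (is "?A = ?B") for a b j
  proof
    assume ?A
    then obtain x l' where "x \<in> univ M" "l' \<in> univ M" "a = Inl x" "b = Inl l'" "rvE `` {[z j, l]} = rvE `` {[x, l']}"
      by (auto simp: eq_struct_simps tuples_2 cls_def)
    then show ?B using rvE_class_eq[of "z j" l x l'] z l by blast
  next
    assume ?B
    then obtain x l' where *: "a = Inl x" "b = Inl l'" "([z j, l], [x, l']) \<in> rvE" by blast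
    then have t: "[x, l'] \<in> tuples M 2" "x \<in> univ M" "l' \<in> univ M" by (simp_all add: mem_rvE tuples_2)
    then have "rvE `` {[z j, l]} = rvE `` {[x, l']}" using rvE_class_eq[of "z j" l x l'] z l * by blast
    then show ?A unfolding eq_struct_simps cls_def using sort t * by (auto intro!: bexI[of _ "[x, l']"])
  qed
  have key: "sat (eq_struct L M) (\<lambda>v. if v < 1 then [u] ! v else E v) \<Phi> \<longleftrightarrow>
      (\<exists>y\<in>univ M. u = Inl y \<and> sat M (mix (f(i := y)) l z) p)" for u
  proof
    assume "sat (eq_struct L M) (\<lambda>v. if v < 1 then [u] ! v else E v) \<Phi>"
    then obtain y e' where y: "y \<in> univ M" "u = Inl y"
      and e': "\<And>v. v \<notin> set vs \<Longrightarrow> e' v = (if v < 1 then [u] ! v else E v)"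
      and sat: "sat (eq_struct L M) e' \<Psi>"
      by (auto simp: \<Phi>_def sat_fHome[OF sort] sat_exis)
    have e'_f: "e' (3 * j + 2) = Inl (f j)" "e' 0 = Inl y" "e' (3 * j + 4) = cls j" for j
      using e'[OF mod_vs[of _ j]] E y by auto
    have "\<exists>x l'. e' (3 * j + 3) = Inl x \<and> e' 1 = Inl l' \<and> ([z j, l], [x, l']) \<in> rvE" if "j < k" for j
    proof -
      have "rel_of (eq_struct L M) (Inr (2, rvE)) [e' (3 * j + 3), e' 1, e' (3 * j + 4)]"
        using sat that by (auto simp: \<Psi>_def)
      then show ?thesis unfolding e'_f rel .
    qed
    then obtain x l' where x: "\<And>j. j < k \<Longrightarrow> e' (3 * j + 3) = Inl (x j) \<and> e' 1 = Inl (l' j) \<and> ([z j, l], [x j, l' j]) \<in> rvE"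
      by metis
    define l1 where "l1 = l' 0"
    have l1: "e' 1 = Inl l1" "j < k \<Longrightarrow> l' j = l1" for j
      using x[of 0] x[of j] by (auto simp: l1_def k_def)
    define z1 where "z1 j = (if j < k then x j else z j)" for j
    have z1: "e' (3 * j + 3) = Inl (z1 j)" "([z j, l], [z1 j, l1]) \<in> rvE" if "j < k" for j
      using x[OF that] l1(2)[OF that] that by (auto simp: z1_def)
    have "0 < k" by (simp add: k_def)
    have l1_in: "l1 \<in> univ M" "radius R V l1" "vle R V l l1" "vle R V l1 l"
      using z1(2)[OF \<open>0 < k\<close>] l by (auto simp: mem_rvE)
    have z1_in: "z1 j \<in> univ M" "rveq R V l (z j) (z1 j)" for j
      using z1(2)[of j] z l by (auto simp: z1_def mem_rvE split: if_splits)
    have m: "e' (\<sigma> v) = Inl (mix (f(i := y)) l1 z1 v)" if "v \<in> fv p" for v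
      using that
    proof (cases v rule: mix_cases)
      case (2 j)
      then show ?thesis using e'_f by (auto simp: \<sigma>_def)
    next
      case (3 j)
      then show ?thesis using z1(1)[OF k] that by (auto simp: \<sigma>_def)
    qed (use l1(1) in \<open>simp add: \<sigma>_def\<close>)
    have m_in: "mix (f(i := y)) l1 z1 v \<in> univ M" for v
      by (rule mix_in) (use f y l1_in z1_in in auto)
    obtain g where g: "\<And>v. v \<in> fv p \<Longrightarrow> g (\<sigma> v) = mix (f(i := y)) l1 z1 v" "\<And>w. g w \<in> univ M"
    proof
      define g where "g w = (if w \<in> \<sigma> ` fv p then projl (e' w) else y)" for w
      show "g (\<sigma> v) = mix (f(i := y)) l1 z1 v" if "v \<in> fv p" for v
        using that m[OF that] by (simp add: g_def)
      show "g w \<in> univ M" for w using m m_in y by (auto simp: g_def)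
    qed
    have "sat (eq_struct L M) e' (relat (2, rvE) (ren \<sigma> p)) = sat (eq_struct L M) (\<lambda>w. Inl (g w)) (relat (2, rvE) (ren \<sigma> p))"
      by (rule sat_cong) (use fv_ren[of \<sigma> p] m g in \<open>auto simp: fv_relat\<close>)
    then have "sat M g (ren \<sigma> p)"
      using sat sat_relat[OF sort g(2)] by (simp add: \<Psi>_def)
    then have "sat M (mix (f(i := y)) l1 z1) p"
      using sat_cong[of p "\<lambda>v. g (\<sigma> v)" "mix (f(i := y)) l1 z1" M] g by simp
    moreover have "rveq R V l1 (z1 j) (z j)" for j
      using rveq_radius_cong[of l l1 "z1 j" "z j"] rveq_sym[of l "z j" "z1 j"] l l1_in z1_in[of j] z[of j] by simp
    then have "rv_equiv R V l1 z1 l z"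
      unfolding rv_equiv_def using l l1_in by simp
    \<comment> \<open>Invariance replaces the representatives that were found by the given z and
      l.\<close>
    ultimately have "sat M (mix (f(i := y)) l z) p"
      using inv[unfolded rv_invariant_def, rule_format, of "f(i := y)" l1 l z1 z] f y l l1_in z1_in z
      by simp
    with y show "\<exists>y\<in>univ M. u = Inl y \<and> sat M (mix (f(i := y)) l z) p" by blast
  next
    assume "\<exists>y\<in>univ M. u = Inl y \<and> sat M (mix (f(i := y)) l z) p"
    then obtain y where y: "y \<in> univ M" "u = Inl y" "sat M (mix (f(i := y)) l z) p" by blast
    define g where "g w = (if w = 0 then y else if w = 1 then l else if w mod 3 = 2 then f (w div 3) else z (w div 3 - 1))" for w
    have g: "g 0 = y" "g 1 = l" "g (3 * j + 2) = f j" "g (3 * j + 3) = z j" for j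
      unfolding g_def ar by simp_all
    have g_in: "g w \<in> univ M" for w using y l f z by (simp add: g_def)
    have "(\<lambda>v. g (\<sigma> v)) = mix (f(i := y)) l z"
    proof
      show "g (\<sigma> v) = mix (f(i := y)) l z v" for v
        by (cases v rule: mix_cases) (use g in \<open>auto simp: \<sigma>_def\<close>)
    qed
    then have "sat (eq_struct L M) (\<lambda>w. Inl (g w)) (relat (2, rvE) (ren \<sigma> p))"
      using y sat_relat[OF sort g_in] by simp
    define e' where "e' w = (if w \<in> set vs then Inl (g w) else if w < 1 then [u] ! w else E w)" for w
    have e': "e' (3 * j + 2) = Inl (f j)" "e' 0 = Inl y" "e' (3 * j + 4) = cls j" for j
      using mod_vs[of _ j] E y by (auto simp: e'_def)
    have "e' (\<sigma> v) = Inl (g (\<sigma> v))" if "v \<in> fv p" for v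
    proof (cases v rule: mix_cases)
      case 1
      then show ?thesis using in_vs(2) by (simp add: \<sigma>_def e'_def vs_def)
    next
      case (2 j)
      then show ?thesis using e' g by (simp add: \<sigma>_def)
    next
      case (3 j)
      then show ?thesis using in_vs(1) k that by (simp add: \<sigma>_def e'_def)
    qed
    then have "sat (eq_struct L M) e' (relat (2, rvE) (ren \<sigma> p)) = sat (eq_struct L M) (\<lambda>w. Inl (g w)) (relat (2, rvE) (ren \<sigma> p))"
      by (intro sat_cong) (use fv_ren[of \<sigma> p] in \<open>auto simp: fv_relat\<close>)
    with \<open>sat (eq_struct L M) (\<lambda>w. Inl (g w)) (relat (2, rvE) (ren \<sigma> p))\<close>
    have "sat (eq_struct L M) e' (relat (2, rvE) (ren \<sigma> p))" by simp
    moreover have "rel_of (eq_struct L M) (Inr (2, rvE)) [e' (3 * j + 3), e' 1, e' (3 * j + 4)]" if "j < k" for j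
    proof -
      have "e' (3 * j + 3) = Inl (z j)" "e' 1 = Inl l"
        using in_vs[OF that] g by (simp_all add: e'_def)
      then show ?thesis unfolding rel e'(3) using z l by (auto simp: mem_rvE)
    qed
    ultimately have "sat (eq_struct L M) e' \<Psi>" by (auto simp: \<Psi>_def)
    moreover have "e' v \<in> univ (eq_struct L M)" if "v \<in> set vs" for v
      using that g_in by (simp add: e'_def eq_struct_simps)
    moreover have "e' v = (if v < 1 then [u] ! v else E v)" if "v \<notin> set vs" for v
      using that by (simp add: e'_def)
    ultimately have "sat (eq_struct L M) (\<lambda>v. if v < 1 then [u] ! v else E v) (exis vs \<Psi>)"
      unfolding sat_exis by blast
    then show "sat (eq_struct L M) (\<lambda>v. if v < 1 then [u] ! v else E v) \<Phi>"
      using y by (simp add: \<Phi>_def sat_fHome[OF sort])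
  qed
  show ?thesis
    unfolding definable_eq_def definable_set_def definable_def P_def[symmetric]
  proof (intro exI conjI)
    show "wf_fm (eq_lang L) \<Phi>" by (rule wf_\<Phi>)
    show "\<forall>v\<in>fv \<Phi>. v < 1 \<or> E v \<in> P" using E_P by blast
    show "(\<lambda>x. [x]) ` Inl ` {y \<in> univ M. sat M (mix (f(i := y)) l z) p} =
      {xs \<in> tuples (eq_struct L M) 1. sat (eq_struct L M) (\<lambda>v. if v < 1 then xs ! v else E v) \<Phi>}" (is "?A = ?B")
    proof (intro equalityI subsetI)
      fix xs assume "xs \<in> ?A"
      then obtain y where y: "xs = [Inl y]" "y \<in> univ M" "sat M (mix (f(i := y)) l z) p" by blast
      then have "sat (eq_struct L M) (\<lambda>v. if v < 1 then [Inl y] ! v else E v) \<Phi>"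
        unfolding key by blast
      then show "xs \<in> ?B" using y by (simp add: tuples_def eq_struct_simps)
    next
      fix xs assume xs: "xs \<in> ?B"
      then obtain u where u: "xs = [u]" by (auto simp: tuples_def length_Suc_conv)
      then have "\<exists>y\<in>univ M. u = Inl y \<and> sat M (mix (f(i := y)) l z) p"
        using xs unfolding key[symmetric] by simp
      then show "xs \<in> ?A" using u by blast
    qed
  qed
qed

end

section \<open>Uniform preparation\<close>

lemma mix_upd: "mix (f(i := y)) l z = (mix f l z)(Suc (2 * i) := y)"
proof
  fix v
  show "mix (f(i := y)) l z v = ((mix f l z)(Suc (2 * i) := y)) v"
  proof (cases v rule: mix_cases)
    case (3 j)
    then show ?thesis by (simp, presburger)
  qed auto
qed

text \<open>\<theta> is read at c and the field variables alone; neither the radius nor the leading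
  terms enter. This reflects that the preparing sets of h-minimality are definable over A.\<close>

abbreviation prep_points :: "('f, 'r, 'u) struct \<Rightarrow> ('f, 'r) fm \<Rightarrow> (nat \<Rightarrow> 'u) \<Rightarrow> 'u set" where
  "prep_points M \<theta> f \<equiv> {c \<in> univ M. sat M (case_nat c f) \<theta>}"

definition rv_prepares :: "('f, 'r) vlang \<Rightarrow> ('f, 'r, 'u) struct \<Rightarrow> ('f, 'r) fm \<Rightarrow> nat \<Rightarrow> 'u set \<Rightarrow>
    (nat \<Rightarrow> 'u) \<Rightarrow> 'u \<Rightarrow> (nat \<Rightarrow> 'u) \<Rightarrow> bool" where
  "rv_prepares L M p i C f l z \<longleftrightarrow> (\<forall>y\<in>univ M. \<forall>y'\<in>univ M.
     (\<forall>c\<in>C. rveq (fld L M) (vring L M) l (y \<ominus>\<^bsub>fld L M\<^esub> c) (y' \<ominus>\<^bsub>fld L M\<^esub> c)) \<longrightarrow>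
     sat M (mix (f(i := y)) l z) p = sat M (mix (f(i := y')) l z) p)"

text \<open>For compactness the conclusion of h-minimality has to be a formula in the radius, the
  field variables and the leading terms. The renamed copies of p have coordinate i at one of the two
  quantified points, 1 for y and 0 for y', and all else shifted by two.\<close>

definition fPrep :: "('f, 'r) vlang \<Rightarrow> ('f, 'r) fm \<Rightarrow> nat \<Rightarrow> ('f, 'r) fm \<Rightarrow> nat \<Rightarrow> ('f, 'r) fm" where
  "fPrep L p i \<theta> m = (let \<theta>' = ren (case_nat 0 (\<lambda>j. Suc (Suc (2 * j)))) \<theta>;
       p' = (\<lambda>a. ren (\<lambda>v. if v = Suc (2 * i) then a else Suc (Suc v)) p) in
     Conj (AtMost m \<theta>') (Conj (ExB \<theta>')
       (AllB (AllB (Imp (AllB (Imp (ren (case_nat 0 (\<lambda>j. Suc (Suc (Suc (Suc (2 * j)))))) \<theta>) (fRvSub L 3 2 1 0)))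
          (Iff (p' 1) (p' 0)))))))"

lemma wf_fPrep: "wf_vlang L \<Longrightarrow> wf_fm L p \<Longrightarrow> wf_fm L \<theta> \<Longrightarrow> wf_fm L (fPrep L p i \<theta> m)"
  by (simp add: fPrep_def Let_def)

context valued_struct
begin

lemma univ_nonempty: "univ M \<noteq> {}"
  using wf by (simp add: wf_struct_def)

lemma sat_fPrep:
  assumes f: "\<And>j. f j \<in> univ M" and l: "l \<in> univ M" and z: "\<And>j. z j \<in> univ M"
  shows "sat M (mix f l z) (fPrep L p i \<theta> m) \<longleftrightarrow> finite (prep_points M \<theta> f) \<and> card (prep_points M \<theta> f) \<le> m \<and>
    prep_points M \<theta> f \<noteq> {} \<and> rv_prepares L M p i (prep_points M \<theta> f) f l z"
proof -
  have 1: "(\<lambda>v. case_nat y (mix f l z) (case_nat 0 (\<lambda>j. Suc (Suc (2 * j))) v)) = case_nat y f" for y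
    by (auto split: nat.split)
  have 2: "(\<lambda>v. case_nat c (case_nat y (case_nat y' (mix f l z))) (case_nat 0 (\<lambda>j. Suc (Suc (Suc (Suc (2 * j))))) v)) = case_nat c f"
    for c y y'
    by (auto split: nat.split)
  have 3: "(\<lambda>v. case_nat y' (case_nat y (mix f l z)) (if v = Suc (2 * i) then 1 else Suc (Suc v))) = mix (f(i := y)) l z"
    "(\<lambda>v. case_nat y' (case_nat y (mix f l z)) (if v = Suc (2 * i) then 0 else Suc (Suc v))) = mix (f(i := y')) l z" for y y'
    unfolding mix_upd by auto
  have points: "{y \<in> univ M. sat M (case_nat y (mix f l z)) (ren (case_nat 0 (\<lambda>j. Suc (Suc (2 * j)))) \<theta>)} = prep_points M \<theta> f"
    unfolding sat_ren 1 ..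
  have 4: "sat M (case_nat c (case_nat y' (case_nat y (mix f l z)))) (fRvSub L 3 2 1 0) \<longleftrightarrow> rveq R V l (y \<ominus>\<^bsub>R\<^esub> c) (y' \<ominus>\<^bsub>R\<^esub> c)"
    if "c \<in> univ M" "y \<in> univ M" "y' \<in> univ M" for c y y'
    using that l by (simp add: numeral_2_eq_2 numeral_3_eq_3)
  have ne: "sat M (mix f l z) (ExB (ren (case_nat 0 (\<lambda>j. Suc (Suc (2 * j)))) \<theta>)) \<longleftrightarrow> prep_points M \<theta> f \<noteq> {}"
    unfolding points[symmetric] by auto
  have prep: "sat M (mix f l z) (AllB (AllB (Imp (AllB (Imp (ren (case_nat 0 (\<lambda>j. Suc (Suc (Suc (Suc (2 * j)))))) \<theta>) (fRvSub L 3 2 1 0)))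
          (Iff (ren (\<lambda>v. if v = Suc (2 * i) then 1 else Suc (Suc v)) p) (ren (\<lambda>v. if v = Suc (2 * i) then 0 else Suc (Suc v)) p)))))
      \<longleftrightarrow> rv_prepares L M p i (prep_points M \<theta> f) f l z"
  proof -
    have "(\<forall>c\<in>univ M. sat M (case_nat c f) \<theta> \<longrightarrow> sat M (case_nat c (case_nat y' (case_nat y (mix f l z)))) (fRvSub L 3 2 1 0))
        \<longleftrightarrow> (\<forall>c\<in>prep_points M \<theta> f. rveq R V l (y \<ominus>\<^bsub>R\<^esub> c) (y' \<ominus>\<^bsub>R\<^esub> c))"
      if "y \<in> univ M" "y' \<in> univ M" for y y'
      using 4[OF _ that] by auto
    then show ?thesis
      unfolding rv_prepares_def sat_connectives sat_ren 2 3 by (intro ball_cong refl) (simp only:)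
  qed
  show ?thesis
    unfolding fPrep_def Let_def sat.simps ne prep sat_AtMost[OF univ_nonempty] points by blast
qed

lemma rv_prepares_mono:
  "rv_prepares L M p i C f l z \<Longrightarrow> C \<subseteq> C' \<Longrightarrow> rv_prepares L M p i C' f l z"
  unfolding rv_prepares_def by blast

text \<open>The fibre of p in coordinate i is definable over the values of f and the leading terms
  of z, so it has a preparing set over the values of f. These values are listed by f, which turns
  the definition of that set into a formula \<theta> of the field variables.\<close>

lemma h_minimal_prepares:
  assumes h: "h_minimal TYPE('u) \<infinity> L T" and T: "models L M T"
    and p: "wf_fm L p" and inv: "rv_invariant L M p"
    and f: "\<And>j. f j \<in> univ M" and l: "l \<in> univ M" "radius R V l" and z: "\<And>j. z j \<in> univ M"
  obtains \<theta> where "wf_fm L \<theta>" "finite (prep_points M \<theta> f)" "prep_points M \<theta> f \<noteq> {}"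
    "rv_prepares L M p i (prep_points M \<theta> f) f l z"
proof -
  define X where "X = {y \<in> univ M. sat M (mix (f(i := y)) l z) p}"
  define A' where "A' = range (\<lambda>j. rv R V (val R V l) (z j))"
  have l0: "l \<noteq> \<zero>\<^bsub>R\<^esub>" using l by (simp add: radius_def)
  have "definable_eq L M (Inl ` range f \<union> rv_imag L M (val R V \<one>\<^bsub>R\<^esub>) (RV R V (val R V \<one>\<^bsub>R\<^esub>)) \<union> rv_imag L M (val R V l) A') X"
    using definable_eq_over_rv[OF p inv f l z] unfolding X_def A'_def
    by (rule definable_eq_mono) blast
  moreover have "val R V l \<in> value_group R V" using l l0 by (auto simp: value_group_def)
  moreover have "val_le R V (val R V l) (val R V \<one>\<^bsub>R\<^esub>)" using l radius_iff[of l] by simp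
  moreover have "range f \<subseteq> univ M" "A' \<subseteq> RV R V (val R V l)" "X \<subseteq> univ M"
    using f z by (auto simp: A'_def RV_def X_def)
  \<comment> \<open>All the z j are offered as parameters of radius l; countably many are allowed
    because the bound is \<omega>.\<close>
  moreover have "card_at_most A' \<infinity>" by (simp add: card_at_most_def A'_def)
  ultimately obtain C where C: "definable_set L M (range f) C" "prepares R V (val R V l) C X"
    using h[unfolded h_minimal_def Let_def, rule_format, OF T] by blast
  then obtain q e where q: "wf_fm L q" "\<forall>v\<in>fv q. v < 1 \<or> e v \<in> range f"
    "(\<lambda>x. [x]) ` C = {xs \<in> tuples M 1. sat M (\<lambda>v. if v < 1 then xs ! v else e v) q}"
    unfolding definable_set_def definable_def by blast
  note iff = C(2)[unfolded prepares_iff[OF l(2)] fld_simps]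
  note prep = conjunct1[OF iff] conjunct1[OF conjunct2[OF iff]] conjunct1[OF conjunct2[OF conjunct2[OF iff]]]
    conjunct2[OF conjunct2[OF conjunct2[OF iff]]]
  \<comment> \<open>A parameter of the defining formula is replaced by a field variable with that
    value.\<close>
  define \<sigma> where "\<sigma> v = (if v < 1 then 0 else Suc (SOME j. f j = e v))" for v
  define \<theta> where "\<theta> = ren \<sigma> q"
  have "f (SOME j. f j = e v) = e v" if "v \<in> fv q" "\<not> v < 1" for v
  proof (rule someI_ex)
    have "e v \<in> range f" using q(2) that by blast
    then show "\<exists>j. f j = e v" by (metis rangeE)
  qed
  then have sat: "sat M (case_nat c f) \<theta> = sat M (\<lambda>v. if v < 1 then [c] ! v else e v) q" for c
    unfolding \<theta>_def sat_ren by (intro sat_cong) (auto simp: \<sigma>_def)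
  have "c \<in> C \<longleftrightarrow> c \<in> univ M \<and> sat M (case_nat c f) \<theta>" for c
  proof -
    have "c \<in> C \<longleftrightarrow> [c] \<in> (\<lambda>x. [x]) ` C" by auto
    then show ?thesis unfolding q(3) sat by (simp add: tuples_def)
  qed
  then have C_eq: "prep_points M \<theta> f = C" by auto
  show thesis
  proof (rule that)
    show "wf_fm L \<theta>" using q by (simp add: \<theta>_def)
    show "rv_prepares L M p i (prep_points M \<theta> f) f l z"
      unfolding C_eq rv_prepares_def
    proof (intro ballI impI)
      fix y y' assume y: "y \<in> univ M" "y' \<in> univ M" "\<forall>c\<in>C. rveq R V l (y \<ominus>\<^bsub>R\<^esub> c) (y' \<ominus>\<^bsub>R\<^esub> c)"
      then have "y \<in> X \<longleftrightarrow> y' \<in> X" using prep(4) by blast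
      then show "sat M (mix (f(i := y)) l z) p = sat M (mix (f(i := y')) l z) p"
        using y by (simp add: X_def)
    qed
    show "finite (prep_points M \<theta> f)" unfolding C_eq by (rule prep(1))
    show "prep_points M \<theta> f \<noteq> {}" unfolding C_eq by (rule prep(2))
  qed
qed

end

text \<open>If no finite list of pairs (\<theta>, m) were enough, compactness would give a model in
  \<open>'u\<close> and an environment where no \<theta> prepares the fibre with at most m points
  for any m, against h-minimality there. The members of the list that are small enough at f are
  united; enlarging a preparing set keeps it preparing.\<close>

theorem uniform_preparation:
  fixes L :: "('f, 'r) vlang" and M :: "('f, 'r, 'v) struct" and g :: "('f + 'r) + nat \<Rightarrow> 'u"
  assumes M: "valued_struct L M" and g: "inj g" and h: "h_minimal TYPE('u) \<infinity> L T" and T: "T \<subseteq> Th L M"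
    and p: "wf_fm L p" and inv: "\<And>N :: ('f, 'r, 'u) struct. models L N T \<Longrightarrow> rv_invariant L N p"
  obtains \<theta> m where "wf_fm L \<theta>"
    "\<And>f. (\<And>j. f j \<in> univ M) \<Longrightarrow> finite (prep_points M \<theta> f) \<and> card (prep_points M \<theta> f) \<le> m \<and> prep_points M \<theta> f \<noteq> {}"
    "\<And>f l z. (\<And>j. f j \<in> univ M) \<Longrightarrow> l \<in> univ M \<Longrightarrow> radius (fld L M) (vring L M) l \<Longrightarrow> (\<And>j. z j \<in> univ M) \<Longrightarrow>
      rv_prepares L M p i (prep_points M \<theta> f) f l z"
proof -
  interpret M: valued_struct L M by (rule M)
  \<comment> \<open>The radius condition is included because h-minimality speaks only of radii in
    (0, 1].\<close>
  define \<Sigma> where "\<Sigma> = insert (fRad L 0) {Neg (fPrep L p i \<theta> m) | \<theta> m. wf_fm L \<theta>}"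
  define bad where "bad F \<longleftrightarrow> finite F \<and> F \<subseteq> \<Sigma> \<and> (\<forall>e. (\<forall>v. e v \<in> univ M) \<longrightarrow> (\<exists>q\<in>F. \<not> sat M e q))" for F
  have "\<exists>F. bad F"
  proof (rule ccontr)
    assume "\<nexists>F. bad F"
    then have fin: "\<exists>e. (\<forall>v. e v \<in> univ M) \<and> (\<forall>q\<in>F. sat M e q)" if "finite F" "F \<subseteq> \<Sigma>" for F
      using that unfolding bad_def by (metis (no_types, lifting))
    have wf: "wf_fm L q" if "q \<in> \<Sigma>" for q
      using that p M.wf_lang by (auto simp: \<Sigma>_def wf_fPrep)
    obtain N :: "('f, 'r, 'u) struct" and e where N: "models L N (Th L M)" "\<And>v. e v \<in> univ N"
      "\<And>q. q \<in> \<Sigma> \<Longrightarrow> sat N e q"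
      by (rule compactness[OF M.wf g wf fin]) blast+
    then have NT: "models L N T" using T unfolding models_def by blast
    then have "equichar_0 (fld L N) (vring L N)"
      using h unfolding h_minimal_def Let_def by blast
    then have "valued_struct L N"
      using M.wf_lang NT unfolding valued_struct_def equichar_0_def valued_field_def models_def by blast
    then interpret N: valued_struct L N .
    define f l z where "f j = e (Suc (2 * j))" and "l = e 0" and "z j = e (Suc (Suc (2 * j)))" for j
    have e: "e = mix f l z" unfolding f_def l_def z_def by (rule mix_eta[symmetric])
    have in_univ: "f j \<in> univ N" "l \<in> univ N" "z j \<in> univ N" for j
      using N(2) by (simp_all add: f_def l_def z_def)
    have "sat N e (fRad L 0)" by (rule N(3)) (simp add: \<Sigma>_def)
    then have rad: "radius (fld L N) (vring L N) l" using in_univ by (simp add: l_def)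
    obtain \<theta> where \<theta>: "wf_fm L \<theta>" "finite (prep_points N \<theta> f)" "prep_points N \<theta> f \<noteq> {}"
      "rv_prepares L N p i (prep_points N \<theta> f) f l z"
      by (rule N.h_minimal_prepares[OF h NT p inv[OF NT] in_univ(1,2) rad in_univ(3)])
    then have "sat N e (fPrep L p i \<theta> (card (prep_points N \<theta> f)))"
      unfolding e by (subst N.sat_fPrep) (use in_univ in auto)
    moreover have "sat N e (Neg (fPrep L p i \<theta> (card (prep_points N \<theta> f))))"
      by (rule N(3)) (use \<theta>(1) in \<open>auto simp: \<Sigma>_def\<close>)
    ultimately show False by simp
  qed
  then obtain F where F: "finite F" "F \<subseteq> \<Sigma>" "\<And>e. (\<And>v. e v \<in> univ M) \<Longrightarrow> \<exists>q\<in>F. \<not> sat M e q"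
    unfolding bad_def by blast
  have "F - {fRad L 0} \<subseteq> (\<lambda>(\<theta>, m). Neg (fPrep L p i \<theta> m)) ` {(\<theta>, m). wf_fm L \<theta>}"
    using F(2) by (auto simp: \<Sigma>_def)
  then obtain G where G: "finite G" "G \<subseteq> {(\<theta>, m). wf_fm L \<theta>}" "F - {fRad L 0} = (\<lambda>(\<theta>, m). Neg (fPrep L p i \<theta> m)) ` G"
    using F(1) by (meson finite_Diff finite_subset_image)
  obtain gs where gs: "set gs = G" using finite_list[OF G(1)] by blast
  \<comment> \<open>The guard admits only those \<theta> with at most m points at f, so the union is
    finite. It is a condition on f alone, hence shifted by \<open>Suc\<close> past the point
    c.\<close>
  define \<theta> where "\<theta> = Neg (Conjs (map (\<lambda>(\<theta>, m). Neg (Conj \<theta> (ren Suc (AtMost m \<theta>)))) gs))"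
  have points: "prep_points M \<theta> f = \<Union> ((\<lambda>(\<theta>, m). prep_points M \<theta> f) ` {(\<theta>, m) \<in> G. finite (prep_points M \<theta> f) \<and> card (prep_points M \<theta> f) \<le> m})" for f
  proof -
    have "sat M (case_nat c f) \<theta> \<longleftrightarrow> (\<exists>(\<theta>', m)\<in>G. sat M (case_nat c f) \<theta>' \<and> finite (prep_points M \<theta>' f) \<and> card (prep_points M \<theta>' f) \<le> m)" for c
      by (simp add: \<theta>_def gs sat_AtMost[OF M.univ_nonempty] split_beta conj_ac)
    then show ?thesis by auto
  qed
  have some: "\<exists>(\<theta>, m)\<in>G. finite (prep_points M \<theta> f) \<and> card (prep_points M \<theta> f) \<le> m \<and>
      prep_points M \<theta> f \<noteq> {} \<and> rv_prepares L M p i (prep_points M \<theta> f) f l z"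
    if f: "\<And>j. f j \<in> univ M" and l: "l \<in> univ M" "radius (fld L M) (vring L M) l" and z: "\<And>j. z j \<in> univ M" for f l z
  proof -
    have "mix f l z v \<in> univ M" for v by (rule mix_in) (use f l z in auto)
    then obtain q where q: "q \<in> F" "\<not> sat M (mix f l z) q" using F(3) by blast
    have "q \<noteq> fRad L 0" using q(2) l by auto
    with q(1) have "q \<in> (\<lambda>(\<theta>, m). Neg (fPrep L p i \<theta> m)) ` G" by (simp flip: G(3))
    then obtain \<theta> m where \<theta>: "(\<theta>, m) \<in> G" "q = Neg (fPrep L p i \<theta> m)" by auto
    have "sat M (mix f l z) (fPrep L p i \<theta> m)" using q(2) \<theta>(2) by simp
    then show ?thesis using \<theta>(1) unfolding M.sat_fPrep[OF f l(1) z] by blast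
  qed
  show thesis
  proof (rule that)
    show "wf_fm L \<theta>" unfolding \<theta>_def using G(2) gs by auto
    fix f :: "nat \<Rightarrow> 'v" assume f: "\<And>j. f j \<in> univ M"
    define H where "H = {(\<theta>, m) \<in> G. finite (prep_points M \<theta> f) \<and> card (prep_points M \<theta> f) \<le> m}"
    have H: "finite H" unfolding H_def using G(1) by (rule rev_finite_subset) auto
    have "card (prep_points M \<theta> f) \<le> (\<Sum>x\<in>H. card (case x of (\<theta>, m) \<Rightarrow> prep_points M \<theta> f))"
      unfolding points H_def[symmetric] by (rule card_UN_le[OF H])
    also have "\<dots> \<le> (\<Sum>x\<in>H. snd x)" by (rule sum_mono) (auto simp: H_def)
    also have "\<dots> \<le> (\<Sum>x\<in>G. snd x)" by (rule sum_mono2[OF G(1)]) (auto simp: H_def)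
    finally have "card (prep_points M \<theta> f) \<le> (\<Sum>x\<in>G. snd x)" .
    moreover have "finite (prep_points M \<theta> f)"
      unfolding points H_def[symmetric] using H by (auto simp: H_def)
    moreover have "prep_points M \<theta> f \<noteq> {}"
    proof -
      \<comment> \<open>Nonemptiness concerns f alone, so it may be read off at radius 1 and
        arbitrary leading terms.\<close>
      have "radius (fld L M) (vring L M) \<one>\<^bsub>fld L M\<^esub>" using M.V_one by (simp add: radius_def)
      moreover have "\<one>\<^bsub>fld L M\<^esub> \<in> univ M" using M.one_closed by simp
      ultimately obtain \<theta>' m where "(\<theta>', m) \<in> G" "finite (prep_points M \<theta>' f)" "card (prep_points M \<theta>' f) \<le> m"
        "prep_points M \<theta>' f \<noteq> {}"
        using some[of f "\<one>\<^bsub>fld L M\<^esub>" "\<lambda>_. \<one>\<^bsub>fld L M\<^esub>"] f by blast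
      then show ?thesis unfolding points by blast
    qed
    ultimately show "finite (prep_points M \<theta> f) \<and> card (prep_points M \<theta> f) \<le> (\<Sum>x\<in>G. snd x) \<and> prep_points M \<theta> f \<noteq> {}"
      by blast
  next
    fix f z :: "nat \<Rightarrow> 'v" and l
    assume *: "\<And>j. f j \<in> univ M" "l \<in> univ M" "radius (fld L M) (vring L M) l" "\<And>j. z j \<in> univ M"
    then obtain \<theta>' m where "(\<theta>', m) \<in> G" "finite (prep_points M \<theta>' f)" "card (prep_points M \<theta>' f) \<le> m"
      "rv_prepares L M p i (prep_points M \<theta>' f) f l z"
      using some[of f l z] by blast
    then show "rv_prepares L M p i (prep_points M \<theta> f) f l z"
      using M.rv_prepares_mono[of p i "prep_points M \<theta>' f" f l z "prep_points M \<theta> f"] unfolding points by blast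
  qed
qed

section \<open>Back and forth\<close>

text \<open>In the environment \<open>(c, mix f l z)\<close>: some \<open>y\<close> that is nearest to \<open>c\<close> among the points given by
  \<open>\<theta>\<close> has \<open>rv (y - c) = rv (z 0)\<close> and satisfies \<open>p\<close> unless \<open>z 1 = 0\<close>.\<close>

definition fTau :: "('f, 'r) vlang \<Rightarrow> ('f, 'r) fm \<Rightarrow> nat \<Rightarrow> ('f, 'r) fm \<Rightarrow> ('f, 'r) fm" where
  "fTau L p i \<theta> = ExB (Conj (AllB (Imp (ren (case_nat 0 (\<lambda>j. Suc (Suc (Suc (Suc (2 * j)))))) \<theta>) (fNear L 1 2 0)))
     (Conj (ExB (Conj (fSub L 0 1 2) (fRv L 3 0 5)))
       (Disj (fZero L 6) (ren (mix (\<lambda>j. if j = i then 0 else Suc (Suc (Suc (2 * j)))) (Suc (Suc 0)) (\<lambda>j. Suc (Suc (Suc (Suc (2 * Suc (Suc j))))))) p))))"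

text \<open>The leading terms are divided into blocks by \<open>prod_encode\<close>. Entry 0 of
  block b is a flag: it is zero if the rest of the block is to lie in the set belonging to c, and
  nonzero if it is not.\<close>

definition fBlock :: "('f, 'r) vlang \<Rightarrow> ('f, 'r) fm \<Rightarrow> nat \<Rightarrow> ('f, 'r) fm \<Rightarrow> nat \<Rightarrow> ('f, 'r) fm" where
  "fBlock L p i \<theta> b = Iff (fZero L (2 * prod_encode (b, 0) + 3))
     (ren (case_nat 0 (\<lambda>v. Suc (mix (\<lambda>j. 2 * j + 1) 0 (\<lambda>j. 2 * prod_encode (b, Suc j) + 2) v))) (fTau L p i \<theta>))"

text \<open>Two finite families of at most \<open>m\<close> sets that contain the same combinations of \<open>m\<close> points and
  non-points are equal as sets of sets; this replaces naming the points of \<open>\<theta>\<close> individually.\<close>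

definition fBF :: "('f, 'r) vlang \<Rightarrow> ('f, 'r) fm \<Rightarrow> nat \<Rightarrow> ('f, 'r) fm \<Rightarrow> nat \<Rightarrow> ('f, 'r) fm" where
  "fBF L p i \<theta> m = ExB (Conj (ren (case_nat 0 (\<lambda>j. 2 * j + 2)) \<theta>) (Conjs (map (fBlock L p i \<theta>) [0..<m])))"

lemma wf_fBF: "wf_vlang L \<Longrightarrow> wf_fm L p \<Longrightarrow> wf_fm L \<theta> \<Longrightarrow> wf_fm L (fBF L p i \<theta> m)"
  by (simp add: fBF_def fBlock_def fTau_def)

definition feq :: "('f, 'r, 'u) struct \<Rightarrow> ('f, 'r) fm \<Rightarrow> 'u \<Rightarrow> (nat \<Rightarrow> 'u) \<Rightarrow> (nat \<Rightarrow> 'u) \<Rightarrow> bool" where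
  "feq M p l f f' \<longleftrightarrow> (\<forall>z. (\<forall>j. z j \<in> univ M) \<longrightarrow> sat M (mix f l z) p = sat M (mix f' l z) p)"

context valued_struct
begin

definition tau :: "('f, 'r) fm \<Rightarrow> nat \<Rightarrow> ('f, 'r) fm \<Rightarrow> (nat \<Rightarrow> 'u) \<Rightarrow> 'u \<Rightarrow> 'u \<Rightarrow> (nat \<Rightarrow> 'u) \<Rightarrow> bool" where
  "tau p i \<theta> f c l z \<longleftrightarrow> (\<exists>y\<in>univ M. (\<forall>c'\<in>prep_points M \<theta> f. vle R V (y \<ominus>\<^bsub>R\<^esub> c) (y \<ominus>\<^bsub>R\<^esub> c')) \<and>
     rveq R V l (y \<ominus>\<^bsub>R\<^esub> c) (z 0) \<and>
     (z 1 = \<zero>\<^bsub>R\<^esub> \<or> sat M (mix (f(i := y)) l (\<lambda>j. z (Suc (Suc j)))) p))"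

lemma sat_fTau:
  assumes f: "\<And>j. f j \<in> univ M" and l: "l \<in> univ M" and z: "\<And>j. z j \<in> univ M" and c: "c \<in> univ M"
  shows "sat M (case_nat c (mix f l z)) (fTau L p i \<theta>) \<longleftrightarrow> tau p i \<theta> f c l z"
proof -
  let ?e = "\<lambda>y. case_nat y (case_nat c (mix f l z))"
  have z01: "mix f l z (Suc (Suc 0)) = z 0" "mix f l z (Suc (Suc (Suc (Suc 0)))) = z (Suc 0)"
    using mix_simps(3)[of f l z 0] mix_simps(3)[of f l z "Suc 0"] by (simp_all add: numeral_eq_Suc)
  have near: "sat M (?e y) (AllB (Imp (ren (case_nat 0 (\<lambda>j. Suc (Suc (Suc (Suc (2 * j)))))) \<theta>) (fNear L 1 2 0))) \<longleftrightarrow>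
      (\<forall>c'\<in>prep_points M \<theta> f. vle R V (y \<ominus>\<^bsub>R\<^esub> c) (y \<ominus>\<^bsub>R\<^esub> c'))" if "y \<in> univ M" for y
  proof -
    have "(\<lambda>v. case_nat c' (?e y) (case_nat 0 (\<lambda>j. Suc (Suc (Suc (Suc (2 * j))))) v)) = case_nat c' f" for c'
    proof
      show "case_nat c' (?e y) (case_nat 0 (\<lambda>j. Suc (Suc (Suc (Suc (2 * j))))) v) = case_nat c' f v" for v
        by (cases v) simp_all
    qed
    moreover have "sat M (case_nat c' (?e y)) (fNear L 1 2 0) \<longleftrightarrow> vle R V (y \<ominus>\<^bsub>R\<^esub> c) (y \<ominus>\<^bsub>R\<^esub> c')" if "c' \<in> univ M" for c'
      using that \<open>y \<in> univ M\<close> c by (simp add: numeral_2_eq_2)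
    ultimately show ?thesis by auto
  qed
  have rvd: "sat M (?e y) (ExB (Conj (fSub L 0 1 2) (fRv L 3 0 5))) \<longleftrightarrow> rveq R V l (y \<ominus>\<^bsub>R\<^esub> c) (z 0)"
    if "y \<in> univ M" for y
    using that c l z[of 0] by (auto simp: numeral_eq_Suc z01)
  have zero: "sat M (?e y) (fZero L 6) \<longleftrightarrow> z 1 = \<zero>\<^bsub>R\<^esub>" for y
    using z[of "Suc 0"] by (simp add: numeral_eq_Suc z01)
  have p': "(\<lambda>v. ?e y (mix (\<lambda>j. if j = i then 0 else Suc (Suc (Suc (2 * j)))) (Suc (Suc 0)) (\<lambda>j. Suc (Suc (Suc (Suc (2 * Suc (Suc j)))))) v)) = mix (f(i := y)) l (\<lambda>j. z (Suc (Suc j)))" for y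
  proof
    fix v
    show "?e y (mix (\<lambda>j. if j = i then 0 else Suc (Suc (Suc (2 * j)))) (Suc (Suc 0)) (\<lambda>j. Suc (Suc (Suc (Suc (2 * Suc (Suc j)))))) v) = mix (f(i := y)) l (\<lambda>j. z (Suc (Suc j))) v"
    proof (cases v rule: mix_cases)
      case (3 j)
      then show ?thesis using mix_simps(3)[of f l z "Suc (Suc j)"] by simp
    qed simp_all
  qed
  show ?thesis
    unfolding fTau_def tau_def sat_ExB sat.simps(4) sat_connectives(1) sat_ren p' zero
    by (intro bex_cong refl) (simp only: near rvd[unfolded sat_ExB sat.simps(4)])
qed

lemma sat_fBF:
  assumes f: "\<And>j. f j \<in> univ M" and l: "l \<in> univ M" and z: "\<And>j. z j \<in> univ M"
  shows "sat M (mix f l z) (fBF L p i \<theta> m) \<longleftrightarrow> (\<exists>c\<in>prep_points M \<theta> f. \<forall>b<m.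
    z (prod_encode (b, 0)) = \<zero>\<^bsub>R\<^esub> \<longleftrightarrow> tau p i \<theta> f c l (\<lambda>j. z (prod_encode (b, Suc j))))"
proof -
  have 1: "(\<lambda>v. case_nat c (mix f l z) (case_nat 0 (\<lambda>j. 2 * j + 2) v)) = case_nat c f" for c
    by (auto split: nat.split)
  have 2: "(\<lambda>v. case_nat c (mix f l z) (case_nat 0 (\<lambda>v. Suc (mix (\<lambda>j. 2 * j + 1) 0 (\<lambda>j. 2 * prod_encode (b, Suc j) + 2) v)) v))
      = case_nat c (mix f l (\<lambda>j. z (prod_encode (b, Suc j))))" for c b
  proof
    fix v
    show "case_nat c (mix f l z) (case_nat 0 (\<lambda>v. Suc (mix (\<lambda>j. 2 * j + 1) 0 (\<lambda>j. 2 * prod_encode (b, Suc j) + 2) v)) v)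
        = case_nat c (mix f l (\<lambda>j. z (prod_encode (b, Suc j)))) v"
    proof (cases v)
      case (Suc w)
      then show ?thesis by (cases w rule: mix_cases) simp_all
    qed simp
  qed
  have "sat M (case_nat c (mix f l z)) (fBlock L p i \<theta> b) \<longleftrightarrow>
      (z (prod_encode (b, 0)) = \<zero>\<^bsub>R\<^esub> \<longleftrightarrow> tau p i \<theta> f c l (\<lambda>j. z (prod_encode (b, Suc j))))" if "c \<in> univ M" for c b
    unfolding fBlock_def sat_connectives sat_ren 2 sat_fTau[OF f l z that]
    using z[of "prod_encode (b, 0)"] by (simp add: numeral_3_eq_3)
  then show ?thesis
    unfolding fBF_def sat_ExB sat.simps sat_Conjs sat_ren 1 by auto
qed

lemma rv_equiv_sym:
  assumes "rv_equiv R V l z l' z'" "l \<in> univ M" "\<And>j. z j \<in> univ M" "\<And>j. z' j \<in> univ M"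
  shows "rv_equiv R V l' z' l z"
  using assms rveq_radius_cong[of l l' "z' _" "z _"] rveq_sym[of l "z _" "z' _"] unfolding rv_equiv_def by auto

lemma rveq_zero: "radius R V l \<Longrightarrow> x \<in> univ M \<Longrightarrow> x' \<in> univ M \<Longrightarrow> rveq R V l x x' \<Longrightarrow> x = \<zero>\<^bsub>R\<^esub> \<longleftrightarrow> x' = \<zero>\<^bsub>R\<^esub>"
  using rveq_le[of l x x'] by auto

text \<open>The witness y stays the same, since the points and the condition of being nearest
  involve neither radius nor leading terms.\<close>

lemma tau_invariant:
  assumes inv: "rv_invariant L M p" and f: "\<And>j. f j \<in> univ M" and l: "l \<in> univ M" "l' \<in> univ M"
    and z: "\<And>j. z j \<in> univ M" "\<And>j. z' j \<in> univ M" and c: "c \<in> univ M" and eq: "rv_equiv R V l z l' z'"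
    and tau: "tau p i \<theta> f c l z"
  shows "tau p i \<theta> f c l' z'"
proof -
  have rad: "radius R V l" "radius R V l'" "vle R V l l'" and rv: "rveq R V l (z j) (z' j)" for j
    using eq by (auto simp: rv_equiv_def)
  obtain y where y: "y \<in> univ M" "\<forall>c'\<in>prep_points M \<theta> f. vle R V (y \<ominus>\<^bsub>R\<^esub> c) (y \<ominus>\<^bsub>R\<^esub> c')"
    "rveq R V l (y \<ominus>\<^bsub>R\<^esub> c) (z 0)" "z 1 = \<zero>\<^bsub>R\<^esub> \<or> sat M (mix (f(i := y)) l (\<lambda>j. z (Suc (Suc j)))) p"
    using tau unfolding tau_def by blast
  have "rveq R V l (y \<ominus>\<^bsub>R\<^esub> c) (z' 0)"
    using rveq_trans[of l "y \<ominus>\<^bsub>R\<^esub> c" "z 0" "z' 0"] rad rv[of 0] y z[of 0] c by simp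
  then have "rveq R V l' (y \<ominus>\<^bsub>R\<^esub> c) (z' 0)"
    using rveq_radius_cong[of l l' "y \<ominus>\<^bsub>R\<^esub> c" "z' 0"] rad y z[of 0] c by simp
  moreover have "z' 1 = \<zero>\<^bsub>R\<^esub> \<or> sat M (mix (f(i := y)) l' (\<lambda>j. z' (Suc (Suc j)))) p"
  proof (cases "z 1 = \<zero>\<^bsub>R\<^esub>")
    case True
    then show ?thesis using rveq_zero[OF rad(1) z(1) z(2) rv, of 1] by simp
  next
    case False
    have "rv_equiv R V l (\<lambda>j. z (Suc (Suc j))) l' (\<lambda>j. z' (Suc (Suc j)))"
      using eq by (simp add: rv_equiv_def)
    moreover have "sat M (mix (f(i := y)) l (\<lambda>j. z (Suc (Suc j)))) p" using y(4) False by simp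
    ultimately have "sat M (mix (f(i := y)) l' (\<lambda>j. z' (Suc (Suc j)))) p"
      using inv[unfolded rv_invariant_def, rule_format, of "f(i := y)" l l' "\<lambda>j. z (Suc (Suc j))" "\<lambda>j. z' (Suc (Suc j))"]
        f l z y(1) by simp
    then show ?thesis ..
  qed
  ultimately show ?thesis using y(1,2) unfolding tau_def by blast
qed

lemma rv_invariant_fBF:
  assumes "rv_invariant L M p"
  shows "rv_invariant L M (fBF L p i \<theta> m)"
  unfolding rv_invariant_def
proof (intro allI impI)
  fix f l z l' z'
  assume f: "\<forall>j. f j \<in> univ M" and l: "l \<in> univ M" "l' \<in> univ M" and z: "\<forall>j. z j \<in> univ M" "\<forall>j. z' j \<in> univ M"
    and eq: "rv_equiv R V l z l' z'" and sat: "sat M (mix f l z) (fBF L p i \<theta> m)"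
  have eq': "rv_equiv R V l' z' l z" by (rule rv_equiv_sym) (use eq l z in auto)
  have "tau p i \<theta> f c l (\<lambda>j. z (prod_encode (b, Suc j))) \<longleftrightarrow> tau p i \<theta> f c l' (\<lambda>j. z' (prod_encode (b, Suc j)))"
    if "c \<in> univ M" for c b
  proof
    assume "tau p i \<theta> f c l (\<lambda>j. z (prod_encode (b, Suc j)))"
    then show "tau p i \<theta> f c l' (\<lambda>j. z' (prod_encode (b, Suc j)))"
      by (rule tau_invariant[rotated -1]) (use assms f l z that eq in \<open>simp_all add: rv_equiv_def\<close>)
  next
    assume "tau p i \<theta> f c l' (\<lambda>j. z' (prod_encode (b, Suc j)))"
    then show "tau p i \<theta> f c l (\<lambda>j. z (prod_encode (b, Suc j)))"
      by (rule tau_invariant[rotated -1]) (use assms f l z that eq' in \<open>simp_all add: rv_equiv_def\<close>)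
  qed
  moreover have "z k = \<zero>\<^bsub>R\<^esub> \<longleftrightarrow> z' k = \<zero>\<^bsub>R\<^esub>" for k
    using rveq_zero[of l "z k" "z' k"] eq z by (simp add: rv_equiv_def)
  ultimately show "sat M (mix f l' z') (fBF L p i \<theta> m)"
    using sat f l z by (simp add: sat_fBF)
qed

text \<open>Let c be a preparing point for f nearest to y. Some preparing point c' for f' has the
  same set of tuples \<open>tau\<close> as c, because otherwise m blocks tell c from all points for
  f'. Then y' is found at c' with the leading term of y - c, and nearest point and leading term
  decide p on both sides.\<close>

lemma feq_fBF:
  assumes p: "rv_invariant L M p"
    and points: "\<And>f. (\<And>j. f j \<in> univ M) \<Longrightarrow> finite (prep_points M \<theta> f) \<and> card (prep_points M \<theta> f) \<le> m \<and> prep_points M \<theta> f \<noteq> {}"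
    and prep: "\<And>f z. (\<And>j. f j \<in> univ M) \<Longrightarrow> (\<And>j. z j \<in> univ M) \<Longrightarrow> rv_prepares L M p i (prep_points M \<theta> f) f l z"
    and f: "\<And>j. f j \<in> univ M" "\<And>j. f' j \<in> univ M" and l: "l \<in> univ M" "radius R V l"
    and feq: "feq M (fBF L p i \<theta> m) l f f'" and y: "y \<in> univ M"
  obtains y' where "y' \<in> univ M" "feq M p l (f(i := y)) (f'(i := y'))"
proof -
  define C C' where "C = prep_points M \<theta> f" and "C' = prep_points M \<theta> f'"
  have C: "finite C" "C \<noteq> {}" "C \<subseteq> univ M" and C': "finite C'" "card C' \<le> m" "C' \<noteq> {}" "C' \<subseteq> univ M"
    using points f by (auto simp: C_def C'_def)
  obtain c where c: "c \<in> C" "\<forall>c'\<in>C. vle R V (y \<ominus>\<^bsub>R\<^esub> c) (y \<ominus>\<^bsub>R\<^esub> c')"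
    using nearest_exists[OF C(1,2), of y] C(3) y by (simp only: fld_simps) blast
  have zero: "\<zero>\<^bsub>R\<^esub> \<in> univ M" and one: "\<one>\<^bsub>R\<^esub> \<in> univ M" using zero_closed one_closed by simp_all
  obtain c' where c': "c' \<in> C'"
    and same: "\<And>w. (\<And>j. w j \<in> univ M) \<Longrightarrow> tau p i \<theta> f c l w \<longleftrightarrow> tau p i \<theta> f' c' l w"
  \<comment> \<open>Otherwise each c' has a tuple \<open>W c'\<close> lying in the set of exactly
    one of c and c'. There are at most m such tuples, one for each block.\<close>
  proof (rule ccontr)
    assume "\<not> thesis"
    then have "\<forall>c'\<in>C'. \<exists>w. (\<forall>j. w j \<in> univ M) \<and> (tau p i \<theta> f c l w \<longleftrightarrow> \<not> tau p i \<theta> f' c' l w)"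
      using that by blast
    then obtain W where W: "\<And>c' j. c' \<in> C' \<Longrightarrow> W c' j \<in> univ M"
      "\<And>c'. c' \<in> C' \<Longrightarrow> tau p i \<theta> f c l (W c') \<longleftrightarrow> \<not> tau p i \<theta> f' c' l (W c')"
      by metis
    obtain cs where cs: "set cs = C'" "length cs = card C'"
      using C'(1) by (metis finite_distinct_list distinct_card)
    \<comment> \<open>The blocks run through C'. There are m of them however small C' is, so the
      remaining ones repeat its first point.\<close>
    define d where "d b = (if b < length cs then cs ! b else hd cs)" for b
    have d: "d b \<in> C'" for b
      unfolding d_def cs(1)[symmetric] using C'(3) cs(1) by (cases "cs = []") auto
    \<comment> \<open>Block b carries the separating tuple of its point, flagged by the answer for
      c, so that c witnesses the formula at f.\<close>
    define z where "z k = (case prod_decode k of (b, 0) \<Rightarrow> if tau p i \<theta> f c l (W (d b)) then \<zero>\<^bsub>R\<^esub> else \<one>\<^bsub>R\<^esub>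
      | (b, Suc j) \<Rightarrow> W (d b) j)" for k
    have z: "z (prod_encode (b, 0)) = \<zero>\<^bsub>R\<^esub> \<longleftrightarrow> tau p i \<theta> f c l (W (d b))" "(\<lambda>j. z (prod_encode (b, Suc j))) = W (d b)" for b
      using one_not_zero by (auto simp: z_def)
    have z_in: "z k \<in> univ M" for k
      using W(1)[OF d] zero one by (auto simp: z_def split: prod.split nat.split)
    have "sat M (mix f l z) (fBF L p i \<theta> m)"
      unfolding sat_fBF[OF f(1) l(1) z_in] z using c(1) by (auto simp: C_def)
    then have "sat M (mix f' l z) (fBF L p i \<theta> m)"
      using feq z_in unfolding feq_def by blast
    then obtain c' where c': "c' \<in> C'" "\<forall>b<m. tau p i \<theta> f c l (W (d b)) \<longleftrightarrow> tau p i \<theta> f' c' l (W (d b))"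
      unfolding sat_fBF[OF f(2) l(1) z_in] z by (auto simp: C'_def)
    then obtain b where "b < length cs" "c' = cs ! b" using cs by (metis in_set_conv_nth)
    then have "b < m" "d b = c'" using cs C'(2) by (auto simp: d_def)
    with c' W(2)[of c'] show False by metis
  qed
  define \<eta> where "\<eta> = y \<ominus>\<^bsub>R\<^esub> c"
  have cU: "c \<in> univ M" "c' \<in> univ M" using c(1) c' C C' by auto
  then have \<eta>: "\<eta> \<in> univ M" using y by (simp add: \<eta>_def)
  \<comment> \<open>A tuple for \<open>tau\<close>: the leading term of y - c, a switch for p, then
    the leading terms that p speaks about. With switch 0 only the existence of a suitable element is
    asked.\<close>
  define w where "w a z = case_nat \<eta> (case_nat a z)" for a and z :: "nat \<Rightarrow> 'u"
  have w_in: "w a z j \<in> univ M" if "a \<in> univ M" "\<And>j. z j \<in> univ M" for a z j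
    using that \<eta> by (auto simp: w_def split: nat.split)
  have tau_w: "tau p i \<theta> g b l (w a z) \<longleftrightarrow> (\<exists>x\<in>univ M. (\<forall>c'\<in>prep_points M \<theta> g. vle R V (x \<ominus>\<^bsub>R\<^esub> b) (x \<ominus>\<^bsub>R\<^esub> c')) \<and>
     rveq R V l (x \<ominus>\<^bsub>R\<^esub> b) \<eta> \<and> (a = \<zero>\<^bsub>R\<^esub> \<or> sat M (mix (g(i := x)) l z) p))" for g b a z
    by (simp add: tau_def w_def)
  \<comment> \<open>The witness of \<open>tau\<close> may differ from x, but it has the same leading
    term relative to the point nearest to x, hence relative to all preparing points; by preparation
    p has the same truth value at both.\<close>
  have tau_p: "tau p i \<theta> g b l (w \<one>\<^bsub>R\<^esub> z) \<longleftrightarrow> sat M (mix (g(i := x)) l z) p"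
    if x: "x \<in> univ M" "\<forall>c'\<in>prep_points M \<theta> g. vle R V (x \<ominus>\<^bsub>R\<^esub> b) (x \<ominus>\<^bsub>R\<^esub> c')" "rveq R V l (x \<ominus>\<^bsub>R\<^esub> b) \<eta>"
      and b: "b \<in> univ M" and z: "\<And>j. z j \<in> univ M" and g: "\<And>j. g j \<in> univ M" for g b x z
  proof
    assume "tau p i \<theta> g b l (w \<one>\<^bsub>R\<^esub> z)"
    then obtain x' where x': "x' \<in> univ M" "rveq R V l (x' \<ominus>\<^bsub>R\<^esub> b) \<eta>" "sat M (mix (g(i := x')) l z) p"
      unfolding tau_w using one_not_zero by blast
    have "rveq R V l (x \<ominus>\<^bsub>R\<^esub> b) (x' \<ominus>\<^bsub>R\<^esub> b)"
      using rveq_trans[of l "x \<ominus>\<^bsub>R\<^esub> b" \<eta> "x' \<ominus>\<^bsub>R\<^esub> b"] rveq_sym[of l "x' \<ominus>\<^bsub>R\<^esub> b" \<eta>] x x' b \<eta> l by simp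
    then have "rveq R V l (x \<ominus>\<^bsub>R\<^esub> c') (x' \<ominus>\<^bsub>R\<^esub> c')" if "c' \<in> prep_points M \<theta> g" for c'
      using rveq_nearest[of l x x' b c'] x x' b l that by simp
    moreover have "rv_prepares L M p i (prep_points M \<theta> g) g l z" using prep[of g z] g z by blast
    ultimately show "sat M (mix (g(i := x)) l z) p"
      using x(1) x' unfolding rv_prepares_def by blast
  next
    assume "sat M (mix (g(i := x)) l z) p"
    with x show "tau p i \<theta> g b l (w \<one>\<^bsub>R\<^esub> z)" unfolding tau_w by blast
  qed
  \<comment> \<open>With the switch at 0, y itself is a witness at c; equality of the sets then
    yields y' at c'.\<close>
  have "tau p i \<theta> f c l (w \<zero>\<^bsub>R\<^esub> (\<lambda>_. \<zero>\<^bsub>R\<^esub>))"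
    unfolding tau_w using y c(2) by (auto simp: \<eta>_def C_def)
  then have "tau p i \<theta> f' c' l (w \<zero>\<^bsub>R\<^esub> (\<lambda>_. \<zero>\<^bsub>R\<^esub>))"
    by (rule same[THEN iffD1, rotated]) (rule w_in; rule zero)
  then obtain y' where y': "y' \<in> univ M" "\<forall>c''\<in>prep_points M \<theta> f'. vle R V (y' \<ominus>\<^bsub>R\<^esub> c') (y' \<ominus>\<^bsub>R\<^esub> c'')"
    "rveq R V l (y' \<ominus>\<^bsub>R\<^esub> c') \<eta>"
    unfolding tau_w by blast
  show thesis
  proof (rule that[OF y'(1)], unfold feq_def, intro allI impI)
    fix z :: "nat \<Rightarrow> 'u" assume z: "\<forall>j. z j \<in> univ M"
    have "sat M (mix (f(i := y)) l z) p \<longleftrightarrow> tau p i \<theta> f c l (w \<one>\<^bsub>R\<^esub> z)"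
      by (rule tau_p[symmetric]) (use y c cU z f \<eta>_def C_def in auto)
    also have "\<dots> \<longleftrightarrow> tau p i \<theta> f' c' l (w \<one>\<^bsub>R\<^esub> z)"
      by (rule same) (use w_in one z in blast)
    also have "\<dots> \<longleftrightarrow> sat M (mix (f'(i := y')) l z) p"
      by (rule tau_p) (use y' cU z f in auto)
    finally show "sat M (mix (f(i := y)) l z) p = sat M (mix (f'(i := y')) l z) p" .
  qed
qed

end

section \<open>Relations forced by leading terms\<close>

lemma sat_mix_odd [simp]: "sat M (mix f l z) (ren (\<lambda>j. Suc (2 * j)) p) = sat M f p"
  by simp

lemma (in valued_struct) tval_in:
  assumes "wf_trm L t" "\<And>j. f j \<in> univ M"
  shows "tval M f t \<in> univ M"
  using assms(1)
proof (induction t)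
  case (Fn s ts)
  then have "set (map (tval M f) ts) \<subseteq> univ M" by auto
  then show ?case using Fn.prems wf by (simp add: wf_struct_def tuples_def)
qed (use assms in simp)

text \<open>A one-element set of leading terms: if f and f' give the same set, then t has the same
  leading term at both.\<close>

definition fName :: "('f, 'r) vlang \<Rightarrow> 'f trm \<Rightarrow> ('f, 'r) fm" where
  "fName L t = ExB (Conj (Eql (Var 0) (ren_trm (\<lambda>j. Suc (Suc (2 * j))) t)) (fRv L 1 0 3))"

text \<open>The disjoint union of two families: the first leading term, zero or not, selects one of
  them, so a single family carries the information of both.\<close>

definition fFlag :: "('f, 'r) vlang \<Rightarrow> ('f, 'r) fm \<Rightarrow> ('f, 'r) fm \<Rightarrow> ('f, 'r) fm" where
  "fFlag L p q = Conj (Imp (fZero L 2) (ren (mix (\<lambda>j. Suc (2 * j)) 0 (\<lambda>j. Suc (Suc (2 * Suc j)))) p))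
     (Imp (Neg (fZero L 2)) (ren (mix (\<lambda>j. Suc (2 * j)) 0 (\<lambda>j. Suc (Suc (2 * Suc j)))) q))"

context valued_struct
begin

lemma sat_fName:
  assumes "wf_trm L t" "\<And>j. f j \<in> univ M" "l \<in> univ M" "\<And>j. z j \<in> univ M"
  shows "sat M (mix f l z) (fName L t) \<longleftrightarrow> rveq R V l (tval M f t) (z 0)"
proof -
  have t: "tval M (case_nat y (mix f l z)) (ren_trm (\<lambda>j. Suc (Suc (2 * j))) t) = tval M f t" for y
    by simp
  have z: "mix f l z (Suc (Suc 0)) = z 0" using mix_simps(3)[of f l z 0] by simp
  show ?thesis
    unfolding fName_def sat_ExB sat.simps t using tval_in[OF assms(1,2)] assms(3) assms(4)[of 0]
    by (auto simp: numeral_3_eq_3 z)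
qed

lemma rv_invariant_fName: "wf_trm L t \<Longrightarrow> rv_invariant L M (fName L t)"
  unfolding rv_invariant_def
proof (intro allI impI)
  fix f l z l' z'
  assume t: "wf_trm L t" and f: "\<forall>j. f j \<in> univ M" and l: "l \<in> univ M" "l' \<in> univ M"
    and z: "\<forall>j. z j \<in> univ M" "\<forall>j. z' j \<in> univ M"
    and eq: "rv_equiv R V l z l' z'" and sat: "sat M (mix f l z) (fName L t)"
  have x: "tval M f t \<in> univ M" using tval_in t f by blast
  have "rveq R V l (tval M f t) (z 0)" using sat t f l z by (simp add: sat_fName)
  then have "rveq R V l (tval M f t) (z' 0)"
    using eq x z rveq_trans[of l "tval M f t" "z 0" "z' 0"] by (auto simp: rv_equiv_def)
  then have "rveq R V l' (tval M f t) (z' 0)"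
    using eq x z rveq_radius_cong[of l l' "tval M f t" "z' 0"] by (auto simp: rv_equiv_def)
  then show "sat M (mix f l' z') (fName L t)" using t f l z by (simp add: sat_fName)
qed

lemma sat_fFlag:
  assumes "\<And>j. z j \<in> univ M"
  shows "sat M (mix f l z) (fFlag L p q) \<longleftrightarrow>
    (if z 0 = \<zero>\<^bsub>R\<^esub> then sat M (mix f l (\<lambda>j. z (Suc j))) p else sat M (mix f l (\<lambda>j. z (Suc j))) q)"
proof -
  have z: "mix f l z (Suc (Suc 0)) = z 0" using mix_simps(3)[of f l z 0] by simp
  have "(\<lambda>v. mix f l z (mix (\<lambda>j. Suc (2 * j)) 0 (\<lambda>j. Suc (Suc (2 * Suc j))) v)) = mix f l (\<lambda>j. z (Suc j))"
  proof
    fix v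
    show "mix f l z (mix (\<lambda>j. Suc (2 * j)) 0 (\<lambda>j. Suc (Suc (2 * Suc j))) v) = mix f l (\<lambda>j. z (Suc j)) v"
    proof (cases v rule: mix_cases)
      case (3 j)
      then show ?thesis using mix_simps(3)[of f l z "Suc j"] by simp
    qed simp_all
  qed
  then show ?thesis using assms[of 0] by (simp add: fFlag_def numeral_2_eq_2 z)
qed

lemma rv_invariant_fFlag:
  assumes "rv_invariant L M p" "rv_invariant L M q"
  shows "rv_invariant L M (fFlag L p q)"
  unfolding rv_invariant_def
proof (intro allI impI)
  fix f l z l' z'
  assume f: "\<forall>j. f j \<in> univ M" and l: "l \<in> univ M" "l' \<in> univ M" and z: "\<forall>j. z j \<in> univ M" "\<forall>j. z' j \<in> univ M"
    and eq: "rv_equiv R V l z l' z'" and sat: "sat M (mix f l z) (fFlag L p q)"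
  have eq': "rv_equiv R V l (\<lambda>j. z (Suc j)) l' (\<lambda>j. z' (Suc j))" using eq by (simp add: rv_equiv_def)
  have "z 0 = \<zero>\<^bsub>R\<^esub> \<longleftrightarrow> z' 0 = \<zero>\<^bsub>R\<^esub>"
    using rveq_zero[of l "z 0" "z' 0"] eq z by (simp add: rv_equiv_def)
  moreover have "sat M (mix f l (\<lambda>j. z (Suc j))) r \<Longrightarrow> sat M (mix f l' (\<lambda>j. z' (Suc j))) r" if "rv_invariant L M r" for r
    using that[unfolded rv_invariant_def, rule_format, of f l l' "\<lambda>j. z (Suc j)" "\<lambda>j. z' (Suc j)"] eq' f l z by simp
  ultimately show "sat M (mix f l' z') (fFlag L p q)"
    using sat z assms by (simp add: sat_fFlag split: if_splits)
qed

lemma rv_invariant_field_formula: "rv_invariant L M (ren (\<lambda>j. Suc (2 * j)) p)"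
  unfolding rv_invariant_def sat_mix_odd by blast

end

text \<open>M will be the L-reduct of an arbitrary model of the expanded theory, in its own type
  \<open>'v\<close>, and T the theory of the given K. h-minimality is known for models in
  \<open>'u\<close> only; compactness, which needs \<open>g\<close>, connects the two types.\<close>

locale prep_setting = valued_struct L M for L :: "('f, 'r) vlang" and M :: "('f, 'r, 'v) struct" +
  fixes g :: "('f + 'r) + nat \<Rightarrow> 'u" and T :: "('f, 'r) fm set"
  assumes inj_g: "inj g" and h: "h_minimal TYPE('u) \<infinity> L T" and T: "T \<subseteq> Th L M"
begin

lemma model_valued_struct:
  fixes N :: "('f, 'r, 'u) struct"
  assumes "models L N T"
  shows "valued_struct L N"
proof -
  have "equichar_0 (fld L N) (vring L N)"
    using h assms unfolding h_minimal_def Let_def by blast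
  then show ?thesis
    using wf_lang assms unfolding valued_struct_def equichar_0_def valued_field_def models_def by blast
qed

text \<open>A formula describes a set of tuples of leading terms that depends on the field variables. The
  invariance is also required in the models in which the theory is known to be h-minimal.\<close>

definition family :: "('f, 'r) fm \<Rightarrow> bool" where
  "family p \<longleftrightarrow> wf_fm L p \<and> rv_invariant L M p \<and> (\<forall>N :: ('f, 'r, 'u) struct. models L N T \<longrightarrow> rv_invariant L N p)"

text \<open>The family is chosen before the radius, so that one p works for every l.\<close>

definition forced :: "('v \<Rightarrow> (nat \<Rightarrow> 'v) \<Rightarrow> (nat \<Rightarrow> 'v) \<Rightarrow> bool) \<Rightarrow> bool" where
  "forced Q \<longleftrightarrow> (\<exists>p. family p \<and> (\<forall>l f f'. l \<in> univ M \<longrightarrow> radius R V l \<longrightarrow> (\<forall>j. f j \<in> univ M) \<longrightarrow> (\<forall>j. f' j \<in> univ M) \<longrightarrow>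
     feq M p l f f' \<longrightarrow> Q l f f'))"

lemma forcedI:
  assumes "family p" "\<And>l f f'. l \<in> univ M \<Longrightarrow> radius R V l \<Longrightarrow> (\<And>j. f j \<in> univ M) \<Longrightarrow> (\<And>j. f' j \<in> univ M) \<Longrightarrow>
    feq M p l f f' \<Longrightarrow> Q l f f'"
  shows "forced Q"
  unfolding forced_def using assms by (intro exI[of _ p]) simp

lemma forcedE:
  assumes "forced Q"
  obtains p where "family p" "\<And>l f f'. l \<in> univ M \<Longrightarrow> radius R V l \<Longrightarrow> (\<And>j. f j \<in> univ M) \<Longrightarrow> (\<And>j. f' j \<in> univ M) \<Longrightarrow>
    feq M p l f f' \<Longrightarrow> Q l f f'"
  using assms unfolding forced_def by metis

lemma forced_mono:
  assumes "forced Q" "\<And>l f f'. l \<in> univ M \<Longrightarrow> radius R V l \<Longrightarrow> (\<And>j. f j \<in> univ M) \<Longrightarrow> (\<And>j. f' j \<in> univ M) \<Longrightarrow>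
    Q l f f' \<Longrightarrow> Q' l f f'"
  shows "forced Q'"
proof -
  obtain p where "family p" "\<And>l f f'. l \<in> univ M \<Longrightarrow> radius R V l \<Longrightarrow> (\<And>j. f j \<in> univ M) \<Longrightarrow> (\<And>j. f' j \<in> univ M) \<Longrightarrow>
    feq M p l f f' \<Longrightarrow> Q l f f'"
    using forcedE[OF assms(1)] by blast
  note p = this
  show ?thesis
  proof (rule forcedI[OF p(1)])
    fix l f f' assume *: "l \<in> univ M" "radius R V l" "\<And>j. f j \<in> univ M" "\<And>j. f' j \<in> univ M" "feq M p l f f'"
    have "Q l f f'" by (rule p(2)) (fact *)+
    then show "Q' l f f'" using * by (intro assms(2))
  qed
qed

lemma forced_sym: "forced Q \<Longrightarrow> forced (\<lambda>l f f'. Q l f' f)"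
  by (elim forcedE, rule forcedI) (auto simp: feq_def)

text \<open>Without leading-term variables the set of tuples is everything or empty, so equal sets
  mean equal truth values.\<close>

lemma forced_field_formula:
  assumes "wf_fm L p"
  shows "forced (\<lambda>l f f'. sat M f p \<longrightarrow> sat M f' p)"
proof (rule forcedI)
  show "family (ren (\<lambda>j. Suc (2 * j)) p)"
    using assms rv_invariant_field_formula valued_struct.rv_invariant_field_formula[OF model_valued_struct]
    by (simp add: family_def)
  show "sat M f p \<longrightarrow> sat M f' p" if "feq M (ren (\<lambda>j. Suc (2 * j)) p) l f f'" "\<And>j. f j \<in> univ M" for l f f'
    using that unfolding feq_def sat_mix_odd by blast
qed

lemma forced_True: "forced (\<lambda>_ _ _. True)"
  by (rule forced_mono[OF forced_field_formula[of Tru]]) (simp_all add: Tru_def)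

lemma forced_rveq:
  assumes t: "wf_trm L t"
  shows "forced (\<lambda>l f f'. rveq R V l (tval M f t) (tval M f' t))"
proof (rule forcedI)
  show "family (fName L t)"
    using t wf_lang rv_invariant_fName[OF t] valued_struct.rv_invariant_fName[OF model_valued_struct t]
    by (simp add: family_def fName_def)
  fix l f f' assume *: "l \<in> univ M" "radius R V l" "\<And>j. f j \<in> univ M" "\<And>j. f' j \<in> univ M" "feq M (fName L t) l f f'"
  have x: "tval M f t \<in> univ M" "tval M f' t \<in> univ M" using tval_in[OF t] * by auto
  have "sat M (mix f l (\<lambda>_. tval M f t)) (fName L t)"
    by (subst sat_fName) (use t * x in simp_all)
  then have "sat M (mix f' l (\<lambda>_. tval M f t)) (fName L t)"
    using *(5) x by (simp add: feq_def)
  then have "rveq R V l (tval M f' t) (tval M f t)"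
    by (subst (asm) sat_fName) (use t * x in simp_all)
  then show "rveq R V l (tval M f t) (tval M f' t)"
    using rveq_sym * x by simp
qed

lemma forced_conj:
  assumes "forced Q" "forced Q'"
  shows "forced (\<lambda>l f f'. Q l f f' \<and> Q' l f f')"
proof -
  obtain p where p: "family p" "\<And>l f f'. l \<in> univ M \<Longrightarrow> radius R V l \<Longrightarrow> (\<And>j. f j \<in> univ M) \<Longrightarrow> (\<And>j. f' j \<in> univ M) \<Longrightarrow>
    feq M p l f f' \<Longrightarrow> Q l f f'"
    using forcedE[OF assms(1)] by blast
  obtain q where q: "family q" "\<And>l f f'. l \<in> univ M \<Longrightarrow> radius R V l \<Longrightarrow> (\<And>j. f j \<in> univ M) \<Longrightarrow> (\<And>j. f' j \<in> univ M) \<Longrightarrow>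
    feq M q l f f' \<Longrightarrow> Q' l f f'"
    using forcedE[OF assms(2)] by blast
  show ?thesis
  proof (rule forcedI)
    show "family (fFlag L p q)"
      using p(1) q(1) wf_lang rv_invariant_fFlag[of p q]
        valued_struct.rv_invariant_fFlag[OF model_valued_struct, of _ p q]
      by (simp add: family_def) (simp add: fFlag_def)
    fix l f f' assume *: "l \<in> univ M" "radius R V l" "\<And>j. f j \<in> univ M" "\<And>j. f' j \<in> univ M" "feq M (fFlag L p q) l f f'"
    have zero: "\<zero>\<^bsub>R\<^esub> \<in> univ M" and one: "\<one>\<^bsub>R\<^esub> \<in> univ M" using zero_closed one_closed by simp_all
    have sub: "(if a = \<zero>\<^bsub>R\<^esub> then sat M (mix f l z) p else sat M (mix f l z) q) =
      (if a = \<zero>\<^bsub>R\<^esub> then sat M (mix f' l z) p else sat M (mix f' l z) q)"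
      if "a \<in> univ M" "\<forall>j. z j \<in> univ M" for a z
    proof -
      have "\<forall>j. case_nat a z j \<in> univ M" using that by (auto split: nat.split)
      then show ?thesis
        using *(5)[unfolded feq_def, rule_format, of "case_nat a z"] by (simp add: sat_fFlag cong: if_cong)
    qed
    have "feq M p l f f'" "feq M q l f f'"
      unfolding feq_def using sub[OF zero] sub[OF one] one_not_zero by simp_all
    then show "Q l f f' \<and> Q' l f f'" using p(2) q(2) * by blast
  qed
qed

lemma forced_ball:
  assumes "finite S" "\<And>s. s \<in> S \<Longrightarrow> forced (Q s)"
  shows "forced (\<lambda>l f f'. \<forall>s\<in>S. Q s l f f')"
  using assms
proof (induction S rule: finite_induct)
  case empty
  show ?case using forced_True by simp
next
  case (insert s S)
  then have "forced (\<lambda>l f f'. Q s l f f' \<and> (\<forall>s\<in>S. Q s l f f'))" by (intro forced_conj) auto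
  then show ?case by simp
qed

text \<open>Uniform preparation in coordinate i turns a family for the environments after the choice
  of y into the family \<open>fBF\<close> for those before it.\<close>

lemma forced_ex:
  assumes "forced Q"
  shows "forced (\<lambda>l f f'. \<forall>y\<in>univ M. \<exists>y'\<in>univ M. Q l (f(i := y)) (f'(i := y')))"
proof -
  obtain p where p: "family p" "\<And>l f f'. l \<in> univ M \<Longrightarrow> radius R V l \<Longrightarrow> (\<And>j. f j \<in> univ M) \<Longrightarrow> (\<And>j. f' j \<in> univ M) \<Longrightarrow>
    feq M p l f f' \<Longrightarrow> Q l f f'"
    using forcedE[OF assms] by blast
  have wf_p: "wf_fm L p" and inv: "rv_invariant L M p"
    and inv_N: "\<And>N :: ('f, 'r, 'u) struct. models L N T \<Longrightarrow> rv_invariant L N p"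
    using p(1) by (auto simp: family_def)
  obtain \<theta> m where \<theta>: "wf_fm L \<theta>"
    "\<And>f. (\<And>j. f j \<in> univ M) \<Longrightarrow> finite (prep_points M \<theta> f) \<and> card (prep_points M \<theta> f) \<le> m \<and> prep_points M \<theta> f \<noteq> {}"
    "\<And>f l z. (\<And>j. f j \<in> univ M) \<Longrightarrow> l \<in> univ M \<Longrightarrow> radius (fld L M) (vring L M) l \<Longrightarrow> (\<And>j. z j \<in> univ M) \<Longrightarrow>
      rv_prepares L M p i (prep_points M \<theta> f) f l z"
    using uniform_preparation[OF valued_struct_axioms inj_g h T wf_p inv_N, of i] by blast
  show ?thesis
  proof (rule forcedI)
    show "family (fBF L p i \<theta> m)"
      unfolding family_def
      using wf_fBF[OF wf_lang wf_p \<theta>(1)] rv_invariant_fBF[OF inv]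
        valued_struct.rv_invariant_fBF[OF model_valued_struct inv_N] by blast
    fix l f f' assume *: "l \<in> univ M" "radius R V l" "\<And>j. f j \<in> univ M" "\<And>j. f' j \<in> univ M" "feq M (fBF L p i \<theta> m) l f f'"
    show "\<forall>y\<in>univ M. \<exists>y'\<in>univ M. Q l (f(i := y)) (f'(i := y'))"
    proof
      fix y assume y: "y \<in> univ M"
      obtain y' where "y' \<in> univ M" "feq M p l (f(i := y)) (f'(i := y'))"
        by (rule feq_fBF[OF inv \<theta>(2) \<theta>(3) *(3,4) *(1,2,5) y]) (use *(1,2) in blast)+
      then show "\<exists>y'\<in>univ M. Q l (f(i := y)) (f'(i := y'))"
        using p(2)[of l "f(i := y)" "f'(i := y')"] * y by (intro bexI[of _ y']) auto
    qed
  qed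
qed

end

section \<open>The expansion by the coarse valuation ring\<close>

lemma coarse_lang_simps [simp]:
  "farity (coarse_lang L) = farity L" "rarity (coarse_lang L) (Some r) = rarity L r"
  "rarity (coarse_lang L) None = 1" "plus_sym (coarse_lang L) = plus_sym L"
  "times_sym (coarse_lang L) = times_sym L" "vring_sym (coarse_lang L) = None"
  by (simp_all add: coarse_lang_def)

lemma wf_trm_coarse_lang [simp]: "wf_trm (coarse_lang L) t = wf_trm L t"
  by (induction t) auto

lemma tval_cong_struct: "fun_of M' = fun_of M \<Longrightarrow> tval M' e t = tval M e t"
  by (induction t) (auto cong: map_cong)

text \<open>The expansion is described by its symbols and not as \<open>expand M V\<close>, because
  an arbitrary model of the expanded theory has to fit.\<close>

locale coarse_setting = prep_setting L M g T
  for L :: "('f, 'r) vlang" and M :: "('f, 'r, 'v) struct" and g :: "('f + 'r) + nat \<Rightarrow> 'u" and T +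
  fixes Mc :: "('f, 'r option, 'v) struct"
  assumes univ_c [simp]: "univ Mc = univ M" and fun_c [simp]: "fun_of Mc = fun_of M"
    and rel_c [simp]: "rel_of Mc (Some r) = rel_of M r"
    and valuation_ring_c: "valuation_ring (fld L M) (vring (coarse_lang L) Mc)"
    and V_subset_c: "vring L M \<subseteq> vring (coarse_lang L) Mc"
begin

abbreviation "Lc \<equiv> coarse_lang L"
abbreviation "Vc \<equiv> vring Lc Mc"
abbreviation "EQ \<equiv> eq_struct Lc Mc"

lemma tval_c [simp]: "tval Mc = tval M"
  by (intro ext tval_cong_struct fun_c)

lemma tuples_c [simp]: "tuples Mc n = tuples M n"
  by (simp add: tuples_def)

lemma fld_c [simp]: "fld Lc Mc = fld L M"
  by (simp add: fld_def)

lemma forced_iff: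
  assumes "forced (\<lambda>l f f'. P f \<longrightarrow> P f')"
  shows "forced (\<lambda>l f f'. P f \<longleftrightarrow> P f')"
  by (rule forced_mono[OF forced_conj[OF assms forced_sym[OF assms]]]) blast

lemma mem_Vc_cong:
  assumes "a \<in> univ M" "b \<in> univ M" "vle R V a b" "b \<in> Vc"
  shows "a \<in> Vc"
proof -
  interpret c: valued R Vc by (rule valued.intro[OF F]) (rule valued_axioms.intro[OF valuation_ring_c])
  obtain v where "v \<in> V" "a = b \<otimes>\<^bsub>R\<^esub> v" using assms(3) by (auto simp: vle_def)
  then show ?thesis using c.V_mult assms(4) V_subset_c by blast
qed

text \<open>The only new atom is membership in the coarse ring. It depends on the fine value alone,
  as this ring is closed under multiplication by the fine one, and a leading term determines the
  value.\<close>

lemma forced_formula: "wf_fm Lc p \<Longrightarrow> forced (\<lambda>l f f'. sat Mc f p \<longleftrightarrow> sat Mc f' p)"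
proof (induction p)
  case (Eql s t)
  then show ?case
    using forced_iff[OF forced_field_formula[of "Eql s t"]] by simp
next
  case (Rel r ts)
  show ?case
  proof (cases r)
    case (Some r')
    then show ?thesis
      using forced_iff[OF forced_field_formula[of "Rel r' ts"]] Rel by simp
  next
    case None
    then obtain t where ts: "ts = [t]" using Rel by (auto simp: length_Suc_conv)
    then have t: "wf_trm L t" using Rel by simp
    have sat: "sat Mc f (Rel r ts) \<longleftrightarrow> tval M f t \<in> Vc" if "\<And>j. f j \<in> univ M" for f
      using tval_in[OF t that] by (simp add: ts None vring_def)
    show ?thesis
    proof (rule forced_mono[OF forced_rveq[OF t]])
      fix l f f' assume *: "l \<in> univ M" "radius R V l" "\<And>j. f j \<in> univ M" "\<And>j. f' j \<in> univ M"
        "rveq R V l (tval M f t) (tval M f' t)"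
      have x: "tval M f t \<in> univ M" "tval M f' t \<in> univ M" using tval_in[OF t] *(3,4) by auto
      have "vle R V (tval M f t) (tval M f' t) \<and> vle R V (tval M f' t) (tval M f t)"
        by (rule rveq_le[OF *(2)]) (use x *(5) in simp_all)
      then show "sat Mc f (Rel r ts) = sat Mc f' (Rel r ts)"
        unfolding sat[OF *(3)] sat[OF *(4)] using mem_Vc_cong[OF x(1) x(2)] mem_Vc_cong[OF x(2) x(1)] by blast
    qed
  qed
next
  case (Neg p)
  then have "forced (\<lambda>l f f'. sat Mc f p \<longleftrightarrow> sat Mc f' p)" by simp
  then show ?case by (rule forced_mono) simp
next
  case (Conj p q)
  then have "forced (\<lambda>l f f'. (sat Mc f p \<longleftrightarrow> sat Mc f' p) \<and> (sat Mc f q \<longleftrightarrow> sat Mc f' q))"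
    by (intro forced_conj) simp_all
  then show ?case by (rule forced_mono) simp
next
  case (Exi i p)
  then have "forced (\<lambda>l f f'. \<forall>y\<in>univ M. \<exists>y'\<in>univ M. sat Mc (f(i := y)) p \<longleftrightarrow> sat Mc (f'(i := y')) p)"
    by (intro forced_ex) simp
  then have "forced (\<lambda>l f f'. sat Mc f (Exi i p) \<longrightarrow> sat Mc f' (Exi i p))"
    by (rule forced_mono) auto
  then show ?case by (rule forced_iff)
qed

section \<open>Imaginary elements\<close>

text \<open>The terms are put in through equations for new variables above all of theirs; no
  capture-avoiding substitution is needed.\<close>

lemma subst_formula:
  assumes p: "wf_fm Lc p" "\<And>v. v \<in> fv p \<Longrightarrow> v < length us" and us: "\<And>u. u \<in> set us \<Longrightarrow> wf_trm L u"
  obtains q where "wf_fm Lc q"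
    "\<And>f. (\<And>j. f j \<in> univ M) \<Longrightarrow> sat Mc f q \<longleftrightarrow> sat Mc (\<lambda>i. tval M f (us ! i)) p"
proof -
  define B where "B = fresh (\<Union> (fv_trm ` set us))"
  define q where "q = exis (map (\<lambda>i. B + i) [0..<length us])
    (Conj (Conjs (map (\<lambda>i. Eql (Var (B + i)) (us ! i)) [0..<length us])) (ren (\<lambda>i. B + i) p))"
  have B: "v < B" if "u \<in> set us" "v \<in> fv_trm u" for u v
    unfolding B_def by (rule fresh_greater) (use that finite_fv_trm in auto)
  have tv: "tval M f' u = tval M f u" if "u \<in> set us" "\<And>v. v \<notin> set (map (\<lambda>i. B + i) [0..<length us]) \<Longrightarrow> f' v = f v" for f f' u
    by (rule tval_cong, rule that(2)) (use B[OF that(1)] in fastforce)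
  show thesis
  proof (rule that)
    show "wf_fm Lc q" using p us by (simp add: q_def)
    fix f :: "nat \<Rightarrow> 'v" assume f: "\<And>j. f j \<in> univ M"
    show "sat Mc f q \<longleftrightarrow> sat Mc (\<lambda>i. tval M f (us ! i)) p"
    proof
      assume "sat Mc f q"
      then obtain f' where f'0: "\<forall>v. v \<notin> set (map (\<lambda>i. B + i) [0..<length us]) \<longrightarrow> f' v = f v"
        "sat Mc f' (Conj (Conjs (map (\<lambda>i. Eql (Var (B + i)) (us ! i)) [0..<length us])) (ren (\<lambda>i. B + i) p))"
        unfolding q_def sat_exis by blast
      have f': "\<And>v. v \<notin> set (map (\<lambda>i. B + i) [0..<length us]) \<Longrightarrow> f' v = f v"
        "\<And>i. i < length us \<Longrightarrow> f' (B + i) = tval M f' (us ! i)" "sat Mc (\<lambda>i. f' (B + i)) p"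
        using f'0 by auto
      have "sat Mc (\<lambda>i. f' (B + i)) p = sat Mc (\<lambda>i. tval M f (us ! i)) p"
        by (rule sat_cong) (use p(2) f'(2) tv[OF _ f'(1)] in simp)
      then show "sat Mc (\<lambda>i. tval M f (us ! i)) p" using f'(3) by simp
    next
      assume sat: "sat Mc (\<lambda>i. tval M f (us ! i)) p"
      define f' where "f' v = (if v \<in> set (map (\<lambda>i. B + i) [0..<length us]) then tval M f (us ! (v - B)) else f v)" for v
      have 1: "f' v = f v" if "v \<notin> set (map (\<lambda>i. B + i) [0..<length us])" for v
        using that by (simp only: f'_def if_False)
      have 2: "f' (B + i) = tval M f (us ! i)" if "i < length us" for i
        using that by (auto simp: f'_def)
      have 3: "f' v \<in> univ M" for v
        using f tval_in[OF us f] by (auto simp: f'_def)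
      have "sat Mc (\<lambda>i. f' (B + i)) p"
        using sat sat_cong[of p "\<lambda>i. f' (B + i)" "\<lambda>i. tval M f (us ! i)" Mc] 2 p(2) by simp
      moreover have "f' (B + i) = tval M f' (us ! i)" if "i < length us" for i
        using 2[OF that] tv[OF nth_mem[OF that] 1] by simp
      ultimately show "sat Mc f q"
        unfolding q_def sat_exis using 1 3 by (intro exI[of _ f']) auto
    qed
  qed
qed

text \<open>A sort is given by a formula without parameters, so its instance at two tuples of terms
  is a formula in the field variables.\<close>

lemma forced_sort:
  assumes s: "is_sort Lc Mc (n, E)" and us: "length us = n" "\<And>u. u \<in> set us \<Longrightarrow> wf_trm L u"
    and ws: "length ws = n" "\<And>u. u \<in> set ws \<Longrightarrow> wf_trm L u"
  shows "forced (\<lambda>l f f'. (map (tval M f) us, map (tval M f) ws) \<in> E \<longleftrightarrow> (map (tval M f') us, map (tval M f') ws) \<in> E)"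
proof -
  obtain p e where p: "wf_fm Lc p" "\<forall>i\<in>fv p. i < n + n \<or> e i \<in> {}"
    "{xs @ ys |xs ys. (xs, ys) \<in> E} = {xs \<in> tuples M (n + n). sat Mc (\<lambda>i. if i < n + n then xs ! i else e i) p}"
    and E: "equiv (tuples M n) E"
    using s unfolding is_sort_def definable_def by auto
  obtain q where q: "wf_fm Lc q"
    "\<And>f. (\<And>j. f j \<in> univ M) \<Longrightarrow> sat Mc f q \<longleftrightarrow> sat Mc (\<lambda>i. tval M f ((us @ ws) ! i)) p"
    by (rule subst_formula[of p "us @ ws"]) (use p us ws in auto)
  have mem: "(map (tval M f) us, map (tval M f) ws) \<in> E \<longleftrightarrow> sat Mc f q" if f: "\<And>j. f j \<in> univ M" for f
  proof -
    let ?xs = "map (tval M f) us" and ?ys = "map (tval M f) ws"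
    have t: "?xs @ ?ys \<in> tuples M (n + n)"
      using us ws tval_in[OF _ f] by (auto simp: tuples_def)
    have "(?xs, ?ys) \<in> E \<longleftrightarrow> ?xs @ ?ys \<in> {xs @ ys |xs ys. (xs, ys) \<in> E}"
    proof
      assume "?xs @ ?ys \<in> {xs @ ys |xs ys. (xs, ys) \<in> E}"
      then obtain xs ys where *: "?xs @ ?ys = xs @ ys" "(xs, ys) \<in> E" by blast
      then have "length xs = n" using E by (auto simp: equiv_def tuples_def)
      then have "?xs = xs" "?ys = ys" using *(1) us(1) by (simp_all add: append_eq_append_conv)
      then show "(?xs, ?ys) \<in> E" using * by simp
    qed blast
    also have "\<dots> \<longleftrightarrow> sat Mc (\<lambda>i. if i < n + n then (?xs @ ?ys) ! i else e i) p"
      unfolding p(3) using t by blast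
    also have "\<dots> \<longleftrightarrow> sat Mc (\<lambda>i. tval M f ((us @ ws) ! i)) p"
      by (rule sat_cong) (use p(2) us ws in \<open>auto simp: nth_append\<close>)
    finally show ?thesis using q(2)[OF f] by simp
  qed
  show ?thesis
  proof (rule forced_mono[OF forced_formula[OF q(1)]])
    fix l f f' assume "\<And>j. f j \<in> univ M" "\<And>j. f' j \<in> univ M" "sat Mc f q = sat Mc f' q"
    then show "((map (tval M f) us, map (tval M f) ws) \<in> E) = ((map (tval M f') us, map (tval M f') ws) \<in> E)"
      using mem[of f] mem[of f'] by blast
  qed
qed

text \<open>Position \<open>prod_encode (v, j)\<close> holds the j-th coordinate of a tuple that
  represents variable v of a formula over M^eq.\<close>

definition updn :: "nat \<Rightarrow> nat \<Rightarrow> (nat \<Rightarrow> 'v) \<Rightarrow> (nat \<Rightarrow> 'v) \<Rightarrow> nat \<Rightarrow> 'v" where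
  "updn v n f x = (\<lambda>k. case prod_decode k of (w, j) \<Rightarrow> if w = v \<and> j < n then x j else f k)"

lemma updn_encode: "updn v n f x (prod_encode (w, j)) = (if w = v \<and> j < n then x j else f (prod_encode (w, j)))"
  by (simp add: updn_def)

lemma updn_Suc: "updn v (Suc n) f x = (updn v n f x)(prod_encode (v, n) := x n)"
proof
  fix k
  obtain w j where "k = prod_encode (w, j)" by (metis prod_decode_inverse surj_pair)
  then show "updn v (Suc n) f x k = ((updn v n f x)(prod_encode (v, n) := x n)) k"
    by (auto simp: updn_encode less_Suc_eq)
qed

lemma forced_ex_n:
  assumes "forced Q"
  shows "forced (\<lambda>l f f'. \<forall>x. (\<forall>j. x j \<in> univ M) \<longrightarrow> (\<exists>x'. (\<forall>j. x' j \<in> univ M) \<and> Q l (updn v n f x) (updn v n f' x')))"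
  using assms
proof (induction n arbitrary: Q)
  case 0
  have "updn v 0 f x = f" for f x by (auto simp: updn_def)
  then show ?case by (intro forced_mono[OF 0]) auto
next
  case (Suc n)
  define Q' where "Q' = (\<lambda>l f f'. \<forall>y\<in>univ M. \<exists>y'\<in>univ M. Q l (f(prod_encode (v, n) := y)) (f'(prod_encode (v, n) := y')))"
  have "forced Q'" unfolding Q'_def by (rule forced_ex[OF Suc.prems])
  from Suc.IH[OF this] show ?case
  proof (rule forced_mono)
    fix l f f'
    assume *: "\<forall>x. (\<forall>j. x j \<in> univ M) \<longrightarrow> (\<exists>x'. (\<forall>j. x' j \<in> univ M) \<and> Q' l (updn v n f x) (updn v n f' x'))"
    show "\<forall>x. (\<forall>j. x j \<in> univ M) \<longrightarrow> (\<exists>x'. (\<forall>j. x' j \<in> univ M) \<and> Q l (updn v (Suc n) f x) (updn v (Suc n) f' x'))"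
    proof (intro allI impI)
      fix x :: "nat \<Rightarrow> 'v" assume x: "\<forall>j. x j \<in> univ M"
      with * obtain x' where x': "\<forall>j. x' j \<in> univ M" "Q' l (updn v n f x) (updn v n f' x')" by blast
      then obtain y' where y': "y' \<in> univ M" "Q l ((updn v n f x)(prod_encode (v, n) := x n)) ((updn v n f' x')(prod_encode (v, n) := y'))"
        using x unfolding Q'_def by blast
      have "updn v n f' (x'(n := y')) = updn v n f' x'"
        by (auto simp: updn_def split: prod.split)
      then have "Q l (updn v (Suc n) f x) (updn v (Suc n) f' (x'(n := y')))"
        using y'(2) by (simp add: updn_Suc)
      then show "\<exists>x'. (\<forall>j. x' j \<in> univ M) \<and> Q l (updn v (Suc n) f x) (updn v (Suc n) f' x')"
        using x' y' by (intro exI[of _ "x'(n := y')"]) auto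
    qed
  qed
qed

end

text \<open>The kind of an element of \<open>M\<^sup>e\<^sup>q\<close> relative to a finite set of sorts; elements of all other sorts
  are only compared by equality.\<close>

datatype 'v kind = KHome | KSort "'v sort" | KJunk

fun represents :: "'v kind \<Rightarrow> (nat \<Rightarrow> 'v) \<Rightarrow> 'v eq_elem \<Rightarrow> bool" where
  "represents KHome x u \<longleftrightarrow> u = Inl (x 0)"
| "represents (KSort s) x u \<longleftrightarrow> u = Inr (s, snd s `` {map x [0..<fst s]})"
| "represents KJunk x u \<longleftrightarrow> True"

primrec sorts :: "('f, 'r + 's) fm \<Rightarrow> 's set" where
  "sorts (Eql s t) = {}"
| "sorts (Rel q ts) = (case q of Inl r \<Rightarrow> {} | Inr s \<Rightarrow> {s})"
| "sorts (Neg p) = sorts p"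
| "sorts (Conj p q) = sorts p \<union> sorts q"
| "sorts (Exi i p) = sorts p"

lemma finite_sorts: "finite (sorts p)"
  by (induction p) (auto split: sum.split)

section \<open>Agreement on formulas with imaginary variables\<close>

context coarse_setting
begin

definition junk :: "'v sort set \<Rightarrow> 'v eq_elem \<Rightarrow> bool" where
  "junk \<Sigma> u \<longleftrightarrow> u \<in> univ EQ \<and> u \<notin> range Inl \<and> (\<forall>s\<in>\<Sigma>. \<forall>c. u \<noteq> Inr (s, c))"

definition lifts :: "'v sort set \<Rightarrow> (nat \<Rightarrow> 'v kind) \<Rightarrow> (nat \<Rightarrow> 'v) \<Rightarrow> (nat \<Rightarrow> 'v eq_elem) \<Rightarrow> bool" where
  "lifts \<Sigma> \<kappa> f e \<longleftrightarrow> (\<forall>v. represents (\<kappa> v) (\<lambda>j. f (prod_encode (v, j))) (e v) \<and> (\<kappa> v = KJunk \<longrightarrow> junk \<Sigma> (e v)))"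

text \<open>No tuple represents a junk element, so both sides have to carry the same one. This
  suffices for quantifiers that range over sorts outside the finite set \<Sigma>.\<close>

definition eq_agree :: "'v sort set \<Rightarrow> (nat \<Rightarrow> 'v kind) \<Rightarrow> ('f, 'r option + 'v sort) fm \<Rightarrow> (nat \<Rightarrow> 'v) \<Rightarrow> (nat \<Rightarrow> 'v) \<Rightarrow> bool" where
  "eq_agree \<Sigma> \<kappa> p f f' \<longleftrightarrow> (\<forall>e e'. lifts \<Sigma> \<kappa> f e \<longrightarrow> lifts \<Sigma> \<kappa> f' e' \<longrightarrow> (\<forall>v. \<kappa> v = KJunk \<longrightarrow> e v = e' v) \<longrightarrow>
     sat EQ e p = sat EQ e' p)"

lemma lifts_Home: "lifts \<Sigma> \<kappa> f e \<Longrightarrow> \<kappa> v = KHome \<Longrightarrow> e v = Inl (f (prod_encode (v, 0)))"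
  unfolding lifts_def by (metis represents.simps(1))

lemma lifts_Sort: "lifts \<Sigma> \<kappa> f e \<Longrightarrow> \<kappa> v = KSort (n, E) \<Longrightarrow>
    e v = Inr ((n, E), E `` {map (\<lambda>j. f (prod_encode (v, j))) [0..<n]})"
  unfolding lifts_def by (metis represents.simps(2) fst_conv snd_conv)

lemma lifts_Junk: "lifts \<Sigma> \<kappa> f e \<Longrightarrow> \<kappa> v = KJunk \<Longrightarrow> junk \<Sigma> (e v)"
  unfolding lifts_def by blast

lemma lifts_not_Home: "lifts \<Sigma> \<kappa> f e \<Longrightarrow> \<kappa> v \<noteq> KHome \<Longrightarrow> e v \<notin> range Inl"
proof (cases "\<kappa> v")
  case (KSort s)
  assume "lifts \<Sigma> \<kappa> f e"
  then show ?thesis using lifts_Sort[of \<Sigma> \<kappa> f e v "fst s" "snd s"] KSort by auto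
next
  case KJunk
  assume "lifts \<Sigma> \<kappa> f e"
  then show ?thesis using lifts_Junk[of \<Sigma> \<kappa> f e v] KJunk by (auto simp: junk_def)
qed simp

lemma lifts_Sort_Junk:
  assumes "lifts \<Sigma> \<kappa> f e" "\<kappa> v = KSort s" "s \<in> \<Sigma>" "\<kappa> w = KJunk"
  shows "e v \<noteq> e w"
proof -
  obtain n E where s: "s = (n, E)" by force
  have "\<forall>c. e w \<noteq> Inr ((n, E), c)" using lifts_Junk[OF assms(1,4)] assms(3) s by (simp add: junk_def)
  then show ?thesis using lifts_Sort[OF assms(1) assms(2)[unfolded s]] by metis
qed

definition home_term :: "'v sort set \<Rightarrow> (nat \<Rightarrow> 'v kind) \<Rightarrow> 'f trm \<Rightarrow> 'f trm \<Rightarrow> bool" where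
  "home_term \<Sigma> \<kappa> t t' \<longleftrightarrow> wf_trm L t' \<and> (\<forall>f e. lifts \<Sigma> \<kappa> f e \<longrightarrow> tval EQ e t = Inl (tval M f t'))"

definition imag_term :: "'v sort set \<Rightarrow> (nat \<Rightarrow> 'v kind) \<Rightarrow> 'f trm \<Rightarrow> nat \<Rightarrow> bool" where
  "imag_term \<Sigma> \<kappa> t v \<longleftrightarrow> \<kappa> v \<noteq> KHome \<and> (\<forall>f e. lifts \<Sigma> \<kappa> f e \<longrightarrow> tval EQ e t = e v)"

lemma home_term_value: "home_term \<Sigma> \<kappa> t t' \<Longrightarrow> lifts \<Sigma> \<kappa> f e \<Longrightarrow> tval EQ e t = Inl (tval M f t')"
  by (simp add: home_term_def)

lemma imag_term_value: "imag_term \<Sigma> \<kappa> t v \<Longrightarrow> lifts \<Sigma> \<kappa> f e \<Longrightarrow> tval EQ e t \<noteq> Inl x"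
  using lifts_not_Home[of \<Sigma> \<kappa> f e v] by (metis imag_term_def rangeI)

text \<open>A function symbol applied outside the home sort returns its first argument. So a term
  with an imaginary argument has the value of its first argument, and by induction every term is a
  field term or behaves like one imaginary variable.\<close>

lemma term_kind:
  "wf_trm L t \<Longrightarrow> (\<exists>t'. home_term \<Sigma> \<kappa> t t') \<or> (\<exists>v. imag_term \<Sigma> \<kappa> t v)"
proof (induction t)
  case (Var v)
  show ?case
  proof (cases "\<kappa> v = KHome")
    case True
    then have "home_term \<Sigma> \<kappa> (Var v) (Var (prod_encode (v, 0)))"
      using lifts_Home by (simp add: home_term_def)
    then show ?thesis by blast
  next
    case False
    then have "imag_term \<Sigma> \<kappa> (Var v) v" by (simp add: imag_term_def)
    then show ?thesis by blast
  qed
next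
  case (Fn s ts)
  then have wf: "length ts = farity L s" "\<And>t. t \<in> set ts \<Longrightarrow> wf_trm L t" by auto
  show ?case
  proof (cases "\<forall>t\<in>set ts. \<exists>t'. home_term \<Sigma> \<kappa> t t'")
    case True
    then obtain h where h: "\<And>t. t \<in> set ts \<Longrightarrow> home_term \<Sigma> \<kappa> t (h t)" by metis
    have "home_term \<Sigma> \<kappa> (Fn s ts) (Fn s (map h ts))"
      unfolding home_term_def
    proof (intro conjI allI impI)
      show "wf_trm L (Fn s (map h ts))" using h wf by (auto simp: home_term_def)
      fix f e assume fe: "lifts \<Sigma> \<kappa> f e"
      have "map (tval EQ e) ts = map Inl (map (tval M f) (map h ts))"
        using h fe by (auto simp: home_term_def)
      then show "tval EQ e (Fn s ts) = Inl (tval M f (Fn s (map h ts)))"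
        by (simp only: tval.simps eq_struct_simps set_map_Inl if_True map_projl_Inl fun_c)
    qed
    then show ?thesis by blast
  next
    case False
    then obtain u where u: "u \<in> set ts" "\<nexists>t'. home_term \<Sigma> \<kappa> u t'" by blast
    then obtain v where v: "imag_term \<Sigma> \<kappa> u v" using Fn.IH wf by blast
    then obtain t0 ts' where ts: "ts = t0 # ts'" using u by (cases ts) auto
    have val: "tval EQ e (Fn s ts) = tval EQ e t0" if "lifts \<Sigma> \<kappa> f e" for f e
    proof -
      have "tval EQ e u \<notin> range Inl"
        using v lifts_not_Home[OF that] that by (auto simp: imag_term_def)
      then have "\<not> set (map (tval EQ e) ts) \<subseteq> range Inl" using u(1) by auto
      then have "tval EQ e (Fn s ts) = hd (map (tval EQ e) ts)"
        by (simp only: tval.simps eq_struct_simps if_False)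
      then show ?thesis by (simp add: ts)
    qed
    have "(\<exists>t'. home_term \<Sigma> \<kappa> t0 t') \<or> (\<exists>v. imag_term \<Sigma> \<kappa> t0 v)" using Fn.IH wf ts by simp
    then show ?thesis using val unfolding home_term_def imag_term_def by metis
  qed
qed

lemma lifts_upd:
  assumes "lifts \<Sigma> \<kappa> f e" "represents k (\<lambda>j. f' (prod_encode (v, j))) u" "k = KJunk \<Longrightarrow> junk \<Sigma> u"
    "\<And>w j. w \<noteq> v \<Longrightarrow> f' (prod_encode (w, j)) = f (prod_encode (w, j))"
  shows "lifts \<Sigma> (\<kappa>(v := k)) f' (e(v := u))"
  using assms unfolding lifts_def by (auto simp: fun_upd_def)

definition home_list :: "'v sort set \<Rightarrow> (nat \<Rightarrow> 'v kind) \<Rightarrow> 'f trm list \<Rightarrow> 'f trm list \<Rightarrow> bool" where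
  "home_list \<Sigma> \<kappa> ts us \<longleftrightarrow> length us = length ts \<and> (\<forall>u\<in>set us. wf_trm L u) \<and>
     (\<forall>f e. lifts \<Sigma> \<kappa> f e \<longrightarrow> map (tval EQ e) ts = map Inl (map (tval M f) us))"

lemma term_list_kind:
  assumes "\<And>t. t \<in> set ts \<Longrightarrow> wf_trm L t"
  shows "(\<exists>us. home_list \<Sigma> \<kappa> ts us) \<or> (\<forall>f e. lifts \<Sigma> \<kappa> f e \<longrightarrow> \<not> set (map (tval EQ e) ts) \<subseteq> range Inl)"
proof (cases "\<forall>t\<in>set ts. \<exists>t'. home_term \<Sigma> \<kappa> t t'")
  case True
  then obtain h where h: "\<And>t. t \<in> set ts \<Longrightarrow> home_term \<Sigma> \<kappa> t (h t)" by metis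
  have "home_list \<Sigma> \<kappa> ts (map h ts)"
    using h by (auto simp: home_list_def home_term_def)
  then show ?thesis by blast
next
  case False
  then obtain u v where u: "u \<in> set ts" "imag_term \<Sigma> \<kappa> u v" using term_kind assms by blast
  have "\<not> set (map (tval EQ e) ts) \<subseteq> range Inl" if "lifts \<Sigma> \<kappa> f e" for f e
  proof -
    have "tval EQ e u \<notin> range Inl"
      using u(2) lifts_not_Home[OF that] that by (auto simp: imag_term_def)
    then show ?thesis using u(1) by auto
  qed
  then show ?thesis by blast
qed

lemma forced_eq_agreeI:
  assumes "forced (\<lambda>l f f'. P f \<longleftrightarrow> P f')"
    "\<And>f e. (\<And>j. f j \<in> univ M) \<Longrightarrow> lifts \<Sigma> \<kappa> f e \<Longrightarrow> sat EQ e p \<longleftrightarrow> P f"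
  shows "forced (\<lambda>l. eq_agree \<Sigma> \<kappa> p)"
proof (rule forced_mono[OF assms(1)])
  fix l f f' assume "\<And>j. f j \<in> univ M" "\<And>j. f' j \<in> univ M" "P f = P f'"
  then show "eq_agree \<Sigma> \<kappa> p f f'"
    using assms(2)[of f] assms(2)[of f'] unfolding eq_agree_def by blast
qed

lemma forced_const: "forced (\<lambda>l f f'. c \<longleftrightarrow> c)"
  using forced_True by simp

lemma class_eq_iff:
  assumes "is_sort Lc Mc (n, E)" "xs \<in> tuples M n" "ys \<in> tuples M n"
  shows "E `` {xs} = E `` {ys} \<longleftrightarrow> (xs, ys) \<in> E"
  using assms eq_equiv_class_iff[of "tuples M n" E xs ys] by (simp add: is_sort_def)

text \<open>Values of different kinds are never equal; for sort against junk this holds because the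
  sorts in use belong to \<Sigma>. Within one sort the equivalence relation decides, and two junk
  values are the same pair on both sides.\<close>

lemma forced_Eql:
  assumes wf: "wf_trm L s" "wf_trm L t" and \<Sigma>: "\<And>s. s \<in> \<Sigma> \<Longrightarrow> is_sort Lc Mc s"
    and good: "\<And>v s. \<kappa> v = KSort s \<Longrightarrow> s \<in> \<Sigma>"
  shows "forced (\<lambda>l. eq_agree \<Sigma> \<kappa> (Eql s t))"
proof -
  consider s' t' where "home_term \<Sigma> \<kappa> s s'" "home_term \<Sigma> \<kappa> t t'"
    | s' v where "home_term \<Sigma> \<kappa> s s'" "imag_term \<Sigma> \<kappa> t v"
    | v t' where "imag_term \<Sigma> \<kappa> s v" "home_term \<Sigma> \<kappa> t t'"
    | v w where "imag_term \<Sigma> \<kappa> s v" "imag_term \<Sigma> \<kappa> t w"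
    using term_kind[OF wf(1), of \<Sigma> \<kappa>] term_kind[OF wf(2), of \<Sigma> \<kappa>] by metis
  then show ?thesis
  proof cases
    case (1 s' t')
    have "forced (\<lambda>l f f'. sat Mc f (Eql s' t') = sat Mc f' (Eql s' t'))"
      by (rule forced_formula) (use 1 in \<open>simp add: home_term_def\<close>)
    then show ?thesis
      by (rule forced_eq_agreeI) (simp add: home_term_value[OF 1(1)] home_term_value[OF 1(2)])
  next
    case (2 s' v)
    show ?thesis
      by (rule forced_eq_agreeI[OF forced_const[of False]])
        (metis 2 sat.simps(1) home_term_value imag_term_value)
  next
    case (3 v t')
    show ?thesis
      by (rule forced_eq_agreeI[OF forced_const[of False]])
        (metis 3 sat.simps(1) home_term_value imag_term_value)
  next
    case (4 v w)
    have sat: "sat EQ e (Eql s t) \<longleftrightarrow> e v = e w" if "lifts \<Sigma> \<kappa> f e" for f e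
      using 4 that by (auto simp: imag_term_def)
    show ?thesis
    proof (cases "\<kappa> v")
      case KHome
      then show ?thesis using 4 by (simp add: imag_term_def)
    next
      case (KSort s1)
      show ?thesis
      proof (cases "\<kappa> w")
        case KHome
        then show ?thesis using 4 by (simp add: imag_term_def)
      next
        case (KSort s2)
        obtain n E where s1: "s1 = (n, E)" by force
        show ?thesis
        proof (cases "s1 = s2")
          case True
          define us where "us = map (\<lambda>j. Var (prod_encode (v, j)) :: 'f trm) [0..<n]"
          define ws where "ws = map (\<lambda>j. Var (prod_encode (w, j)) :: 'f trm) [0..<n]"
          have sort: "is_sort Lc Mc (n, E)" using \<Sigma> good[OF KSort] True s1 by auto
          have vals: "map (tval M f) us = map (\<lambda>j. f (prod_encode (v, j))) [0..<n]"
            "map (tval M f) ws = map (\<lambda>j. f (prod_encode (w, j))) [0..<n]" for f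
            by (simp_all add: us_def ws_def)
          have "forced (\<lambda>l f f'. (map (tval M f) us, map (tval M f) ws) \<in> E \<longleftrightarrow> (map (tval M f') us, map (tval M f') ws) \<in> E)"
            by (rule forced_sort[OF sort]) (auto simp: us_def ws_def)
          then show ?thesis
          proof (rule forced_eq_agreeI)
            fix f e assume f: "\<And>j. f j \<in> univ M" and fe: "lifts \<Sigma> \<kappa> f e"
            have "map (tval M f) us \<in> tuples M n" "map (tval M f) ws \<in> tuples M n"
              unfolding vals using f by (auto simp: tuples_def)
            from class_eq_iff[OF sort this]
            show "sat EQ e (Eql s t) \<longleftrightarrow> (map (tval M f) us, map (tval M f) ws) \<in> E"
              unfolding sat[OF fe] lifts_Sort[OF fe \<open>\<kappa> v = KSort s1\<close>[unfolded s1]]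
                lifts_Sort[OF fe KSort[folded True, unfolded s1]] vals by simp
          qed
        next
          case False
          have "e v \<noteq> e w" if "lifts \<Sigma> \<kappa> f e" for f e
            using lifts_Sort[OF that, of v "fst s1" "snd s1"] lifts_Sort[OF that, of w "fst s2" "snd s2"]
              \<open>\<kappa> v = KSort s1\<close> KSort False by auto
          then show ?thesis
            by (intro forced_eq_agreeI[OF forced_const[of False]]) (use sat in blast)
        qed
      next
        case KJunk
        have "e v \<noteq> e w" if "lifts \<Sigma> \<kappa> f e" for f e
          using lifts_Sort_Junk[OF that \<open>\<kappa> v = KSort s1\<close> good[OF \<open>\<kappa> v = KSort s1\<close>] KJunk] .
        then show ?thesis
          by (intro forced_eq_agreeI[OF forced_const[of False]]) (use sat in blast)
      qed
    next
      case KJunk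
      show ?thesis
      proof (cases "\<kappa> w")
        case KHome
        then show ?thesis using 4 by (simp add: imag_term_def)
      next
        case (KSort s2)
        have "e v \<noteq> e w" if "lifts \<Sigma> \<kappa> f e" for f e
          using lifts_Sort_Junk[OF that KSort good[OF KSort] KJunk] by metis
        then show ?thesis
          by (intro forced_eq_agreeI[OF forced_const[of False]]) (use sat in blast)
      next
        case KJunk': KJunk
        have "eq_agree \<Sigma> \<kappa> (Eql s t) f f'" for f f'
          unfolding eq_agree_def using sat KJunk KJunk' by metis
        then show ?thesis by (intro forced_mono[OF forced_True])
      qed
    qed
  qed
qed

end

context coarse_setting
begin

lemma forced_Rel_Inl:
  assumes wf: "length ts = rarity Lc r" "\<And>t. t \<in> set ts \<Longrightarrow> wf_trm L t"
  shows "forced (\<lambda>l. eq_agree \<Sigma> \<kappa> (Rel (Inl r) ts))"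
proof (cases "\<exists>us. home_list \<Sigma> \<kappa> ts us")
  case True
  then obtain us where us: "home_list \<Sigma> \<kappa> ts us" by blast
  have "forced (\<lambda>l f f'. sat Mc f (Rel r us) = sat Mc f' (Rel r us))"
    by (rule forced_formula) (use us wf in \<open>auto simp: home_list_def\<close>)
  then show ?thesis
  proof (rule forced_eq_agreeI)
    fix f e assume "lifts \<Sigma> \<kappa> f e"
    then have "map (tval EQ e) ts = map Inl (map (tval M f) us)" using us unfolding home_list_def by blast
    then show "sat EQ e (Rel (Inl r) ts) = sat Mc f (Rel r us)"
      by (simp only: sat.simps eq_struct_simps set_map_Inl map_projl_Inl simp_thms tval_c)
  qed
next
  case False
  then have "\<not> set (map (tval EQ e) ts) \<subseteq> range Inl" if "lifts \<Sigma> \<kappa> f e" for f e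
    using term_list_kind[OF wf(2)] that by metis
  then show ?thesis
    by (intro forced_eq_agreeI[OF forced_const[of False]]) (simp only: sat.simps eq_struct_simps simp_thms)
qed

text \<open>The projection relation can hold only if the last term behaves like a variable of the
  sort in question; then the representing tuple is compared with the given one. A junk value is
  excluded since \<Sigma> contains the sort.\<close>

lemma forced_Rel_Inr:
  assumes wf: "length ts = Suc n" "\<And>t. t \<in> set ts \<Longrightarrow> wf_trm L t"
    and \<Sigma>: "is_sort Lc Mc (n, E) \<Longrightarrow> (n, E) \<in> \<Sigma>" and good: "\<And>v s. \<kappa> v = KSort s \<Longrightarrow> s \<in> \<Sigma>"
  shows "forced (\<lambda>l. eq_agree \<Sigma> \<kappa> (Rel (Inr (n, E)) ts))"
proof -
  obtain ts0 t where ts: "ts = ts0 @ [t]" using wf(1) by (metis append_butlast_last_id list.size(3) nat.simps(3))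
  then have ts0: "length ts0 = n" "\<And>t. t \<in> set ts0 \<Longrightarrow> wf_trm L t" and t: "wf_trm L t" using wf by auto
  have sat: "sat EQ e (Rel (Inr (n, E)) ts) \<longleftrightarrow> is_sort Lc Mc (n, E) \<and>
      (\<exists>xs\<in>tuples M n. map (tval EQ e) ts0 = map Inl xs \<and> tval EQ e t = Inr ((n, E), E `` {xs}))" for e
    by (simp add: eq_struct_simps ts)
  have False_case: ?thesis if "\<And>f e. lifts \<Sigma> \<kappa> f e \<Longrightarrow> \<not> sat EQ e (Rel (Inr (n, E)) ts)"
    by (rule forced_eq_agreeI[OF forced_const[of False]]) (use that in blast)
  show ?thesis
  proof (cases "is_sort Lc Mc (n, E)")
    case False
    then show ?thesis using sat by (intro False_case) blast
  next
    case sort: True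
    show ?thesis
    proof (cases "\<exists>us. home_list \<Sigma> \<kappa> ts0 us")
      case False
      then have "\<not> set (map (tval EQ e) ts0) \<subseteq> range Inl" if "lifts \<Sigma> \<kappa> f e" for f e
        using term_list_kind[OF ts0(2)] that by metis
      then have "\<not> sat EQ e (Rel (Inr (n, E)) ts)" if "lifts \<Sigma> \<kappa> f e" for f e
        unfolding sat using that set_map_Inl by metis
      then show ?thesis by (rule False_case)
    next
      case True
      then obtain us where us: "home_list \<Sigma> \<kappa> ts0 us" by blast
      show ?thesis
      proof (cases "\<exists>v. imag_term \<Sigma> \<kappa> t v \<and> \<kappa> v = KSort (n, E)")
        case True
        then obtain v where v: "imag_term \<Sigma> \<kappa> t v" "\<kappa> v = KSort (n, E)" by blast
        define ws where "ws = map (\<lambda>j. Var (prod_encode (v, j)) :: 'f trm) [0..<n]"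
        have vals: "map (tval M f) ws = map (\<lambda>j. f (prod_encode (v, j))) [0..<n]" for f
          by (simp add: ws_def)
        have us': "length us = n" "\<And>u. u \<in> set us \<Longrightarrow> wf_trm L u" using us ts0 by (auto simp: home_list_def)
        have "forced (\<lambda>l f f'. (map (tval M f) us, map (tval M f) ws) \<in> E \<longleftrightarrow> (map (tval M f') us, map (tval M f') ws) \<in> E)"
          by (rule forced_sort[OF sort us']) (auto simp: ws_def)
        then show ?thesis
        proof (rule forced_eq_agreeI)
          fix f e assume f: "\<And>j. f j \<in> univ M" and fe: "lifts \<Sigma> \<kappa> f e"
          have tup: "map (tval M f) us \<in> tuples M n" "map (tval M f) ws \<in> tuples M n"
            using f us' tval_in[OF _ f] by (auto simp: tuples_def ws_def)
          have 1: "map (tval EQ e) ts0 = map Inl (map (tval M f) us)"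
            using us fe unfolding home_list_def by blast
          have 2: "tval EQ e t = Inr ((n, E), E `` {map (tval M f) ws})"
            using v(1) fe lifts_Sort[OF fe v(2)] unfolding imag_term_def vals by metis
          have inj: "map Inl xs = map Inl ys \<longleftrightarrow> xs = ys" for xs ys :: "'v list"
            by (rule inj_map_eq_map) simp
          have "sat EQ e (Rel (Inr (n, E)) ts) \<longleftrightarrow> E `` {map (tval M f) ws} = E `` {map (tval M f) us}"
            unfolding sat 1 2 inj using sort tup by auto
          also have "\<dots> \<longleftrightarrow> (map (tval M f) us, map (tval M f) ws) \<in> E"
            using class_eq_iff[OF sort tup] by auto
          finally show "sat EQ e (Rel (Inr (n, E)) ts) \<longleftrightarrow> (map (tval M f) us, map (tval M f) ws) \<in> E" .
        qed
      next
        case False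
        have "\<not> sat EQ e (Rel (Inr (n, E)) ts)" if fe: "lifts \<Sigma> \<kappa> f e" for f e
        proof
          assume "sat EQ e (Rel (Inr (n, E)) ts)"
          then obtain c where c: "tval EQ e t = Inr ((n, E), c)" unfolding sat by blast
          then obtain v where v: "imag_term \<Sigma> \<kappa> t v"
            using term_kind[OF t, of \<Sigma> \<kappa>] home_term_value[OF _ fe] by (metis Inl_Inr_False)
          then have ev: "e v = Inr ((n, E), c)" using c fe unfolding imag_term_def by metis
          show False
          proof (cases "\<kappa> v")
            case KHome
            then show False using v by (simp add: imag_term_def)
          next
            case (KSort s)
            then have "s = (n, E)" using lifts_Sort[OF fe, of v "fst s" "snd s"] ev by simp
            then show False using KSort False v by blast
          next
            case KJunk
            then show False using lifts_Junk[OF fe KJunk] ev \<Sigma>[OF sort] by (auto simp: junk_def)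
          qed
        qed
        then show ?thesis by (rule False_case)
      qed
    qed
  qed
qed

lemma univ_EQ_cases:
  assumes "u \<in> univ EQ" and \<Sigma>: "\<And>s. s \<in> \<Sigma> \<Longrightarrow> is_sort Lc Mc s"
  obtains x where "x \<in> univ M" "u = Inl x"
    | n E x where "(n, E) \<in> \<Sigma>" "\<And>j. x j \<in> univ M" "u = Inr ((n, E), E `` {map x [0..<n]})"
    | "junk \<Sigma> u"
proof -
  consider x where "x \<in> univ M" "u = Inl x" | n E c where "u = Inr ((n, E), c)" "is_sort Lc Mc (n, E)" "c \<in> tuples M n // E"
    using assms(1) by (auto simp: eq_struct_simps)
  then show thesis
  proof cases
    case (2 n E c)
    show thesis
    proof (cases "(n, E) \<in> \<Sigma>")
      case True
      obtain xs where xs: "xs \<in> tuples M n" "c = E `` {xs}" using 2(3) by (rule quotientE)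
      obtain d where d: "d \<in> univ M" using univ_nonempty by blast
      define x where "x j = (if j < n then xs ! j else d)" for j
      have len: "length xs = n" using xs by (simp add: tuples_def)
      have "map x [0..<n] = xs"
        by (rule nth_equalityI) (simp_all add: len x_def)
      moreover have "x j \<in> univ M" for j
        using xs d by (auto simp: x_def tuples_def subset_iff)
      ultimately show thesis using that(2)[OF True, of x] 2 xs by simp
    next
      case False
      then have "junk \<Sigma> u" using 2 assms(1) by (auto simp: junk_def)
      then show thesis by (rule that(3))
    qed
  qed (rule that(1))
qed

text \<open>A quantifier over M^eq splits into the home sort, the finitely many sorts of \<Sigma>
  and the junk elements. In the first two cases a representing tuple is answered by back and forth,
  in the third the same element is taken on both sides. \<open>half\<close> is one direction;
  symmetry gives the other.\<close>

lemma forced_Exi: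
  assumes \<Sigma>: "finite \<Sigma>" "\<And>s. s \<in> \<Sigma> \<Longrightarrow> is_sort Lc Mc s"
    and IH: "\<And>k. k \<in> {KHome, KJunk} \<union> KSort ` \<Sigma> \<Longrightarrow> forced (\<lambda>l. eq_agree \<Sigma> (\<kappa>(v := k)) p)"
  shows "forced (\<lambda>l. eq_agree \<Sigma> \<kappa> (Exi v p))"
proof -
  define half where "half = (\<lambda>(l :: 'v) f f'. eq_agree \<Sigma> (\<kappa>(v := KJunk)) p f f' \<and>
    (\<forall>y\<in>univ M. \<exists>y'\<in>univ M. eq_agree \<Sigma> (\<kappa>(v := KHome)) p (f(prod_encode (v, 0) := y)) (f'(prod_encode (v, 0) := y'))) \<and>
    (\<forall>s\<in>\<Sigma>. \<forall>x. (\<forall>j. x j \<in> univ M) \<longrightarrow> (\<exists>x'. (\<forall>j. x' j \<in> univ M) \<and>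
       eq_agree \<Sigma> (\<kappa>(v := KSort s)) p (updn v (fst s) f x) (updn v (fst s) f' x'))))"
  have J: "forced (\<lambda>l. eq_agree \<Sigma> (\<kappa>(v := KJunk)) p)" and H: "forced (\<lambda>l. eq_agree \<Sigma> (\<kappa>(v := KHome)) p)"
    by (rule IH, simp)+
  have S: "forced (\<lambda>l. eq_agree \<Sigma> (\<kappa>(v := KSort s)) p)" if "s \<in> \<Sigma>" for s
    by (rule IH) (use that in simp)
  have half: "forced half"
    unfolding half_def by (rule forced_conj[OF J forced_conj[OF forced_ex[OF H] forced_ball[OF \<Sigma>(1) forced_ex_n[OF S]]]])
  have both: "forced (\<lambda>l f f'. half l f f' \<and> half l f' f)"
    by (rule forced_conj[OF half forced_sym[OF half]])
  have step: "sat EQ e' (Exi v p)"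
    if half: "half l f f'" and f: "\<And>j. f' j \<in> univ M" and e: "lifts \<Sigma> \<kappa> f e" "lifts \<Sigma> \<kappa> f' e'" "\<forall>v. \<kappa> v = KJunk \<longrightarrow> e v = e' v"
      and sat: "sat EQ e (Exi v p)" for l f f' e e'
  proof -
    from sat obtain u where u: "u \<in> univ EQ" "sat EQ (e(v := u)) p" by auto
    from u(1) show ?thesis
    proof (rule univ_EQ_cases[OF _ \<Sigma>(2)])
      fix y assume y: "y \<in> univ M" "u = Inl y"
      with half obtain y' where y': "y' \<in> univ M"
        "eq_agree \<Sigma> (\<kappa>(v := KHome)) p (f(prod_encode (v, 0) := y)) (f'(prod_encode (v, 0) := y'))"
        unfolding half_def by blast
      have "lifts \<Sigma> (\<kappa>(v := KHome)) (f(prod_encode (v, 0) := y)) (e(v := u))"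
        by (rule lifts_upd[OF e(1)]) (use y in auto)
      moreover have "lifts \<Sigma> (\<kappa>(v := KHome)) (f'(prod_encode (v, 0) := y')) (e'(v := Inl y'))"
        by (rule lifts_upd[OF e(2)]) auto
      moreover have "\<forall>w. (\<kappa>(v := KHome)) w = KJunk \<longrightarrow> (e(v := u)) w = (e'(v := Inl y')) w" using e(3) by auto
      ultimately have "sat EQ (e'(v := Inl y')) p" using y'(2) u(2) unfolding eq_agree_def by blast
      moreover have "Inl y' \<in> univ EQ" using y'(1) by (simp add: eq_struct_simps)
      ultimately show ?thesis by auto
    next
      fix n E x assume x: "(n, E) \<in> \<Sigma>" "\<And>j. x j \<in> univ M" "u = Inr ((n, E), E `` {map x [0..<n]})"
      have "\<exists>x'. (\<forall>j. x' j \<in> univ M) \<and> eq_agree \<Sigma> (\<kappa>(v := KSort (n, E))) p (updn v n f x) (updn v n f' x')"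
        using half x(1,2) unfolding half_def by (metis fst_conv)
      then obtain x' where x': "\<And>j. x' j \<in> univ M"
        "eq_agree \<Sigma> (\<kappa>(v := KSort (n, E))) p (updn v n f x) (updn v n f' x')"
        by blast
      define u' :: "'v eq_elem" where "u' = Inr ((n, E), E `` {map x' [0..<n]})"
      have m: "map (\<lambda>j. updn v n f x (prod_encode (v, j))) [0..<n] = map x [0..<n]" for f x
        by (simp add: updn_encode)
      have "lifts \<Sigma> (\<kappa>(v := KSort (n, E))) (updn v n f x) (e(v := u))"
        by (rule lifts_upd[OF e(1)]) (simp_all add: x(3) m, simp add: updn_encode)
      moreover have "lifts \<Sigma> (\<kappa>(v := KSort (n, E))) (updn v n f' x') (e'(v := u'))"
        by (rule lifts_upd[OF e(2)]) (simp_all add: u'_def m, simp add: updn_encode)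
      moreover have "\<forall>w. (\<kappa>(v := KSort (n, E))) w = KJunk \<longrightarrow> (e(v := u)) w = (e'(v := u')) w" using e(3) by auto
      ultimately have "sat EQ (e'(v := u')) p" using x'(2) u(2) unfolding eq_agree_def by blast
      moreover have "u' \<in> univ EQ"
      proof -
        have "map x' [0..<n] \<in> tuples M n" using x'(1) by (auto simp: tuples_def)
        then have "E `` {map x' [0..<n]} \<in> tuples M n // E" by (rule quotientI)
        then show ?thesis using \<Sigma>(2)[OF x(1)] by (simp add: eq_struct_simps u'_def)
      qed
      ultimately show ?thesis by auto
    next
      assume junk: "junk \<Sigma> u"
      have "lifts \<Sigma> (\<kappa>(v := KJunk)) f (e(v := u))" "lifts \<Sigma> (\<kappa>(v := KJunk)) f' (e'(v := u))"
        by (rule lifts_upd[OF e(1)] lifts_upd[OF e(2)]; simp add: junk)+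
      moreover have "\<forall>w. (\<kappa>(v := KJunk)) w = KJunk \<longrightarrow> (e(v := u)) w = (e'(v := u)) w" using e(3) by auto
      moreover have "eq_agree \<Sigma> (\<kappa>(v := KJunk)) p f f'" using half by (simp add: half_def)
      ultimately have "sat EQ (e'(v := u)) p" using u(2) unfolding eq_agree_def by blast
      then show ?thesis using u(1) by auto
    qed
  qed
  show ?thesis
  proof (rule forced_mono[OF both])
    fix l f f' assume *: "\<And>j. f j \<in> univ M" "\<And>j. f' j \<in> univ M" "half l f f' \<and> half l f' f"
    show "eq_agree \<Sigma> \<kappa> (Exi v p) f f'"
      unfolding eq_agree_def
    proof (intro allI impI)
      fix e e' assume e: "lifts \<Sigma> \<kappa> f e" "lifts \<Sigma> \<kappa> f' e'" "\<forall>v. \<kappa> v = KJunk \<longrightarrow> e v = e' v"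
      have e': "\<forall>v. \<kappa> v = KJunk \<longrightarrow> e' v = e v" using e(3) by simp
      show "sat EQ e (Exi v p) = sat EQ e' (Exi v p)"
        using step[of l f f' e e'] step[of l f' f e' e] * e e' by blast
    qed
  qed
qed

text \<open>The kinds vary in the induction, because a quantifier gives its variable a new
  kind.\<close>

theorem forced_eq_agree:
  assumes "finite \<Sigma>" "\<And>s. s \<in> \<Sigma> \<Longrightarrow> is_sort Lc Mc s"
    and "wf_fm (eq_lang Lc) p" "\<And>s. s \<in> sorts p \<Longrightarrow> is_sort Lc Mc s \<Longrightarrow> s \<in> \<Sigma>"
    and "\<And>v s. \<kappa> v = KSort s \<Longrightarrow> s \<in> \<Sigma>"
  shows "forced (\<lambda>l. eq_agree \<Sigma> \<kappa> p)"
  using assms(3-)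
proof (induction p arbitrary: \<kappa>)
  case (Eql s t)
  then show ?case by (intro forced_Eql assms(2)) auto
next
  case (Rel q ts)
  show ?case
  proof (cases q)
    case (Inl r)
    then show ?thesis using Rel forced_Rel_Inl[of ts r] by auto
  next
    case (Inr s)
    obtain n E where s: "s = (n, E)" by force
    have "length ts = Suc n" "\<And>t. t \<in> set ts \<Longrightarrow> wf_trm L t" using Rel(1) Inr s by auto
    then show ?thesis unfolding Inr s by (rule forced_Rel_Inr) (use Rel Inr s in auto)
  qed
next
  case (Neg p)
  then have "forced (\<lambda>l. eq_agree \<Sigma> \<kappa> p)" by simp
  then show ?case by (rule forced_mono) (simp add: eq_agree_def)
next
  case (Conj p q)
  then have "forced (\<lambda>l f f'. eq_agree \<Sigma> \<kappa> p f f' \<and> eq_agree \<Sigma> \<kappa> q f f')"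
    by (intro forced_conj) simp_all
  then show ?case by (rule forced_mono) (simp add: eq_agree_def)
next
  case (Exi v p)
  show ?case
  proof (rule forced_Exi[OF assms(1,2)])
    fix k assume k: "k \<in> {KHome, KJunk} \<union> KSort ` \<Sigma>"
    show "forced (\<lambda>l. eq_agree \<Sigma> (\<kappa>(v := k)) p)"
    proof (rule Exi.IH)
      show "wf_fm (eq_lang Lc) p" "\<And>s. s \<in> sorts p \<Longrightarrow> is_sort Lc Mc s \<Longrightarrow> s \<in> \<Sigma>" using Exi.prems by simp_all
      show "s \<in> \<Sigma>" if "(\<kappa>(v := k)) w = KSort s" for w s
        using that k Exi.prems(3)[of w s] by (auto split: if_splits)
    qed
  qed
qed

end

section \<open>Preparing sets for the coarse valuation\<close>

context coarse_setting
begin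

text \<open>S will consist of the coordinates of the leading-term parameters: any choice of
  representatives at f is answered by one at f'.\<close>

lemma forced_ex_set:
  assumes "finite S" "forced Q"
  shows "forced (\<lambda>l f f'. \<forall>x. (\<forall>j. x j \<in> univ M) \<longrightarrow> (\<exists>x'. (\<forall>j. x' j \<in> univ M) \<and>
    Q l (override_on f x S) (override_on f' x' S)))"
  using assms
proof (induction S arbitrary: Q rule: finite_induct)
  case empty
  then show ?case by (intro forced_mono[OF empty]) auto
next
  case (insert v S)
  define Q' where "Q' = (\<lambda>l f f'. \<forall>y\<in>univ M. \<exists>y'\<in>univ M. Q l (f(v := y)) (f'(v := y')))"
  have "forced Q'" unfolding Q'_def by (rule forced_ex[OF insert.prems])
  from insert.IH[OF this] show ?case
  proof (rule forced_mono)
    fix l f f'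
    assume *: "\<forall>x. (\<forall>j. x j \<in> univ M) \<longrightarrow> (\<exists>x'. (\<forall>j. x' j \<in> univ M) \<and> Q' l (override_on f x S) (override_on f' x' S))"
    show "\<forall>x. (\<forall>j. x j \<in> univ M) \<longrightarrow> (\<exists>x'. (\<forall>j. x' j \<in> univ M) \<and> Q l (override_on f x (insert v S)) (override_on f' x' (insert v S)))"
    proof (intro allI impI)
      fix x :: "nat \<Rightarrow> 'v" assume x: "\<forall>j. x j \<in> univ M"
      with * obtain x' where x': "\<forall>j. x' j \<in> univ M" "Q' l (override_on f x S) (override_on f' x' S)" by blast
      then obtain y' where y': "y' \<in> univ M" "Q l ((override_on f x S)(v := x v)) ((override_on f' x' S)(v := y'))"
        using x unfolding Q'_def by blast
      have "(override_on f' x' S)(v := y') = override_on f' (x'(v := y')) (insert v S)"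
        "(override_on f x S)(v := x v) = override_on f x (insert v S)"
        by (auto simp: override_on_def)
      then show "\<exists>x'. (\<forall>j. x' j \<in> univ M) \<and> Q l (override_on f x (insert v S)) (override_on f' x' (insert v S))"
        using x' y' by (intro exI[of _ "x'(v := y')"]) auto
    qed
  qed
qed

abbreviation fine_le (infix \<open>\<preceq>\<close> 50) where "a \<preceq> b \<equiv> vle R V a b"

lemma valued_c: "valued R Vc"
  by (rule valued.intro[OF F]) (rule valued_axioms.intro[OF valuation_ring_c])

text \<open>Let c be nearest to x and q = (x - x') / (x - c), so that |q|_c < |l|_c. Equal fine
  leading terms at c need a radius strictly above |q|, which must stay strictly below l in the
  coarse valuation. Multiplying q by an element u of the coarse ring outside the fine one achieves
  both: |q| < |q u|, yet |q u|_c <= |q|_c.\<close>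

lemma radius_below:
  assumes l: "l \<in> univ M" "radius R Vc l" and C: "finite C" "C \<noteq> {}" "C \<subseteq> univ M"
    and x: "x \<in> univ M" "x' \<in> univ M" "x \<noteq> x'"
    and rv: "\<And>c. c \<in> C \<Longrightarrow> rveq R Vc l (x \<ominus>\<^bsub>R\<^esub> c) (x' \<ominus>\<^bsub>R\<^esub> c)"
  obtains l' where "l' \<in> univ M" "radius R V l'" "\<And>c. c \<in> C \<Longrightarrow> rveq R V l' (x \<ominus>\<^bsub>R\<^esub> c) (x' \<ominus>\<^bsub>R\<^esub> c)"
    "\<And>a b. a \<in> univ M \<Longrightarrow> b \<in> univ M \<Longrightarrow> rveq R V l' a b \<Longrightarrow> rveq R Vc l a b"
proof (cases "Vc \<subseteq> V")
  \<comment> \<open>If the two rings coincide there is no such u, and l itself serves.\<close>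
  case True
  then have "Vc = V" using V_subset_c by auto
  then show ?thesis using that[of l] l rv by simp
next
  case False
  then obtain u where u: "u \<in> Vc" "u \<notin> V" by blast
  interpret c: valued R Vc by (rule valued_c)
  have mono: "vle R V a b \<Longrightarrow> vle R Vc a b" for a b using V_subset_c by (rule vle_mono)
  obtain c where c: "c \<in> C" "\<And>c'. c' \<in> C \<Longrightarrow> x \<ominus>\<^bsub>R\<^esub> c \<preceq> x \<ominus>\<^bsub>R\<^esub> c'"
    using nearest_exists[OF C(1,2), of x] C(3) x(1) by (simp only: fld_simps) blast
  define b d where "b = x \<ominus>\<^bsub>R\<^esub> c" and "d = x \<ominus>\<^bsub>R\<^esub> x'"
  have cU: "c \<in> carrier R" using c(1) C(3) by auto
  have x': "x \<in> carrier R" "x' \<in> carrier R" and lU: "l \<in> carrier R" and uU: "u \<in> carrier R"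
    using x l u c.V_in by simp_all
  have bU: "b \<in> carrier R" and dU: "d \<in> carrier R" unfolding b_def d_def
    by (rule minus_closed[OF x'(1) cU], rule minus_closed[OF x'])
  have bd: "\<not> vle R Vc (l \<otimes>\<^bsub>R\<^esub> b) d"
    using rv[OF c(1)] x(3) x' cU minus_eq_iff[OF x' cU] minus_cancel[OF x' cU]
    by (simp add: rveq_def b_def d_def del: fld_simps)
  have b0: "b \<noteq> \<zero>\<^bsub>R\<^esub>"
    using bd lU dU c.zero_le[of d] r_null[of l] by metis
  define q where "q = inv\<^bsub>R\<^esub> b \<otimes>\<^bsub>R\<^esub> d"
  have q: "q \<in> carrier R" "b \<otimes>\<^bsub>R\<^esub> q = d" using bU dU b0 by (simp_all add: q_def del: fld_simps)
  have lq: "\<not> vle R Vc l q"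
    using bd q c.le_mult[of l q b] lU bU m_comm[of l b] by metis
  define l' where "l' = q \<otimes>\<^bsub>R\<^esub> u"
  have l'U: "l' \<in> carrier R" using q uU by (simp add: l'_def del: fld_simps)
  have l'q: "vle R Vc l' q"
    using c.le_V_mult[OF u(1) q(1)] m_comm[OF q(1) uU] by (simp add: l'_def del: fld_simps)
  have l1: "vle R Vc l \<one>\<^bsub>R\<^esub>" using l(2) c.le_one by (simp add: radius_def)
  \<comment> \<open>Otherwise l' would have coarse value at least 1, hence at least |l|_c.\<close>
  have "l' \<in> V"
  proof (rule ccontr)
    assume "l' \<notin> V"
    then have "\<one>\<^bsub>R\<^esub> \<preceq> l'" using le_total[OF l'U one_closed] le_one by blast
    then have "vle R Vc \<one>\<^bsub>R\<^esub> l'" by (rule mono)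
    then have "vle R Vc l q"
      using c.le_trans[OF lU one_closed l'U l1] c.le_trans[OF lU l'U q(1)] l'q by blast
    with lq show False by simp
  qed
  have u0: "u \<noteq> \<zero>\<^bsub>R\<^esub>" using u(2) V_zero by blast
  have q0: "q \<noteq> \<zero>\<^bsub>R\<^esub>"
  proof
    assume "q = \<zero>\<^bsub>R\<^esub>"
    then have "d = \<zero>\<^bsub>R\<^esub>" using q(2) bU r_null by metis
    then show False using x(3) minus_eq_zero[OF x'] by (simp add: d_def)
  qed
  have l'0: "l' \<noteq> \<zero>\<^bsub>R\<^esub>" using integral[of q u] q(1) uU u0 q0 unfolding l'_def by blast
  have rad: "radius R V l'" using \<open>l' \<in> V\<close> l'0 by (simp add: radius_def)
  have d0: "d \<noteq> \<zero>\<^bsub>R\<^esub>" using x(3) minus_eq_zero[OF x'] by (simp add: d_def)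
  have "l' \<otimes>\<^bsub>R\<^esub> b = d \<otimes>\<^bsub>R\<^esub> u"
    using q(1) uU bU unfolding l'_def q(2)[symmetric] by (simp add: m_ac del: fld_simps)
  moreover have "\<not> d \<otimes>\<^bsub>R\<^esub> u \<preceq> d"
  proof
    assume "d \<otimes>\<^bsub>R\<^esub> u \<preceq> d"
    then have "d \<otimes>\<^bsub>R\<^esub> u \<preceq> d \<otimes>\<^bsub>R\<^esub> \<one>\<^bsub>R\<^esub>" using dU by (simp del: fld_simps)
    then show False using le_mult_iff[OF uU one_closed dU d0] u(2) le_one by blast
  qed
  ultimately have near: "rveq R V l' (x \<ominus>\<^bsub>R\<^esub> c) (x' \<ominus>\<^bsub>R\<^esub> c)"
    unfolding rveq_def minus_cancel[OF x' cU] by (simp add: b_def d_def)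
  show ?thesis
  proof (rule that)
    show "l' \<in> univ M" using l'U by simp
    show "radius R V l'" by (rule rad)
    show "rveq R V l' (x \<ominus>\<^bsub>R\<^esub> c') (x' \<ominus>\<^bsub>R\<^esub> c')" if "c' \<in> C" for c'
      by (rule rveq_nearest[OF rad x' cU _ c(2)[OF that] near]) (use that C(3) in auto)
    show "rveq R Vc l a a'" if a: "a \<in> univ M" "a' \<in> univ M" "rveq R V l' a a'" for a a'
    proof (cases "a = a'")
      case False
      have aU: "a \<in> carrier R" "a' \<in> carrier R" using a by simp_all
      have diff: "a \<ominus>\<^bsub>R\<^esub> a' \<in> carrier R" using aU by (rule minus_closed)
      have less: "\<not> l' \<otimes>\<^bsub>R\<^esub> a \<preceq> a \<ominus>\<^bsub>R\<^esub> a'" using a(3) False by (simp add: rveq_def)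
      have a0: "a \<noteq> \<zero>\<^bsub>R\<^esub>" using less l'U diff zero_le[of "a \<ominus>\<^bsub>R\<^esub> a'"] r_null[of l'] by metis
      have "a \<ominus>\<^bsub>R\<^esub> a' \<preceq> l' \<otimes>\<^bsub>R\<^esub> a" using less le_total[OF diff m_closed[OF l'U aU(1)]] by blast
      \<comment> \<open>A strict inequality of fine values is only a weak one of coarse values;
        strictness is recovered from |q|_c < |l|_c.\<close>
      then have 1: "vle R Vc (a \<ominus>\<^bsub>R\<^esub> a') (a \<otimes>\<^bsub>R\<^esub> l')" using mono m_comm[OF l'U aU(1)] by metis
      have 2: "vle R Vc (a \<otimes>\<^bsub>R\<^esub> l') (a \<otimes>\<^bsub>R\<^esub> q)" using c.le_mult[OF l'U q(1) aU(1) l'q] .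
      have "\<not> vle R Vc (a \<otimes>\<^bsub>R\<^esub> l) (a \<ominus>\<^bsub>R\<^esub> a')"
      proof
        assume "vle R Vc (a \<otimes>\<^bsub>R\<^esub> l) (a \<ominus>\<^bsub>R\<^esub> a')"
        then have "vle R Vc (a \<otimes>\<^bsub>R\<^esub> l) (a \<otimes>\<^bsub>R\<^esub> q)"
          using 1 2 c.le_trans aU(1) diff l'U lU q(1) m_closed by metis
        then show False using c.le_mult_iff[OF lU q(1) aU(1) a0] lq by blast
      qed
      then show ?thesis using m_comm[OF lU aU(1)] by (simp add: rveq_def)
    qed simp
  qed
qed

end

primrec emb :: "('f, 'r) fm \<Rightarrow> ('f, 'r option) fm" where
  "emb (Eql s t) = Eql s t"
| "emb (Rel r ts) = Rel (Some r) ts"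
| "emb (Neg p) = Neg (emb p)"
| "emb (Conj p q) = Conj (emb p) (emb q)"
| "emb (Exi i p) = Exi i (emb p)"

lemma fv_emb [simp]: "fv (emb p) = fv p"
  by (induction p) auto

lemma wf_emb [simp]: "wf_fm (coarse_lang L) (emb p) = wf_fm L p"
  by (induction p) auto

lemma sat_emb:
  assumes "univ Mc = univ M" "fun_of Mc = fun_of M" "\<And>r. rel_of Mc (Some r) = rel_of M r"
  shows "sat Mc e (emb p) = sat M e p"
proof -
  have t: "tval Mc e = tval M e" for e
    using tval_cong_struct[OF assms(2)] by blast
  show ?thesis
    by (induction p arbitrary: e) (simp_all add: t assms(1,3))
qed

context coarse_setting
begin

lemma valued_struct_c: "valued_struct Lc Mc"
proof -
  have "wf_vlang Lc" using wf_lang by (simp add: wf_vlang_def)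
  moreover have "wf_struct Lc Mc" using wf by (simp add: wf_struct_def)
  ultimately show ?thesis using F valuation_ring_c by (simp add: valued_struct_def)
qed

text \<open>The coordinates of f outside A are zero, which is definable. A bound variable takes
  their place, and only parameters from A remain.\<close>

lemma points_definable:
  assumes \<theta>: "wf_fm L \<theta>" and f: "\<And>j. f j \<in> insert \<zero>\<^bsub>R\<^esub> A" and A: "A \<subseteq> univ M"
  shows "definable_set Lc Mc A (prep_points M \<theta> f)"
proof -
  interpret c: valued_struct Lc Mc by (rule valued_struct_c)
  have zero: "\<zero>\<^bsub>R\<^esub> \<in> univ M" using zero_closed by simp
  define \<rho> where "\<rho> = case_nat (Suc 0) (\<lambda>k. if f k \<in> A then Suc (Suc k) else 0)"
  define \<psi> where "\<psi> = ExB (Conj (fZero Lc 0) (ren \<rho> (emb \<theta>)))"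
  define e where "e = case_nat \<zero>\<^bsub>R\<^esub> f"
  have sat: "sat Mc (\<lambda>i. if i < 1 then [c] ! i else e i) \<psi> \<longleftrightarrow> sat M (case_nat c f) \<theta>" for c
  proof -
    have env: "(\<lambda>i. if i < 1 then [c] ! i else e i) = case_nat c f"
      by (rule ext) (simp add: e_def split: nat.split)
    have "(\<lambda>i. case_nat \<zero>\<^bsub>R\<^esub> (case_nat c f) (\<rho> i)) = case_nat c f"
    proof
      show "case_nat \<zero>\<^bsub>R\<^esub> (case_nat c f) (\<rho> i) = case_nat c f i" for i
        using f[of "i - 1"] by (cases i) (auto simp: \<rho>_def)
    qed
    moreover have "sat Mc (case_nat y (case_nat c f)) (fZero Lc 0) \<longleftrightarrow> y = \<zero>\<^bsub>R\<^esub>" if "y \<in> univ M" for y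
      using that by simp
    ultimately have "(\<exists>y\<in>univ M. sat Mc (case_nat y (case_nat c f)) (fZero Lc 0) \<and> sat Mc (\<lambda>i. case_nat y (case_nat c f) (\<rho> i)) (emb \<theta>))
        \<longleftrightarrow> sat Mc (case_nat c f) (emb \<theta>)"
      using zero by metis
    then show ?thesis unfolding env \<psi>_def using sat_emb[of Mc M] by simp
  qed
  show ?thesis
    unfolding definable_set_def definable_def
  proof (intro exI conjI)
    show "wf_fm Lc \<psi>" using \<theta> c.wf_lang by (simp add: \<psi>_def)
    have "fv (ren \<rho> (emb \<theta>)) \<subseteq> range \<rho>" using fv_ren[of \<rho> "emb \<theta>"] by blast
    then have "i = 0 \<or> e i \<in> A" if "Suc i \<in> fv (Conj (fZero Lc 0) (ren \<rho> (emb \<theta>)))" for i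
      using that by (auto simp: \<rho>_def e_def fZero_def split: nat.splits if_splits)
    then show "\<forall>i\<in>fv \<psi>. i < 1 \<or> e i \<in> A"
      using fv_ExB[of "Conj (fZero Lc 0) (ren \<rho> (emb \<theta>))"] unfolding \<psi>_def by blast
    show "(\<lambda>x. [x]) ` prep_points M \<theta> f = {xs \<in> tuples Mc 1. sat Mc (\<lambda>i. if i < 1 then xs ! i else e i) \<psi>}" (is "?A = ?B")
    proof (intro equalityI subsetI)
      fix xs assume "xs \<in> ?A"
      then obtain c where c: "xs = [c]" "c \<in> univ M" "sat M (case_nat c f) \<theta>" by blast
      then have "sat Mc (\<lambda>i. if i < 1 then [c] ! i else e i) \<psi>" unfolding sat by simp
      then show "xs \<in> ?B" using c by (simp add: tuples_def)
    next
      fix xs assume xs: "xs \<in> ?B"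
      then obtain c where c: "xs = [c]" "c \<in> univ M" by (auto simp: tuples_def length_Suc_conv)
      then have "sat M (case_nat c f) \<theta>" using xs unfolding sat[symmetric] by simp
      then show "xs \<in> ?A" using c by blast
    qed
  qed
qed

text \<open>The imaginary parameters are replaced by quantified representatives in the field. If x
  and x' have the same coarse leading terms relative to C, they agree for the family
  \<open>p2\<close> at a suitable fine radius. Back and forth then answers the representatives at x
  by others at x' that still represent the same imaginary parameters, so p has the same truth value
  at x and x'.\<close>

lemma coarse_preparation:
  assumes l: "l \<in> univ M" "radius R Vc l" and A: "A \<subseteq> univ M" and X: "X \<subseteq> univ M"
    and def: "definable_eq Lc Mc (Inl ` A \<union> rv_imag Lc Mc (val R Vc \<one>\<^bsub>R\<^esub>) S1 \<union> rv_imag Lc Mc (val R Vc l) S2) X"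
  shows "\<exists>C. definable_set Lc Mc A C \<and> prepares R Vc (val R Vc l) C X"
proof -
  interpret c: valued_struct Lc Mc by (rule valued_struct_c)
  have zero: "\<zero>\<^bsub>R\<^esub> \<in> univ M" and one: "\<one>\<^bsub>R\<^esub> \<in> univ M" using zero_closed one_closed by simp_all
  define P where "P = Inl ` A \<union> rv_imag Lc Mc (val R Vc \<one>\<^bsub>R\<^esub>) S1 \<union> rv_imag Lc Mc (val R Vc l) S2"
  obtain p e where p: "wf_fm (eq_lang Lc) p" "\<forall>i\<in>fv p. i < 1 \<or> e i \<in> P"
    "(\<lambda>x. [x]) ` Inl ` X = {xs \<in> tuples EQ 1. sat EQ (\<lambda>i. if i < 1 then xs ! i else e i) p}"
    using def[folded P_def] unfolding definable_eq_def definable_set_def definable_def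
    by (elim exE conjE) (rule that)
  have X_iff: "x \<in> X \<longleftrightarrow> sat EQ (\<lambda>i. if i < 1 then [Inl x] ! i else e i) p" if "x \<in> univ M" for x
  proof -
    have "x \<in> X \<longleftrightarrow> [Inl x :: 'v eq_elem] \<in> (\<lambda>x. [x]) ` Inl ` X" by auto
    also have "\<dots> \<longleftrightarrow> sat EQ (\<lambda>i. if i < 1 then [Inl x] ! i else e i) p"
      unfolding p(3) using that by (simp add: tuples_def eq_struct_simps)
    finally show ?thesis .
  qed
  define E where "E = snd (rv_sort Lc Mc)"
  have s: "rv_sort Lc Mc = (2, E)" using c.rv_sort_eq by (simp add: E_def)
  have sort: "is_sort Lc Mc (2, E)" using c.rv_sort_is_sort by (simp add: E_def)
  have mem_E: "([a, b], [a', b']) \<in> E \<longleftrightarrow> a \<in> univ M \<and> b \<in> univ M \<and> a' \<in> univ M \<and> b' \<in> univ M \<and>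
     (radius R Vc b \<and> radius R Vc b' \<and> vle R Vc b b' \<and> vle R Vc b' b \<and> rveq R Vc b a a' \<or>
      \<not> radius R Vc b \<and> \<not> radius R Vc b')" for a b a' b'
    using c.mem_rvE[of a b a' b'] by (simp add: E_def)
  define \<Sigma> where "\<Sigma> = {s' \<in> insert (2, E) (sorts p). is_sort Lc Mc s'}"
  have \<Sigma>: "finite \<Sigma>" "\<And>s'. s' \<in> \<Sigma> \<Longrightarrow> is_sort Lc Mc s'" "\<And>s'. s' \<in> sorts p \<Longrightarrow> is_sort Lc Mc s' \<Longrightarrow> s' \<in> \<Sigma>" "(2, E) \<in> \<Sigma>"
    using finite_sorts[of p] sort by (auto simp: \<Sigma>_def)
  \<comment> \<open>The variables with a leading-term parameter; the other free variables, apart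
    from 0, take values in A.\<close>
  define SV where "SV = {i \<in> fv p. \<not> i < 1 \<and> e i \<notin> Inl ` A}"
  have fin_SV: "finite SV" unfolding SV_def by (rule finite_subset[OF _ finite_fv[of p]]) auto
  \<comment> \<open>A parameter has radius 1 or l. In both cases |l|_c <= |r|_c, so equality of
    leading terms of radius l gives equality at r.\<close>
  have "\<exists>w r. w \<in> univ M \<and> r \<in> univ M \<and> radius R Vc r \<and> vle R Vc l r \<and> e i = Inr ((2, E), E `` {[w, r]})" if "i \<in> SV" for i
  proof -
    have "e i \<in> rv_imag Lc Mc (val R Vc \<one>\<^bsub>R\<^esub>) S1 \<union> rv_imag Lc Mc (val R Vc l) S2"
      using that p(2) by (auto simp: SV_def P_def)
    then obtain w r where wr: "w \<in> univ M" "r \<in> univ M" "val R Vc r = val R Vc \<one>\<^bsub>R\<^esub> \<or> val R Vc r = val R Vc l"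
      "e i = Inr ((2, E), E `` {[w, r]})"
      unfolding rv_imag_def Let_def s by auto
    have lV: "l \<in> Vc" "l \<noteq> \<zero>\<^bsub>R\<^esub>" using l by (simp_all add: radius_def)
    have r: "vle R Vc l r" "vle R Vc r \<one>\<^bsub>R\<^esub>"
      using wr(3) c.val_eq[of r "\<one>\<^bsub>R\<^esub>"] c.val_eq[of r l] c.le_one[of l] c.le_one[of r] wr(2) l(1) lV one
        c.le_trans[of l "\<one>\<^bsub>R\<^esub>" r] c.le_trans[of r l "\<one>\<^bsub>R\<^esub>"] by (simp; metis)+
    have "r \<noteq> \<zero>\<^bsub>R\<^esub>" using r(1) lV l(1) c.le_zero[of l] by auto
    then have "radius R Vc r" using r(2) c.le_one[of r] by (simp add: radius_def)
    then show ?thesis using wr r by blast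
  qed
  then obtain w r where wr: "\<And>i. i \<in> SV \<Longrightarrow> w i \<in> univ M \<and> r i \<in> univ M \<and> radius R Vc (r i) \<and> vle R Vc l (r i) \<and>
      e i = Inr ((2, E), E `` {[w i, r i]})"
    by metis
  define \<kappa> where "\<kappa> i = (if i \<in> SV then KSort (2, E) else KHome)" for i
  \<comment> \<open>Each imaginary parameter is represented by two coordinates, the field element
    and the radius.\<close>
  define NV where "NV = (\<lambda>(i, j). prod_encode (i, j)) ` (SV \<times> {0, 1})"
  have fin_NV: "finite NV" using fin_SV by (simp add: NV_def)
  have NV: "prod_encode (i, j) \<in> NV \<longleftrightarrow> i \<in> SV \<and> j < 2" for i j
    by (auto simp: NV_def)
  define e0 where "e0 x i = (if i = 0 then Inl x else if i \<in> fv p then e i else Inl \<zero>\<^bsub>R\<^esub>)" for x i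
  have X_iff': "x \<in> X \<longleftrightarrow> sat EQ (e0 x) p" if "x \<in> univ M" for x
    unfolding X_iff[OF that] by (rule sat_cong) (auto simp: e0_def)
  define i0 where "i0 = prod_encode (0, 0)"
  \<comment> \<open>Parameters from A stand at their coordinates and zero everywhere else, also
    where representatives will be put. Hence the preparing points depend on A only.\<close>
  define f0 where "f0 k = (case prod_decode k of (i, j) \<Rightarrow>
     if j = 0 \<and> i \<noteq> 0 \<and> i \<in> fv p \<and> i \<notin> SV then projl (e i) else \<zero>\<^bsub>R\<^esub>)" for k
  have home: "e i = Inl (projl (e i))" "projl (e i) \<in> A" if "i \<noteq> 0" "i \<in> fv p" "i \<notin> SV" for i
    using that by (auto simp: SV_def)
  have f0_A: "f0 k \<in> insert \<zero>\<^bsub>R\<^esub> A" for k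
    using home by (auto simp: f0_def split: prod.split)
  have f0_in: "f0 k \<in> univ M" for k using f0_A[of k] A zero by auto
  define Q where "Q l f f' \<longleftrightarrow> eq_agree \<Sigma> \<kappa> p f f' \<and> (\<forall>v\<in>NV. rveq R V l (f v) (f' v))" for l f f'
  have "forced (\<lambda>l. eq_agree \<Sigma> \<kappa> p)"
    by (rule forced_eq_agree[OF \<Sigma>(1,2) p(1) \<Sigma>(3)]) (use \<Sigma>(4) in \<open>auto simp: \<kappa>_def split: if_splits\<close>)
  moreover have "forced (\<lambda>l f f'. \<forall>v\<in>NV. rveq R V l (f v) (f' v))"
    using forced_ball[OF fin_NV, of "\<lambda>v l f f'. rveq R V l (f v) (f' v)"] forced_rveq[of "Var _"] by simp
  ultimately have "forced Q" unfolding Q_def by (rule forced_conj)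
  \<comment> \<open>The representatives are quantified away before preparation is applied, so none
    of them enters C.\<close>
  define Q' where "Q' l f f' \<longleftrightarrow> (\<forall>x. (\<forall>j. x j \<in> univ M) \<longrightarrow>
    (\<exists>x'. (\<forall>j. x' j \<in> univ M) \<and> Q l (override_on f x NV) (override_on f' x' NV)))" for l f f'
  have "forced Q'" unfolding Q'_def by (rule forced_ex_set[OF fin_NV \<open>forced Q\<close>])
  then obtain p2 where p2: "family p2"
    "\<And>l f f'. l \<in> univ M \<Longrightarrow> radius R V l \<Longrightarrow> (\<And>j. f j \<in> univ M) \<Longrightarrow> (\<And>j. f' j \<in> univ M) \<Longrightarrow> feq M p2 l f f' \<Longrightarrow> Q' l f f'"
    using forcedE[of Q'] by blast
  have wf_p2: "wf_fm L p2" and inv_p2: "\<And>N :: ('f, 'r, 'u) struct. models L N T \<Longrightarrow> rv_invariant L N p2"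
    using p2(1) by (auto simp: family_def)
  obtain \<theta> m where \<theta>: "wf_fm L \<theta>"
    "\<And>f. (\<And>j. f j \<in> univ M) \<Longrightarrow> finite (prep_points M \<theta> f) \<and> card (prep_points M \<theta> f) \<le> m \<and> prep_points M \<theta> f \<noteq> {}"
    "\<And>f l z. (\<And>j. f j \<in> univ M) \<Longrightarrow> l \<in> univ M \<Longrightarrow> radius (fld L M) (vring L M) l \<Longrightarrow> (\<And>j. z j \<in> univ M) \<Longrightarrow>
      rv_prepares L M p2 i0 (prep_points M \<theta> f) f l z"
    using uniform_preparation[OF valued_struct_axioms inj_g h T wf_p2 inv_p2, of i0] by blast
  define C where "C = prep_points M \<theta> f0"
  have C: "finite C" "C \<noteq> {}" "C \<subseteq> univ M" using \<theta>(2)[of f0] f0_in by (auto simp: C_def)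
  define W where "W k = (case prod_decode k of (i, j) \<Rightarrow> if i \<in> SV \<and> j < 2 then (if j = 0 then w i else r i) else \<zero>\<^bsub>R\<^esub>)" for k
  have W_in: "W k \<in> univ M" for k using wr zero by (auto simp: W_def split: prod.split)
  have W: "W (prod_encode (i, 0)) = w i" "W (prod_encode (i, 1)) = r i" if "i \<in> SV" for i
    using that by (simp_all add: W_def)
  have not_SV: "0 \<notin> SV" by (simp add: SV_def)
  have lifts: "lifts \<Sigma> \<kappa> (override_on (f0(i0 := x)) W' NV) (e0 x)"
    if W': "\<And>i. i \<in> SV \<Longrightarrow> E `` {[W' (prod_encode (i, 0)), W' (prod_encode (i, 1))]} = E `` {[w i, r i]}" for x W'
    unfolding lifts_def
  proof (intro allI conjI impI)
    fix v
    show "junk \<Sigma> (e0 x v)" if "\<kappa> v = KJunk" using that by (simp add: \<kappa>_def split: if_splits)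
    let ?f = "override_on (f0(i0 := x)) W' NV"
    show "represents (\<kappa> v) (\<lambda>j. ?f (prod_encode (v, j))) (e0 x v)"
    proof (cases "v \<in> SV")
      case True
      have "map (\<lambda>j. ?f (prod_encode (v, j))) [0..<2] = [W' (prod_encode (v, 0)), W' (prod_encode (v, 1))]"
        using True by (simp add: override_on_def NV numeral_2_eq_2)
      moreover have "v \<noteq> 0" "v \<in> fv p" using True by (auto simp: SV_def)
      ultimately show ?thesis using True wr W'[OF True] by (simp add: \<kappa>_def e0_def)
    next
      case False
      then have "?f (prod_encode (v, 0)) = (f0(i0 := x)) (prod_encode (v, 0))"
        by (simp add: override_on_def NV)
      moreover have "e0 x v = Inl ((f0(i0 := x)) (prod_encode (v, 0)))"
        using False home(1)[of v] by (auto simp: e0_def i0_def f0_def)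
      ultimately show ?thesis using False by (simp add: \<kappa>_def)
    qed
  qed
  have "prepares R Vc (val R Vc l) C X"
    unfolding c.prepares_iff[OF l(2)[folded fld_c], unfolded fld_c] fld_simps
  proof (intro conjI ballI impI)
    fix x x' assume x: "x \<in> univ M" "x' \<in> univ M" and rv: "\<forall>c\<in>C. rveq R Vc l (x \<ominus>\<^bsub>R\<^esub> c) (x' \<ominus>\<^bsub>R\<^esub> c)"
    show "x \<in> X \<longleftrightarrow> x' \<in> X"
    proof (cases "x = x'")
      case False
      obtain l' where l': "l' \<in> univ M" "radius R V l'" "\<And>c. c \<in> C \<Longrightarrow> rveq R V l' (x \<ominus>\<^bsub>R\<^esub> c) (x' \<ominus>\<^bsub>R\<^esub> c)"
        "\<And>a b. a \<in> univ M \<Longrightarrow> b \<in> univ M \<Longrightarrow> rveq R V l' a b \<Longrightarrow> rveq R Vc l a b"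
        using radius_below[OF l C x False, of thesis] rv by blast
      have fx: "(f0(i0 := x)) j \<in> univ M" "(f0(i0 := x')) j \<in> univ M" for j using f0_in x by auto
      have "feq M p2 l' (f0(i0 := x)) (f0(i0 := x'))"
        unfolding feq_def
      proof (intro allI impI)
        fix z :: "nat \<Rightarrow> 'v" assume z: "\<forall>j. z j \<in> univ M"
        \<comment> \<open>The radius l' was found for this pair x, x'; C was fixed before and
          prepares at every radius.\<close>
        have "rv_prepares L M p2 i0 C f0 l' z"
          unfolding C_def by (rule \<theta>(3)) (use f0_in l' z in auto)
        then show "sat M (mix (f0(i0 := x)) l' z) p2 = sat M (mix (f0(i0 := x')) l' z) p2"
          using x l'(3) unfolding rv_prepares_def by blast
      qed
      then have "Q' l' (f0(i0 := x)) (f0(i0 := x'))" by (rule p2(2)[OF l'(1,2) fx])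
      then obtain W' where W': "\<And>j. W' j \<in> univ M"
        "Q l' (override_on (f0(i0 := x)) W NV) (override_on (f0(i0 := x')) W' NV)"
        unfolding Q'_def using W_in by blast
      have rvW: "rveq R V l' (W v) (W' v)" if "v \<in> NV" for v
        using W'(2) that unfolding Q_def by (metis override_on_apply_in)
      \<comment> \<open>The answering pair (w', r') has the same class: r' has the value of r, and
        w' the fine leading term of w at radius l', hence the same coarse leading term at radius l
        and at radius r.\<close>
      have "E `` {[W' (prod_encode (i, 0)), W' (prod_encode (i, 1))]} = E `` {[w i, r i]}" if i: "i \<in> SV" for i
      proof -
        have v: "prod_encode (i, 0) \<in> NV" "prod_encode (i, 1) \<in> NV" using i by (simp_all add: NV)
        define w' r' where "w' = W' (prod_encode (i, 0))" and "r' = W' (prod_encode (i, 1))"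
        have in_univ: "w' \<in> univ M" "r' \<in> univ M" "w i \<in> univ M" "r i \<in> univ M"
          using W'(1) wr[OF i] by (auto simp: w'_def r'_def)
        have fine: "rveq R V l' (w i) w'" "rveq R V l' (r i) r'"
          using rvW[OF v(1)] rvW[OF v(2)] W[OF i] by (simp_all add: w'_def r'_def)
        have ri: "radius R Vc (r i)" "vle R Vc l (r i)" using wr[OF i] by auto
        have r': "vle R V (r i) r' \<and> vle R V r' (r i)"
          using rveq_le[OF l'(2), of "r i" r'] in_univ fine by simp
        then have r'c: "vle R Vc (r i) r'" "vle R Vc r' (r i)" using vle_mono[OF V_subset_c] by blast+
        have "radius R Vc r'"
          using ri(1) mem_Vc_cong[of r' "r i"] r' in_univ le_zero[of "r i"] by (auto simp: radius_def)
        moreover have "rveq R Vc (r i) (w i) w'"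
          using c.rveq_radius_cong[of l "r i" "w i" w'] l'(4)[OF _ _ fine(1)] l ri in_univ by simp
        ultimately have "([w i, r i], [w', r']) \<in> E" unfolding mem_E using ri r'c in_univ by blast
        moreover have "equiv (tuples M 2) E" using sort by (simp add: is_sort_def)
        ultimately show ?thesis unfolding w'_def[symmetric] r'_def[symmetric] by (metis equiv_class_eq)
      qed
      then have "lifts \<Sigma> \<kappa> (override_on (f0(i0 := x')) W' NV) (e0 x')" by (rule lifts)
      moreover have "lifts \<Sigma> \<kappa> (override_on (f0(i0 := x)) W NV) (e0 x)"
        by (rule lifts) (simp only: W)
      moreover have "eq_agree \<Sigma> \<kappa> p (override_on (f0(i0 := x)) W NV) (override_on (f0(i0 := x')) W' NV)"
        using W'(2) by (simp add: Q_def)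
      moreover have "\<forall>v. \<kappa> v = KJunk \<longrightarrow> e0 x v = e0 x' v" by (simp add: \<kappa>_def)
      ultimately have "sat EQ (e0 x) p = sat EQ (e0 x') p" unfolding eq_agree_def by blast
      then show ?thesis using X_iff' x by simp
    qed simp
  qed (use C in auto)
  moreover have "definable_set Lc Mc A C"
    unfolding C_def by (rule points_definable[OF \<theta>(1) f0_A A])
  ultimately show ?thesis by blast
qed

end

section \<open>From the given field to all models of the expanded theory\<close>

lemma (in coarse_setting) equichar_0_c:
  assumes "equichar_0 R V" "Vc \<noteq> univ M"
  shows "equichar_0 R Vc"
proof -
  interpret c: valued R Vc by (rule valued_c)
  show ?thesis unfolding c.equichar_0_iff
  proof (intro conjI allI impI)
    show "Vc \<noteq> carrier R" using assms(2) by simp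
    fix n :: nat assume "n > 0"
    then have "vle R V \<one>\<^bsub>R\<^esub> (add_pow R n \<one>\<^bsub>R\<^esub>)" using assms(1) unfolding equichar_0_iff by blast
    \<comment> \<open>A unit of the fine ring is a unit of the coarse ring.\<close>
    then show "vle R Vc \<one>\<^bsub>R\<^esub> (add_pow R n \<one>\<^bsub>R\<^esub>)" by (rule vle_mono[OF V_subset_c])
  qed
qed

lemma (in coarse_setting) coarse_preparation_value:
  assumes "\<kappa> \<in> value_group R Vc" "val_le R Vc \<kappa> (val R Vc \<one>\<^bsub>R\<^esub>)" "A \<subseteq> univ M" "X \<subseteq> univ M"
    "definable_eq Lc Mc (Inl ` A \<union> rv_imag Lc Mc (val R Vc \<one>\<^bsub>R\<^esub>) S1 \<union> rv_imag Lc Mc \<kappa> S2) X"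
  shows "\<exists>C. definable_set Lc Mc A C \<and> prepares R Vc \<kappa> C X"
proof -
  interpret c: valued R Vc by (rule valued_c)
  obtain l where l: "l \<in> univ M" "l \<noteq> \<zero>\<^bsub>R\<^esub>" "\<kappa> = val R Vc l"
    using assms(1) by (auto simp: value_group_def)
  then have "radius R Vc l" using c.radius_iff[of l] assms(2) by simp
  then show ?thesis using coarse_preparation l assms(3-5) by blast
qed

theorem corollary4p2p4:
  fixes L :: "('f, 'r) vlang" and K :: "('f, 'r, 'k) struct" and Oc :: "'k set"
  assumes "wf_vlang L"
    and "wf_struct L K"
    and "equichar_0 (fld L K) (vring L K)"
    and universe_large: "\<exists>g :: ('f + 'r) + nat \<Rightarrow> 'u. inj g"
    and "h_minimal TYPE('u) \<infinity> L (Th L K)"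
    and "valuation_ring (fld L K) Oc"
    and "vring L K \<subseteq> Oc"
    and "Oc \<noteq> univ K"
  shows "h_minimal TYPE('v) \<infinity> (coarse_lang L) (Th (coarse_lang L) (expand K Oc))"
proof -
  let ?Lc = "coarse_lang L" and ?Kc = "expand K Oc"
  obtain g :: "('f + 'r) + nat \<Rightarrow> 'u" where g: "inj g" using universe_large by blast
  have K: "valued_struct L K"
    using assms(1-3) by (simp add: valued_struct_def equichar_0_def valued_field_def)
  interpret K: valued_struct L K by (rule K)
  interpret Oc: valued "fld L K" Oc
    by (rule valued.intro[OF K.F]) (rule valued_axioms.intro[OF assms(6)])
  have Kc: "univ ?Kc = univ K" "fun_of ?Kc = fun_of K" "\<And>r. rel_of ?Kc (Some r) = rel_of K r"
    "\<And>x. rel_of ?Kc None [x] \<longleftrightarrow> x \<in> Oc"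
    by (auto simp: expand_def)
  have wf_Kc: "wf_struct ?Lc ?Kc" using assms(2) by (simp add: wf_struct_def Kc tuples_def)
  have wf_syms: "farity L (plus_sym L) = 2" "farity L (times_sym L) = 2" "rarity L (vring_sym L) = 1"
    using assms(1) by (simp_all add: wf_vlang_def)
  have main: "equichar_0 (fld ?Lc M) (vring ?Lc M) \<and>
     (\<forall>\<kappa>\<in>value_group (fld ?Lc M) (vring ?Lc M).
        val_le (fld ?Lc M) (vring ?Lc M) \<kappa> (val (fld ?Lc M) (vring ?Lc M) \<one>\<^bsub>fld ?Lc M\<^esub>) \<longrightarrow>
        (\<forall>A S1 S2 X. A \<subseteq> univ M \<and> X \<subseteq> univ M \<and>
           definable_eq ?Lc M (Inl ` A \<union> rv_imag ?Lc M (val (fld ?Lc M) (vring ?Lc M) \<one>\<^bsub>fld ?Lc M\<^esub>) S1 \<union>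
             rv_imag ?Lc M \<kappa> S2) X \<longrightarrow>
           (\<exists>C. definable_set ?Lc M A C \<and> prepares (fld ?Lc M) (vring ?Lc M) \<kappa> C X)))"
    if M: "models ?Lc M (Th ?Lc ?Kc)" for M :: "('f, 'r option, 'v) struct"
  proof -
    \<comment> \<open>The L-reduct of an arbitrary model of the expanded theory; its theory contains
      that of K.\<close>
    define N :: "('f, 'r, 'v) struct" where
      "N = \<lparr>univ = univ M, fun_of = fun_of M, rel_of = (\<lambda>r. rel_of M (Some r))\<rparr>"
    have N: "univ M = univ N" "fun_of M = fun_of N" "\<And>r. rel_of M (Some r) = rel_of N r"
      by (simp_all add: N_def)
    have transfer: "sat M e p" if "wf_fm ?Lc p" "\<And>e. (\<And>i. e i \<in> univ K) \<Longrightarrow> sat ?Kc e p" "\<And>i. e i \<in> univ N" for p e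
      by (rule models_transfer[OF that(1) wf_Kc _ M]) (use that(2,3) in \<open>simp_all add: Kc N\<close>)
    have transfer_N: "sat N e p" if "wf_fm L p" "\<And>e. (\<And>i. e i \<in> univ K) \<Longrightarrow> sat K e p" "\<And>i. e i \<in> univ N" for p e
      using transfer[of "emb p" e] that sat_emb[of ?Kc K, OF Kc(1-3)] sat_emb[of M N, OF N] by simp
    have wf_N: "wf_struct L N"
      using M by (simp add: models_def wf_struct_def N tuples_def)
    have "p \<in> Th L N" if "p \<in> Th L K" for p
    proof -
      have p: "wf_fm L p" "fv p = {}" "\<And>e. sat K e p" using that by (simp_all add: Th_def)
      have "emb p \<in> Th ?Lc ?Kc" using p sat_emb[of ?Kc K, OF Kc(1-3)] by (simp add: Th_def)
      then have "sat M e (emb p)" for e using M by (simp add: models_def)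
      then show ?thesis using p sat_emb[of M N, OF N] by (simp add: Th_def)
    qed
    then have Th: "Th L K \<subseteq> Th L N" by blast
    have nonempty: "univ N \<noteq> {}" using wf_N by (simp add: wf_struct_def)
    then obtain d where d: "d \<in> univ N" by blast
    \<comment> \<open>N lives in \<open>'v\<close>, where h-minimality is not assumed; that it is a
      valued field of equi-characteristic 0 comes from the axiom scheme instead.\<close>
    have "sat N (\<lambda>_. d) (valued_axiom L n)" for n
      by (rule transfer_N) (use wf_valued_axiom[OF assms(1)] K.sat_valued_axiomI[OF assms(3)] d in simp_all)
    then have vs_N: "valued_struct L N" and ec_N: "equichar_0 (fld L N) (vring L N)"
      using valued_structI[OF assms(1) wf_N] by blast+
    interpret N: valued_struct L N by (rule vs_N)
    have Vc: "x \<in> vring ?Lc M \<longleftrightarrow> x \<in> univ N \<and> rel_of M None [x]" for x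
      by (simp add: vring_def coarse_lang_def N)
    \<comment> \<open>To be a proper coarsening is first-order: inclusion, closure under sum and
      product, and properness are transferred from the expansion of K to M one by one.\<close>
    have sub: "vring L N \<subseteq> vring ?Lc M"
    proof
      fix x assume x: "x \<in> vring L N"
      then have xN: "x \<in> univ N" by (simp add: vring_def)
      have "sat M (\<lambda>_. x) (Imp (emb (fV L 0)) (Rel None [Var 0]))"
        by (rule transfer) (use assms(7) xN wf_syms in \<open>auto simp: sat_emb[of ?Kc K, OF Kc(1-3)] Kc fV_def vring_def\<close>)
      then show "x \<in> vring ?Lc M" using x xN by (simp add: sat_emb[of M N, OF N] Vc)
    qed
    have closed: "x \<oplus>\<^bsub>fld L N\<^esub> y \<in> vring ?Lc M \<and> x \<otimes>\<^bsub>fld L N\<^esub> y \<in> vring ?Lc M"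
      if xy: "x \<in> vring ?Lc M" "y \<in> vring ?Lc M" for x y
    proof -
      have in_N: "x \<in> univ N" "y \<in> univ N" using xy by (simp_all add: Vc)
      have "sat M (case_nat x (\<lambda>_. y)) (Imp (Conj (Rel None [Var 0]) (Rel None [Var 1]))
          (Conj (Rel None [tadd L (Var 0) (Var 1)]) (Rel None [tmul L (Var 0) (Var 1)])))"
      proof (rule transfer)
        show "case_nat x (\<lambda>_. y) i \<in> univ N" for i using in_N by (cases i) auto
      qed (use Oc.V_add Oc.V_mult wf_syms in \<open>simp_all add: Kc\<close>)
      then show ?thesis
        using xy N.a_closed[of x y] N.m_closed[of x y] in_N by (simp add: Vc N)
    qed
    have "sat M (\<lambda>_. d) (ExB (Neg (Rel None [Var 0])))"
      by (rule transfer) (use assms(8) Oc.V_carrier d in \<open>auto simp: Kc\<close>)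
    then have proper: "vring ?Lc M \<noteq> univ N" by (auto simp: Vc N)
    have "valuation_ring (fld L N) (vring ?Lc M)"
      unfolding valuation_ring_def
    proof (intro conjI ballI)
      show "subring (vring ?Lc M) (fld L N)"
      proof (rule N.subringI)
        show "vring ?Lc M \<subseteq> carrier (fld L N)" by (auto simp: Vc)
        show "\<one>\<^bsub>fld L N\<^esub> \<in> vring ?Lc M" using N.V_one sub by blast
        fix h assume h: "h \<in> vring ?Lc M"
        \<comment> \<open>Negation is multiplication by -1, which lies in the fine ring.\<close>
        have "\<ominus>\<^bsub>fld L N\<^esub> \<one>\<^bsub>fld L N\<^esub> \<in> vring ?Lc M" using N.V_minus[OF N.V_one] sub by blast
        then have "(\<ominus>\<^bsub>fld L N\<^esub> \<one>\<^bsub>fld L N\<^esub>) \<otimes>\<^bsub>fld L N\<^esub> h \<in> vring ?Lc M" using closed h by blast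
        moreover have "(\<ominus>\<^bsub>fld L N\<^esub> \<one>\<^bsub>fld L N\<^esub>) \<otimes>\<^bsub>fld L N\<^esub> h = \<ominus>\<^bsub>fld L N\<^esub> h"
          using N.l_minus[OF N.one_closed, of h] N.l_one[of h] h by (simp add: Vc del: fld_simps(2))
        ultimately show "\<ominus>\<^bsub>fld L N\<^esub> h \<in> vring ?Lc M" by metis
        fix h' assume "h' \<in> vring ?Lc M"
        then show "h \<otimes>\<^bsub>fld L N\<^esub> h' \<in> vring ?Lc M" "h \<oplus>\<^bsub>fld L N\<^esub> h' \<in> vring ?Lc M" using closed h by blast+
      qed
      \<comment> \<open>The inversion clause is inherited from the smaller ring.\<close>
      show "x \<in> vring ?Lc M \<or> inv\<^bsub>fld L N\<^esub> x \<in> vring ?Lc M" if "x \<in> carrier (fld L N) - {\<zero>\<^bsub>fld L N\<^esub>}" for x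
        using N.V_or_inv[of x] that sub by blast
    qed
    then interpret coarse_setting L N g "Th L K" M
      by unfold_locales (use g assms(5) Th N sub in simp_all)
    show ?thesis
      unfolding fld_c N(1)
      using equichar_0_c[OF ec_N proper] coarse_preparation_value by blast
  qed
  then show ?thesis unfolding h_minimal_def Let_def by meson
qed

end
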